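(* For each $n\in\mathbb{N}^+$ there is a compact set $K\subset\mathbb{R}^{n+1}$ and, for each $f\in C(K,\mathbb{R}^n)$, a point $y_f\in\mathbb{R}^n$ such that (i) $d^n_H(K)=1$ and $d^n_P(K)=n+1$; (ii) for a generic $f\in C(K,\mathbb{R}^n)$, $\dim_H f^{-1}(y)<1$ for all $y\in\mathbb{R}^n\setminus\{y_f\}$; (iii) for every $f\in C(K,\mathbb{R}^n)$, $\dim_P f^{-1}(y)<n+1$ for all $y\in\mathbb{R}^n\setminus\{y_f\}$.
   Context: $\dim_T$, $\dim_H$, $\dim_P$ denote the topological (small inductive), Hausdorff and packing dimensions, with $\dim\emptyset=-1$ for all of them. For $\dim_{*}\in\{\dim_H,\dim_P\}$, a separable metric space $X$ and $n\in\mathbb{N}^+$, $d^n_{*}(X)=\inf\{\dim_{*}(X\setminus F): F\subset X$ is an $F_\sigma$ set with $\dim_T F\leq n-1\}$. $C(K,\mathbb{R}^n)$ is the complete metric space of continuous maps $K\to\mathbb{R}^n$ with the maximum norm. A property holds for a generic $f\in C(K,\mathbb{R}^n)$ if the set of $f$ having it is co-meager. *)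

theory Defs
  imports "HOL-Analysis.Analysis"
begin

section \<open>Hausdorff dimension\<close>

text \<open>
  The case distinction implements the conventions \<open>0\<^sup>0 = 1\<close> for nonempty sets (note that
  \<^term>\<open>0 powr 0 = (0::real)\<close>) and \<open>(diam {})\<^sup>s = 0\<close>.
\<close>
definition diam_power :: "real \<Rightarrow> 'a::metric_space set \<Rightarrow> ennreal" where
  "diam_power s U =
     (if U = {} then 0 else if s = 0 then 1 else ennreal (diameter U powr s))"

text \<open>\<^const>\<open>diameter\<close> is only meaningful on bounded sets, hence the boundedness requirement.\<close>
definition hausdorff_premeasure :: "real \<Rightarrow> real \<Rightarrow> 'a::metric_space set \<Rightarrow> ennreal" where
  "hausdorff_premeasure s \<delta> A =
     (INF U \<in> {U :: nat \<Rightarrow> 'a set. A \<subseteq> (\<Union>i. U i) \<and> (\<forall>i. bounded (U i) \<and> diameter (U i) \<le> \<delta>)}.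
        \<Sum>i. diam_power s (U i))"

definition hausdorff_measure :: "real \<Rightarrow> 'a::metric_space set \<Rightarrow> ennreal" where
  "hausdorff_measure s A = (SUP \<delta> \<in> {0<..}. hausdorff_premeasure s \<delta> A)"

definition hausdorff_dim :: "'a::metric_space set \<Rightarrow> ereal" where
  "hausdorff_dim A =
     (if A = {} then -1 else Inf (ereal ` {s. 0 \<le> s \<and> hausdorff_measure s A = 0}))"

section \<open>Packing dimension\<close>

text \<open>Only meaningful for totally bounded sets.\<close>
definition covering_number :: "real \<Rightarrow> 'a::metric_space set \<Rightarrow> nat" where
  "covering_number \<epsilon> A =
     (LEAST k. \<exists>\<U>. finite \<U> \<and> card \<U> = k \<and> A \<subseteq> \<Union>\<U> \<and> (\<forall>U\<in>\<U>. bounded U \<and> diameter U \<le> \<epsilon>))"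

definition upper_box_dim :: "'a::metric_space set \<Rightarrow> ereal" where
  "upper_box_dim A =
     (if A = {} then -1
      else if totally_bounded A
        then Limsup (at_right 0) (\<lambda>\<epsilon>. ereal (ln (real (covering_number \<epsilon> A)) / ln (1 / \<epsilon>)))
      else \<infinity>)"

text \<open>The packing dimension as the countably stable modification of the upper box dimension.\<close>
definition packing_dim :: "'a::metric_space set \<Rightarrow> ereal" where
  "packing_dim A =
     (if A = {} then -1
      else (INF X \<in> {X :: nat \<Rightarrow> 'a set. A = (\<Union>i. X i)}. SUP i. upper_box_dim (X i)))"

section \<open>The quantities $d^n_H$ and $d^n_P$\<close>

text \<open>
  \<^const>\<open>dimension_le\<close> (infix \<open>dim_le\<close>) is the bound on the small inductive dimension.
\<close>
definition d_dim :: "('a::metric_space set \<Rightarrow> ereal) \<Rightarrow> nat \<Rightarrow> 'a set \<Rightarrow> ereal" where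
  "d_dim dim_fn n X =
     (INF F \<in> {F. F \<subseteq> X \<and> fsigma_in (top_of_set X) F \<and> top_of_set F dim_le (int n - 1)}.
        dim_fn (X - F))"

abbreviation d_hausdorff :: "nat \<Rightarrow> 'a::metric_space set \<Rightarrow> ereal" where
  "d_hausdorff \<equiv> d_dim hausdorff_dim"

abbreviation d_packing :: "nat \<Rightarrow> 'a::metric_space set \<Rightarrow> ereal" where
  "d_packing \<equiv> d_dim packing_dim"

section \<open>Spaces of continuous maps and genericity\<close>

text \<open>
  \<open>C(K, 'b)\<close> with the supremum metric. Its points are the continuous maps on \<open>K\<close>, represented by
  functions that are \<^const>\<open>undefined\<close> outside \<open>K\<close>; boundedness is automatic for compact \<open>K\<close>.
\<close>
definition C_metric :: "'a::topological_space set \<Rightarrow> ('a \<Rightarrow> 'b::metric_space) metric" where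
  "C_metric K = cfunspace (top_of_set K) euclidean_metric"

lemma mspace_C_metric:
  assumes "compact K"
  shows "mspace (C_metric K :: ('a::topological_space \<Rightarrow> 'b::metric_space) metric) =
           {f. f \<in> extensional K \<and> continuous_on K f}"
  using compact_imp_bounded[OF compact_continuous_image[OF _ assms]]
  by (auto simp: C_metric_def)

definition nowhere_dense_in :: "'a topology \<Rightarrow> 'a set \<Rightarrow> bool" where
  "nowhere_dense_in X S \<longleftrightarrow> S \<subseteq> topspace X \<and> X interior_of (X closure_of S) = {}"

definition meager_in :: "'a topology \<Rightarrow> 'a set \<Rightarrow> bool" where
  "meager_in X S \<longleftrightarrow> (\<exists>\<N>. countable \<N> \<and> (\<forall>N\<in>\<N>. nowhere_dense_in X N) \<and> S = \<Union>\<N>)"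

definition comeager_in :: "'a topology \<Rightarrow> 'a set \<Rightarrow> bool" where
  "comeager_in X S \<longleftrightarrow> S \<subseteq> topspace X \<and> meager_in X (topspace X - S)"

definition for_generic_C ::
    "'a::topological_space set \<Rightarrow> (('a \<Rightarrow> 'b::metric_space) \<Rightarrow> bool) \<Rightarrow> bool" where
  "for_generic_C K P \<longleftrightarrow>
     comeager_in (mtopology_of (C_metric K)) {f \<in> mspace (C_metric K). P f}"

definition fiber :: "'a set \<Rightarrow> ('a \<Rightarrow> 'b) \<Rightarrow> 'b \<Rightarrow> 'a set" where
  "fiber K f y = {x \<in> K. f x = y}"

end

theory Submission
  imports Defs
begin

text \<open>
  Let \<open>n\<close> be the dimension of the target. Take Cantor sets \<open>C\<^sub>i\<close> on the line whose Hausdorff and upper box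
  dimensions both equal \<open>\<alpha>\<^sub>i < 1\<close>, with \<open>\<alpha>\<^sub>i\<close> increasing to \<open>1\<close>, and let \<open>K\<close> be the union of the products
  \<open>K\<^sub>i = C\<^sub>i \<times> [0, 2\<^sup>-\<^sup>i]\<^sup>n\<close>, shrinking to the origin, together with the origin. Put \<open>y\<^sub>f = f 0\<close>: a fibre over
  another point avoids a neighbourhood of \<open>0\<close> and hence lies in finitely many \<open>K\<^sub>i\<close>.

  A set of dimension at most \<open>n - 1\<close> contains no \<open>n\<close>-cube (by Brouwer), so the complement of an
  admissible \<open>F\<^sub>\<sigma>\<close> set is dense in each \<open>K\<^sub>i\<close> and projects onto \<open>C\<^sub>i\<close>. This bounds its Hausdorff dimension
  below by \<open>\<alpha>\<^sub>i\<close> and, by Baire's theorem, its packing dimension below by \<open>n + \<alpha>\<^sub>i\<close>, which is the upper box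
  dimension of \<open>K\<^sub>i\<close>. Conversely, removing from \<open>K\<close> everything outside a \<open>G\<^sub>\<delta>\<close> set of very thin tubes around
  the points with rational last \<open>n\<close> coordinates leaves a set of Hausdorff dimension at most \<open>1\<close>.

  For the generic statement, approximate \<open>f\<close> by a Lipschitz map and add a small but rapidly
  oscillating zigzag in each of the last \<open>n\<close> coordinates: on every grid cell the fibres become Lipschitz
  graphs over subsets of \<open>C\<^sub>i\<close>, and the resulting covers survive small perturbations of the map.
\<close>

text \<open>The two dimensions react differently to a dense \<open>G_delta\<close> subset of a
  product. Its Hausdorff dimension can be kept small, because neighbourhoods of countably many flats
  may be thinned at will. Its packing dimension cannot: in every countable decomposition, Baire's
  theorem finds a piece that is dense in a relatively open part, and box counting does not
  distinguish a set from its closure. This is the source of the gap between \<open>1\<close> and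
  \<open>n + 1\<close>. The strict inequalities for fibres dictate the exponents. Each must stay
  below \<open>1\<close>, so that finitely many pieces leave a margin, while their supremum has to
  be \<open>1\<close>. The price is an accumulation point, and nothing is claimed about the fibre
  through it. The exponents being below \<open>1\<close> also makes the union of the Cantor sets
  Lebesgue null. Hyperplanes orthogonal to the Cantor axis that miss \<open>K\<close> are therefore
  dense, which provides the small boxes that bound the dimension of the removed set.\<close>

section \<open>Cubes are not of dimension $n - 1$\<close>

text \<open>This is the instability of the value \<open>0\<close> from the Hurewicz-Wallman
  characterisation of \<open>dim X < k\<close>, a map into \<open>k\<close>-space being a family of
  real functions indexed by \<open>i < k\<close>. For \<open>k = 0\<close> it says that
  \<open>X\<close> is empty, matching dimension \<open>-1\<close>.\<close>

definition unstable_zero :: "nat \<Rightarrow> 'a::metric_space set \<Rightarrow> bool" where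
  "unstable_zero k X \<longleftrightarrow>
     (\<forall>f \<epsilon>. (\<forall>i<k. continuous_on X (f i :: 'a \<Rightarrow> real)) \<and> \<epsilon> > 0 \<longrightarrow>
        (\<exists>g. (\<forall>i<k. continuous_on X (g i) \<and> (\<forall>x\<in>X. \<bar>g i x - f i x\<bar> < \<epsilon>)) \<and>
             (\<forall>x\<in>X. \<exists>i<k. g i x \<noteq> (0::real))))"

lemma unstable_zeroD:
  assumes "unstable_zero k X" "\<And>i. i < k \<Longrightarrow> continuous_on X (f i)" "\<epsilon> > 0"
  obtains g where "\<And>i. i < k \<Longrightarrow> continuous_on X (g i)"
    "\<And>i x. \<lbrakk>i < k; x \<in> X\<rbrakk> \<Longrightarrow> \<bar>g i x - f i x\<bar> < (\<epsilon>::real)"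
    "\<And>x. x \<in> X \<Longrightarrow> \<exists>i<k. g i x \<noteq> 0"
proof -
  have "(\<exists>g. (\<forall>i<k. continuous_on X (g i) \<and> (\<forall>x\<in>X. \<bar>g i x - f i x\<bar> < \<epsilon>)) \<and>
             (\<forall>x\<in>X. \<exists>i<k. g i x \<noteq> (0::real)))"
    using assms unfolding unstable_zero_def by (metis (no_types, lifting))
  then show ?thesis using that by blast
qed

text \<open>Tietze's theorem is applied to the difference \<open>g - f\<close> rather than to
  \<open>g\<close>, because its bound on the extension then becomes closeness to \<open>f\<close> on
  all of \<open>X\<close>.\<close>

lemma Tietze_perturbation:
  fixes f g :: "'a::{metric_space,second_countable_topology} \<Rightarrow> real"
  assumes "continuous_on X f" "continuous_on Z g" "closedin (top_of_set X) Z"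
    and "\<And>x. x \<in> Z \<Longrightarrow> \<bar>g x - f x\<bar> \<le> \<epsilon>" "0 \<le> \<epsilon>"
  obtains h where "continuous_on X h" "\<And>x. x \<in> Z \<Longrightarrow> h x = g x"
    "\<And>x. x \<in> X \<Longrightarrow> \<bar>h x - f x\<bar> \<le> \<epsilon>"
proof -
  have "Z \<subseteq> X" using assms(3) closedin_imp_subset by blast
  then have "continuous_on Z (\<lambda>x. g x - f x)"
    by (intro continuous_intros assms) (use assms(1) continuous_on_subset in blast)
  then obtain d where d: "continuous_on X d" "\<And>x. x \<in> Z \<Longrightarrow> d x = g x - f x"
    "\<And>x. x \<in> X \<Longrightarrow> norm (d x) \<le> \<epsilon>"
    using Tietze[of Z "\<lambda>x. g x - f x" X \<epsilon>] assms by auto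
  show ?thesis
    by (rule that[of "\<lambda>x. f x + d x"]) (use d assms(1) in \<open>auto intro!: continuous_intros\<close>)
qed

text \<open>Working with instability of the zero value instead of the small inductive dimension itself makes
  finite unions harmless, so that no sum theorem for the dimension is needed.\<close>
lemma unstable_zero_Un:
  fixes X Y :: "'a::{metric_space,second_countable_topology} set"
  assumes "compact X" "compact Y" "unstable_zero k X" "unstable_zero k Y"
  shows "unstable_zero k (X \<union> Y)"
  unfolding unstable_zero_def
proof (intro allI impI)
  fix f :: "nat \<Rightarrow> 'a \<Rightarrow> real" and \<epsilon> :: real
  assume A: "(\<forall>i<k. continuous_on (X \<union> Y) (f i)) \<and> \<epsilon> > 0"
  have cl: "closedin (top_of_set (X \<union> Y)) X" "closedin (top_of_set (X \<union> Y)) Y"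
    using assms by (auto intro!: closed_subset compact_imp_closed)
  have "continuous_on X (f i)" if "i < k" for i
    using A that continuous_on_subset by blast
  then obtain g where g: "\<And>i. i < k \<Longrightarrow> continuous_on X (g i)"
    "\<And>i x. \<lbrakk>i < k; x \<in> X\<rbrakk> \<Longrightarrow> \<bar>g i x - f i x\<bar> < \<epsilon>/2" "\<And>x. x \<in> X \<Longrightarrow> \<exists>i<k. g i x \<noteq> 0"
    using unstable_zeroD[OF assms(3), of f "\<epsilon>/2"] A by auto
  have "\<exists>h. continuous_on (X \<union> Y) h \<and> (\<forall>x\<in>X. h x = g i x) \<and> (\<forall>x\<in>X \<union> Y. \<bar>h x - f i x\<bar> \<le> \<epsilon>/2)"
    if "i < k" for i
    using Tietze_perturbation[of "X \<union> Y" "f i" X "g i" "\<epsilon>/2"] A g that cl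
    by (metis half_gt_zero less_eq_real_def)
  then obtain h where h: "\<And>i. i < k \<Longrightarrow> continuous_on (X \<union> Y) (h i)"
    "\<And>i x. \<lbrakk>i < k; x \<in> X\<rbrakk> \<Longrightarrow> h i x = g i x"
    "\<And>i x. \<lbrakk>i < k; x \<in> X \<union> Y\<rbrakk> \<Longrightarrow> \<bar>h i x - f i x\<bar> \<le> \<epsilon>/2"
    by metis
  have "\<exists>\<eta>>0. \<forall>x\<in>X. (\<Sum>i<k. \<bar>g i x\<bar>) \<ge> \<eta>"
  proof (cases "X = {}")
    case False
    have "continuous_on X (\<lambda>x. \<Sum>i<k. \<bar>g i x\<bar>)"
      using g(1) by (intro continuous_intros) auto
    then obtain x0 where x0: "x0 \<in> X" "\<And>x. x \<in> X \<Longrightarrow> (\<Sum>i<k. \<bar>g i x0\<bar>) \<le> (\<Sum>i<k. \<bar>g i x\<bar>)"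
      using continuous_attains_inf[OF assms(1) False] by blast
    obtain i where i: "i < k" "g i x0 \<noteq> 0" using g(3) x0 by blast
    then have "0 < (\<Sum>i<k. \<bar>g i x0\<bar>)" by (intro sum_pos2[of _ i]) auto
    with x0 show ?thesis by blast
  qed (auto intro: exI[of _ 1])
  then obtain \<eta> where \<eta>: "\<eta> > 0" "\<And>x. x \<in> X \<Longrightarrow> (\<Sum>i<k. \<bar>g i x\<bar>) \<ge> \<eta>" by blast
  \<comment> \<open>The perturbation that clears \<open>Y\<close> must not create zeros on
    \<open>X\<close>. There the absolute values of the components of \<open>g\<close> sum to at
    least \<open>\<eta>\<close>, and \<open>k\<close> changes of size \<open>\<delta>\<close> cannot
    cancel that. Writing \<open>k + 1\<close> avoids a division by zero.\<close>
  define \<delta> where "\<delta> = min (\<epsilon>/4) (\<eta> / (2 * (real k + 1)))"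
  have \<delta>: "\<delta> > 0" using A \<eta> by (auto simp: \<delta>_def)
  have \<delta>4: "\<delta> \<le> \<epsilon>/4" unfolding \<delta>_def by (rule min.cobounded1)
  have "real k * \<delta> \<le> real k * (\<eta> / (2 * (real k + 1)))"
    by (intro mult_left_mono) (auto simp: \<delta>_def)
  also have "\<dots> < \<eta>" using \<eta>(1) by (simp add: field_simps add_strict_increasing)
  finally have k\<delta>: "real k * \<delta> < \<eta>" .
  have "continuous_on Y (h i)" if "i < k" for i
    using h(1) that continuous_on_subset by blast
  then obtain p where p: "\<And>i. i < k \<Longrightarrow> continuous_on Y (p i)"
    "\<And>i x. \<lbrakk>i < k; x \<in> Y\<rbrakk> \<Longrightarrow> \<bar>p i x - h i x\<bar> < \<delta>" "\<And>x. x \<in> Y \<Longrightarrow> \<exists>i<k. p i x \<noteq> 0"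
    using unstable_zeroD[OF assms(4), of h \<delta>] \<delta> by auto
  have "\<exists>q. continuous_on (X \<union> Y) q \<and> (\<forall>x\<in>Y. q x = p i x) \<and> (\<forall>x\<in>X \<union> Y. \<bar>q x - h i x\<bar> \<le> \<delta>)"
    if "i < k" for i
    using Tietze_perturbation[of "X \<union> Y" "h i" Y "p i" "\<delta>"] h p that cl \<delta>
    by (metis less_eq_real_def)
  then obtain q where q: "\<And>i. i < k \<Longrightarrow> continuous_on (X \<union> Y) (q i)"
    "\<And>i x. \<lbrakk>i < k; x \<in> Y\<rbrakk> \<Longrightarrow> q i x = p i x"
    "\<And>i x. \<lbrakk>i < k; x \<in> X \<union> Y\<rbrakk> \<Longrightarrow> \<bar>q i x - h i x\<bar> \<le> \<delta>"
    by metis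
  have "\<exists>i<k. q i x \<noteq> 0" if x: "x \<in> X \<union> Y" for x
  proof (cases "x \<in> Y")
    case True
    then obtain i where "i < k" "p i x \<noteq> 0" using p(3) by blast
    then show ?thesis using q(2)[of i x] True by auto
  next
    case False
    with x have "x \<in> X" by simp
    show ?thesis
    proof (rule ccontr)
      assume "\<not> ?thesis"
      then have "\<bar>g i x\<bar> \<le> \<delta>" if "i < k" for i
        using q(3)[OF that x] h(2)[OF that \<open>x \<in> X\<close>] that by auto
      then have "(\<Sum>i<k. \<bar>g i x\<bar>) \<le> real k * \<delta>"
        using sum_bounded_above[of "{..<k}" "\<lambda>i. \<bar>g i x\<bar>" \<delta>] by simp
      with \<eta>(2)[OF \<open>x \<in> X\<close>] k\<delta> show False by simp
    qed
  qed
  moreover have "\<bar>q i x - f i x\<bar> < \<epsilon>" if "i < k" "x \<in> X \<union> Y" for i x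
    using q(3)[OF that] h(3)[OF that] \<delta>4 A by linarith
  ultimately show "\<exists>g. (\<forall>i<k. continuous_on (X \<union> Y) (g i) \<and> (\<forall>x\<in>X \<union> Y. \<bar>g i x - f i x\<bar> < \<epsilon>)) \<and>
             (\<forall>x\<in>X \<union> Y. \<exists>i<k. g i x \<noteq> 0)"
    using q(1) by blast
qed

lemma unstable_zero_empty [simp]: "unstable_zero k {}"
  by (simp add: unstable_zero_def)

lemma unstable_zero_UN:
  fixes Z :: "'b \<Rightarrow> 'a::{metric_space,second_countable_topology} set"
  assumes "finite I" "\<And>i. i \<in> I \<Longrightarrow> compact (Z i)" "\<And>i. i \<in> I \<Longrightarrow> unstable_zero k (Z i)"
  shows "unstable_zero k (\<Union>i\<in>I. Z i)"
  using assms
proof (induction I rule: finite_induct)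
  case (insert i I)
  have "compact (\<Union>i\<in>I. Z i)" using insert by (intro compact_UN) auto
  then show ?case using insert by (simp add: unstable_zero_Un)
qed simp

lemma dimension_leD:
  assumes "X dim_le n" "openin X V" "a \<in> V"
  shows "\<exists>U. a \<in> U \<and> U \<subseteq> V \<and> openin X U \<and> subtopology X (X frontier_of U) dim_le (n - 1)"
  using assms by (auto elim: dimension_le.cases)

text \<open>The last component is replaced by a function vanishing only on a finite union of frontiers of
  dimension one less, on which the induction hypothesis moves the other components off zero.\<close>
lemma unstable_zero_dimension_le:
  fixes X :: "'a::{metric_space,second_countable_topology} set"
  assumes "compact X" "top_of_set X dim_le (int k - 1)"
  shows "unstable_zero k X"
  using assms
proof (induction k arbitrary: X)
  case 0
  then have "X = {}" by (auto simp: subtopology_trivial_iff)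
  then show ?case by simp
next
  case (Suc k)
  show ?case unfolding unstable_zero_def
  proof (intro allI impI)
    fix f :: "nat \<Rightarrow> 'a \<Rightarrow> real" and \<epsilon> :: real
    assume A: "(\<forall>i<Suc k. continuous_on X (f i)) \<and> \<epsilon> > 0"
    define e where "e = \<epsilon>/4"
    have e: "e > 0" using A by (simp add: e_def)
    have ck: "continuous_on X (f k)" using A by simp
    define V where "V = {x\<in>X. f k x > 0}"
    \<comment> \<open>An open set \<open>W\<close> is going to be fitted between the compact
      \<open>A'\<close> and the open \<open>V\<close>. Then \<open>f k\<close> is nonnegative on the
      closure of \<open>W\<close> and below \<open>e\<close> off \<open>W\<close>.\<close>
    define A' where "A' = {x\<in>X. f k x \<ge> e}"
    have "openin (top_of_set X) (X \<inter> f k -` {0<..})"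
      by (rule continuous_openin_preimage_gen[OF ck]) simp
    moreover have "V = X \<inter> f k -` {0<..}" by (auto simp: V_def)
    ultimately have opV: "openin (top_of_set X) V" by simp
    have "closedin (top_of_set X) (X \<inter> f k -` {e..})"
      by (rule continuous_closedin_preimage[OF ck]) simp
    moreover have "A' = X \<inter> f k -` {e..}" by (auto simp: A'_def)
    ultimately have "closedin (top_of_set X) A'" by simp
    then have cA: "compact A'" using Suc.prems(1) closedin_compact by blast
    have AV: "A' \<subseteq> V" using e by (auto simp: A'_def V_def)
    have "\<exists>U. a \<in> U \<and> U \<subseteq> V \<and> openin (top_of_set X) U \<and>
              top_of_set (top_of_set X frontier_of U) dim_le (int k - 1)" if aV: "a \<in> V" for a
    proof -
      obtain U where U: "a \<in> U" "U \<subseteq> V" "openin (top_of_set X) U"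
          "subtopology (top_of_set X) (top_of_set X frontier_of U) dim_le (int (Suc k) - 1 - 1)"
        using dimension_leD[OF Suc.prems(2) opV aV] by blast
      have "X \<inter> (top_of_set X frontier_of U) = top_of_set X frontier_of U"
        using frontier_of_subset_topspace[of "top_of_set X" U] by auto
      then show ?thesis using U by (auto simp: subtopology_subtopology)
    qed
    then obtain U where U: "\<And>a. a \<in> V \<Longrightarrow> a \<in> U a \<and> U a \<subseteq> V \<and> openin (top_of_set X) (U a) \<and>
              top_of_set (top_of_set X frontier_of (U a)) dim_le (int k - 1)"
      by metis
    have "\<exists>F\<subseteq>A'. finite F \<and> A' \<subseteq> (\<Union>a\<in>F. U a)"
    proof -
      have "\<forall>a\<in>A'. \<exists>T. open T \<and> U a = X \<inter> T" using U AV by (metis openin_open subsetD)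
      then obtain T where T: "\<And>a. a \<in> A' \<Longrightarrow> open (T a) \<and> U a = X \<inter> T a" by metis
      have "A' \<subseteq> (\<Union>a\<in>A'. T a)" using T U AV by blast
      then obtain F where F: "F \<subseteq> A'" "finite F" "A' \<subseteq> (\<Union>a\<in>F. T a)"
        using compactE_image[OF cA, of A' T] T by metis
      have "A' \<subseteq> (\<Union>a\<in>F. U a)"
      proof
        fix x assume x: "x \<in> A'"
        then obtain a where a: "a \<in> F" "x \<in> T a" using F(3) by blast
        have "x \<in> X" using x by (simp add: A'_def)
        then have "x \<in> U a" using T[of a] a F(1) by blast
        then show "x \<in> (\<Union>a\<in>F. U a)" using a(1) by blast
      qed
      with F show ?thesis by blast
    qed
    then obtain F where F: "F \<subseteq> A'" "finite F" "A' \<subseteq> (\<Union>a\<in>F. U a)" by blast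
    define W where "W = (\<Union>a\<in>F. U a)"
    define Z where "Z = (\<Union>a\<in>F. top_of_set X frontier_of (U a))"
    define C where "C = top_of_set X closure_of W"
    have compZ: "compact (top_of_set X frontier_of (U a))" for a
      using closedin_frontier_of Suc.prems(1) closedin_compact by blast
    have uZ: "unstable_zero k Z"
      unfolding Z_def using compZ U F AV by (intro unstable_zero_UN F Suc.IH) auto
    have cZ: "compact Z" unfolding Z_def using F compZ by (intro compact_UN) auto
    have ZX: "Z \<subseteq> X" unfolding Z_def using frontier_of_subset_topspace[of "top_of_set X"] by fastforce
    have clZ: "closedin (top_of_set X) Z" using cZ ZX by (simp add: closed_subset compact_imp_closed)
    have opW: "openin (top_of_set X) W" unfolding W_def using U F AV by (intro openin_Union) auto
    have WX: "W \<subseteq> X" using opW openin_imp_subset by blast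
    have clC: "closedin (top_of_set X) C" by (simp add: C_def)
    have CX: "C \<subseteq> X" using clC closedin_imp_subset by blast
    have clW: "closedin (top_of_set X) (X - W)" using opW by (simp add: closedin_diff)
    have WC: "W \<subseteq> C" unfolding C_def by (rule closure_of_subset) (use WX in simp)
    have frW: "C - W \<subseteq> Z"
    proof -
      have "C - W = top_of_set X frontier_of W"
        using frontier_of_openin[OF opW] by (simp add: C_def)
      also have "\<dots> \<subseteq> Z"
        using frontier_of_Union_subset[of "U ` F" "top_of_set X"] F(2)
        by (auto simp: W_def Z_def)
      finally show ?thesis .
    qed
    have fC: "f k x \<ge> 0" if "x \<in> C" for x
    proof -
      have "C \<subseteq> X \<inter> f k -` {0..}" unfolding C_def
      proof (rule closure_of_minimal)
        show "W \<subseteq> X \<inter> f k -` {0..}" using U F AV by (force simp: W_def V_def)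
        show "closedin (top_of_set X) (X \<inter> f k -` {0..})"
          by (rule continuous_closedin_preimage[OF ck]) simp
      qed
      with that show ?thesis by auto
    qed
    have fW: "f k x < e" if "x \<in> X - W" for x
      using that F(3) by (force simp: W_def A'_def)
    \<comment> \<open>A function vanishing exactly on \<open>Z\<close>. The case
      \<open>Z = {}\<close> is separate because \<open>infdist\<close> to the empty set is
      \<open>0\<close> by default.\<close>
    define \<zeta> where "\<zeta> x = (if Z = {} then e else min e (infdist x Z))" for x
    have \<zeta>c: "continuous_on S \<zeta>" for S
      unfolding \<zeta>_def by (cases "Z = {}") (auto intro!: continuous_intros)
    have \<zeta>0: "\<zeta> x = 0" if "x \<in> Z" for x using that e by (auto simp: \<zeta>_def)
    have \<zeta>b: "0 \<le> \<zeta> x" "\<zeta> x \<le> e" for x using e by (auto simp: \<zeta>_def infdist_nonneg)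
    have \<zeta>p: "\<zeta> x > 0" if "x \<notin> Z" for x
      using that e infdist_pos_not_in_closed[of Z x] cZ by (auto simp: \<zeta>_def compact_imp_closed)
    \<comment> \<open>Off \<open>Z\<close> this is at least \<open>\<zeta> > 0\<close> on
      \<open>C\<close> and at most \<open>-\<zeta> < 0\<close> elsewhere, so it can vanish only on
      \<open>Z\<close>. On the overlap of \<open>C\<close> and \<open>X - W\<close>, a subset of
      \<open>Z\<close>, the bounds \<open>0 \<le> f k < e\<close> make both formulas
      \<open>0\<close>.\<close>
    define gk where "gk x = (if x \<in> C then max (f k x - e) 0 + \<zeta> x else min (f k x) 0 - \<zeta> x)" for x
    have gkc: "continuous_on X gk"
    proof -
      have "continuous_on (C \<union> (X - W)) (\<lambda>x. if x \<in> C then max (f k x - e) 0 + \<zeta> x else min (f k x) 0 - \<zeta> x)"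
      proof (rule continuous_on_cases_local)
        have eq: "C \<union> (X - W) = X" using CX WC by blast
        show "closedin (top_of_set (C \<union> (X - W))) C" "closedin (top_of_set (C \<union> (X - W))) (X - W)"
          using clC clW by (auto simp: eq)
        have ckC: "continuous_on C (f k)" "continuous_on (X - W) (f k)"
          using ck CX continuous_on_subset by blast+
        show "continuous_on C (\<lambda>x. max (f k x - e) 0 + \<zeta> x)"
          "continuous_on (X - W) (\<lambda>x. min (f k x) 0 - \<zeta> x)"
          by (intro continuous_intros ckC \<zeta>c)+
        fix x assume "x \<in> C \<and> x \<notin> C \<or> x \<in> X - W \<and> x \<in> C"
        then have x: "x \<in> X - W" "x \<in> C" "x \<in> Z" using frW by auto
        show "max (f k x - e) 0 + \<zeta> x = min (f k x) 0 - \<zeta> x"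
          using \<zeta>0[OF x(3)] fC[OF x(2)] fW[OF x(1)] by simp
      qed
      moreover have "C \<union> (X - W) = X" using CX WC by blast
      ultimately show ?thesis by (simp add: gk_def[abs_def])
    qed
    have gkf: "\<bar>gk x - f k x\<bar> < \<epsilon>" if "x \<in> X" for x
    proof -
      have "\<bar>gk x - f k x\<bar> \<le> 2 * e"
      proof (cases "x \<in> C")
        case True
        then show ?thesis using fC[OF True] \<zeta>b[of x] e by (auto simp: gk_def max_def)
      next
        case False
        then have "f k x < e" using fW[of x] that WC by blast
        then show ?thesis using False \<zeta>b[of x] e by (auto simp: gk_def min_def)
      qed
      then show ?thesis using e by (simp add: e_def)
    qed
    have gk0: "gk x \<noteq> 0" if "x \<in> X" "x \<notin> Z" for x
      using \<zeta>p[OF that(2)] by (auto simp: gk_def max_def min_def)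
    have "continuous_on Z (f i)" if "i < k" for i
      using A that ZX continuous_on_subset less_SucI by blast
    then obtain g where g: "\<And>i. i < k \<Longrightarrow> continuous_on Z (g i)"
      "\<And>i x. \<lbrakk>i < k; x \<in> Z\<rbrakk> \<Longrightarrow> \<bar>g i x - f i x\<bar> < e" "\<And>x. x \<in> Z \<Longrightarrow> \<exists>i<k. g i x \<noteq> 0"
      using unstable_zeroD[OF uZ, of f e] e by auto
    have "\<exists>h. continuous_on X h \<and> (\<forall>x\<in>Z. h x = g i x) \<and> (\<forall>x\<in>X. \<bar>h x - f i x\<bar> \<le> e)"
      if "i < k" for i
      using Tietze_perturbation[of X "f i" Z "g i" e] A g that clZ e
      by (metis less_SucI less_eq_real_def)
    then obtain h where h: "\<And>i. i < k \<Longrightarrow> continuous_on X (h i)"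
      "\<And>i x. \<lbrakk>i < k; x \<in> Z\<rbrakk> \<Longrightarrow> h i x = g i x"
      "\<And>i x. \<lbrakk>i < k; x \<in> X\<rbrakk> \<Longrightarrow> \<bar>h i x - f i x\<bar> \<le> e"
      by metis
    show "\<exists>g. (\<forall>i<Suc k. continuous_on X (g i) \<and> (\<forall>x\<in>X. \<bar>g i x - f i x\<bar> < \<epsilon>)) \<and>
             (\<forall>x\<in>X. \<exists>i<Suc k. g i x \<noteq> 0)"
    proof (intro exI[of _ "\<lambda>i. if i = k then gk else h i"] conjI allI impI ballI)
      fix i assume "i < Suc k"
      then show "continuous_on X (if i = k then gk else h i)" using gkc h(1) by auto
      fix x assume "x \<in> X"
      show "\<bar>(if i = k then gk else h i) x - f i x\<bar> < \<epsilon>"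
      proof (cases "i = k")
        case False
        then have "\<bar>h i x - f i x\<bar> \<le> e" using h(3)[of i x] \<open>x \<in> X\<close> \<open>i < Suc k\<close> by simp
        then show ?thesis using False e by (simp add: e_def)
      qed (use gkf[OF \<open>x \<in> X\<close>] in simp)
    next
      fix x assume "x \<in> X"
      show "\<exists>i<Suc k. (if i = k then gk else h i) x \<noteq> 0"
      proof (cases "x \<in> Z")
        case True
        then obtain i where "i < k" "g i x \<noteq> 0" using g(3) by blast
        then show ?thesis using h(2)[OF _ True, of i] by (intro exI[of _ i]) auto
      next
        case False
        then show ?thesis using gk0 \<open>x \<in> X\<close> by (intro exI[of _ k]) auto
      qed
    qed
  qed
qed

text \<open>If the face had such a dimension, \<open>0\<close> would be unstable for the map reading
  off the \<open>n\<close> free coordinates relative to \<open>a\<close>. Subtracting a perturbation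
  without zeros from the identity would give a self-map of the face without fixed points, against
  Brouwer's theorem.\<close>

lemma cube_face_not_dimension_le:
  fixes a :: "real ^ 'm" and m0 :: 'm
  assumes r: "r > 0"
    and dim: "CARD('m) = n + 1"
  shows "\<not> top_of_set {x. x $ m0 = a $ m0 \<and> (\<forall>i. \<bar>x $ i - a $ i\<bar> \<le> r)} dim_le (int n - 1)"
proof
  define Q where "Q = {x. x $ m0 = a $ m0 \<and> (\<forall>i. \<bar>x $ i - a $ i\<bar> \<le> r)}"
  assume "top_of_set {x. x $ m0 = a $ m0 \<and> (\<forall>i. \<bar>x $ i - a $ i\<bar> \<le> r)} dim_le (int n - 1)"
  then have dQ: "top_of_set Q dim_le (int n - 1)" by (simp add: Q_def)
  have Qeq: "Q = cbox (\<chi> i. a $ i - r) (\<chi> i. a $ i + r) \<inter> {x. axis m0 1 \<bullet> x = a $ m0}"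
    by (auto simp: Q_def mem_box_cart inner_axis' abs_le_iff algebra_simps)
  have cQ: "compact Q" unfolding Qeq by (intro compact_Int_closed compact_cbox closed_hyperplane)
  have conv: "convex Q" unfolding Qeq by (intro convex_Int convex_box convex_hyperplane)
  have aQ: "a \<in> Q" using r by (simp add: Q_def)
  have "card (UNIV - {m0}) = n" using dim by (simp add: card_Diff_singleton)
  then obtain e where e: "bij_betw e {..<n} (UNIV - {m0})"
    using ex_bij_betw_nat_finite[of "UNIV - {m0}"] by (auto simp: atLeast0LessThan)
  define e' where "e' = the_inv_into {..<n} e"
  have e': "e' i < n" "e (e' i) = i" if "i \<noteq> m0" for i
    using that e f_the_inv_into_f_bij_betw[OF e] the_inv_into_into[of e "{..<n}" i]
    by (auto simp: e'_def bij_betw_def)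
  have e2: "e j \<noteq> m0" "e' (e j) = j" if "j < n" for j
    using that e by (auto simp: e'_def bij_betw_def the_inv_into_f_f)
  have uz: "unstable_zero n Q" by (rule unstable_zero_dimension_le[OF cQ dQ])
  have "continuous_on Q (\<lambda>x. x $ e j - a $ e j)" for j by (intro continuous_intros)
  then obtain g where g: "\<And>j. j < n \<Longrightarrow> continuous_on Q (g j)"
    "\<And>j x. \<lbrakk>j < n; x \<in> Q\<rbrakk> \<Longrightarrow> \<bar>g j x - (x $ e j - a $ e j)\<bar> < r"
    "\<And>x. x \<in> Q \<Longrightarrow> \<exists>j<n. g j x \<noteq> 0"
    using unstable_zeroD[OF uz, of "\<lambda>j x. x $ e j - a $ e j" r] r by blast
  \<comment> \<open>The tolerance of \<open>g\<close> is the half-width \<open>r\<close> of the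
    face, which is exactly what keeps \<open>F\<close> inside \<open>Q\<close>.\<close>
  define F where "F x = (\<chi> i. if i = m0 then a $ m0 else x $ i - g (e' i) x)" for x :: "real ^ 'm"
  have "continuous_on Q F"
    unfolding F_def
  proof (rule continuous_on_vec_lambda)
    show "continuous_on Q (\<lambda>x. if i = m0 then a $ m0 else x $ i - g (e' i) x)" for i
      using g(1) e'(1) by (cases "i = m0") (auto intro!: continuous_intros)
  qed
  moreover have "F \<in> Q \<rightarrow> Q"
  proof
    fix x assume x: "x \<in> Q"
    have "\<bar>F x $ i - a $ i\<bar> \<le> r" for i
      using g(2)[OF _ x, of "e' i"] e'[of i] r by (cases "i = m0") (auto simp: F_def)
    then show "F x \<in> Q" by (simp add: Q_def) (simp add: F_def)
  qed
  ultimately obtain x where x: "x \<in> Q" "F x = x"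
    using brouwer[OF cQ conv] aQ by blast
  obtain j where j: "j < n" "g j x \<noteq> 0" using g(3) x by blast
  have "F x $ e j = x $ e j - g j x" using e2[OF j(1)] by (simp add: F_def)
  with x j show False by simp
qed

section \<open>An upper bound for the small inductive dimension\<close>

lemma norm_vec_less_if_components:
  fixes x :: "real ^ 'm"
  assumes "\<And>i. \<bar>x $ i\<bar> < e / real CARD('m)"
  shows "norm x < e"
proof -
  have "norm x \<le> (\<Sum>i\<in>UNIV. \<bar>x $ i\<bar>)" by (rule norm_le_l1_cart)
  also have "\<dots> < (\<Sum>i\<in>(UNIV :: 'm set). e / real CARD('m))"
    by (rule sum_strict_mono) (use assms in auto)
  also have "\<dots> = e" by simp
  finally show ?thesis .
qed

text \<open>Boxes with faces at rational heights have frontiers that lie on flats of one dimension less, so the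
  induction needs no sum theorem; the faces orthogonal to \<open>m0\<close> avoid \<open>A\<close> altogether.\<close>
lemma dimension_le_irrational_flats:
  fixes m0 :: "'m::finite" and A D :: "real set"
  assumes A: "\<And>a b. a < b \<Longrightarrow> \<exists>c. a < c \<and> c < b \<and> c \<notin> A"
    and dim: "CARD('m) = n + 1"
    and D: "finite D" "D \<subseteq> \<rat>" and d: "d \<le> n"
  shows "top_of_set {x :: real ^ 'm. x $ m0 \<in> A \<and> (\<exists>i. i \<noteq> m0 \<and> x $ i \<notin> \<rat>) \<and>
            n - d \<le> card {i. i \<noteq> m0 \<and> x $ i \<in> D}} dim_le (int d - 1)"
  using d D
proof (induction d arbitrary: D)
  case 0
  \<comment> \<open>For \<open>d = 0\<close> every coordinate other than the one at
    \<open>m0\<close> has its value in \<open>D\<close> and hence is rational, so the set is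
    empty.\<close>
  have "{i. i \<noteq> m0 \<and> x $ i \<in> D} = - {m0}" if "n \<le> card {i. i \<noteq> m0 \<and> x $ i \<in> D}" for x :: "real ^ 'm"
  proof (rule card_seteq)
    have "card (- {m0}) = n" using dim by (simp add: Compl_eq_Diff_UNIV card_Diff_singleton)
    then show "card (- {m0}) \<le> card {i. i \<noteq> m0 \<and> x $ i \<in> D}" using that by simp
  qed auto
  then have E: "{x :: real ^ 'm. x $ m0 \<in> A \<and> (\<exists>i. i \<noteq> m0 \<and> x $ i \<notin> \<rat>) \<and>
            n \<le> card {i. i \<noteq> m0 \<and> x $ i \<in> D}} = {}"
    using 0 by blast
  show ?case unfolding diff_zero E by simp
next
  case (Suc d)
  define X where "X = {x :: real ^ 'm. x $ m0 \<in> A \<and> (\<exists>i. i \<noteq> m0 \<and> x $ i \<notin> \<rat>) \<and>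
            n - Suc d \<le> card {i. i \<noteq> m0 \<and> x $ i \<in> D}}"
  have "top_of_set X dim_le (int (Suc d) - 1)"
  proof (rule dimension_le.intros)
    fix V p assume V: "openin (top_of_set X) V" and p: "p \<in> V"
    obtain T where T: "open T" "V = X \<inter> T" using V by (metis openin_open)
    obtain e where e: "e > 0" "ball p e \<subseteq> T" using T p openE by blast
    have "\<exists>\<delta>>0. \<forall>q\<in>D. q \<noteq> p $ i \<longrightarrow> \<delta> \<le> dist (p $ i) q" for i
      using finite_set_avoid[OF Suc.prems(2)] by blast
    then obtain \<delta> where \<delta>: "\<And>i. \<delta> i > 0" "\<And>i q. \<lbrakk>q \<in> D; q \<noteq> p $ i\<rbrakk> \<Longrightarrow> \<delta> i \<le> dist (p $ i) q"
      by metis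
    \<comment> \<open>The bound \<open>\<delta> i\<close> keeps the faces closer to
      \<open>p $ i\<close> than any other value in \<open>D\<close>. A frontier point thus gains a
      pinned rational coordinate whose value is not yet in \<open>D\<close>, which raises the count
      by one.\<close>
    define r where "r i = min (\<delta> i) (e / real CARD('m))" for i
    have r: "r i > 0" "r i \<le> \<delta> i" "r i \<le> e / real CARD('m)" for i
      using \<delta> e by (auto simp: r_def)
    have cut: "\<exists>c. u < c \<and> c < v \<and> (if i = m0 then c \<notin> A else c \<in> \<rat>)" if "u < v" for u v i
      using A[OF that] Rats_dense_in_real[OF that] by auto
    obtain a where a: "\<And>i. p $ i - r i < a i \<and> a i < p $ i \<and> (if i = m0 then a i \<notin> A else a i \<in> \<rat>)"
      using cut[of "p $ i - r i" "p $ i" i for i] r by (metis (no_types, lifting) diff_less_eq less_add_same_cancel1)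
    obtain b where b: "\<And>i. p $ i < b i \<and> b i < p $ i + r i \<and> (if i = m0 then b i \<notin> A else b i \<in> \<rat>)"
      using cut[of "p $ i" "p $ i + r i" i for i] r by (metis (no_types, lifting) less_add_same_cancel1)
    define B where "B = box (\<chi> i. a i) (\<chi> i. b i)"
    define B' where "B' = cbox (\<chi> i. a i) (\<chi> i. b i)"
    define U where "U = X \<inter> B"
    have opU: "openin (top_of_set X) U" unfolding U_def B_def by (intro openin_open_Int open_box)
    have "B \<subseteq> ball p e"
    proof
      fix x assume "x \<in> B"
      then have x: "a i < x $ i" "x $ i < b i" for i by (auto simp: B_def mem_box_cart)
      have "\<bar>(x - p) $ i\<bar> < e / real CARD('m)" for i
        using x[of i] a[of i] b[of i] r[of i] by auto
      then show "x \<in> ball p e" using norm_vec_less_if_components[of "x - p" e]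
        by (simp add: dist_norm norm_minus_commute)
    qed
    then have UV: "U \<subseteq> V" using e T by (auto simp: U_def)
    have pU: "p \<in> U" using p T a b by (auto simp: U_def B_def mem_box_cart)
    define D' where "D' = D \<union> a ` (- {m0}) \<union> b ` (- {m0})"
    have D': "finite D'" "D' \<subseteq> \<rat>"
      using Suc.prems a b by (auto simp: D'_def split: if_splits) (metis)+
    define Y where "Y = {x :: real ^ 'm. x $ m0 \<in> A \<and> (\<exists>i. i \<noteq> m0 \<and> x $ i \<notin> \<rat>) \<and>
            n - d \<le> card {i. i \<noteq> m0 \<and> x $ i \<in> D'}}"
    have Y: "top_of_set Y dim_le (int d - 1)"
      unfolding Y_def by (rule Suc.IH) (use Suc.prems D' in auto)
    have fr: "top_of_set X frontier_of U \<subseteq> Y"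
    proof
      fix x assume x: "x \<in> top_of_set X frontier_of U"
      have "top_of_set X closure_of U \<subseteq> X \<inter> B'"
      proof (rule closure_of_minimal)
        show "U \<subseteq> X \<inter> B'" using box_subset_cbox by (auto simp: U_def B_def B'_def)
        show "closedin (top_of_set X) (X \<inter> B')"
          unfolding B'_def by (intro closedin_closed_Int closed_cbox)
      qed
      then have xX: "x \<in> X" "x \<in> B'" "x \<notin> B"
        using x frontier_of_openin[OF opU] by (auto simp: U_def)
      from xX(2) have bd: "a i \<le> x $ i" "x $ i \<le> b i" for i by (auto simp: B'_def mem_box_cart)
      obtain i where "x $ i \<le> a i \<or> b i \<le> x $ i"
        using xX(3) by (auto simp: B_def mem_box_cart not_less)
      then have i: "x $ i = a i \<or> x $ i = b i" using bd[of i] by force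
      have im0: "i \<noteq> m0" using i xX(1) a[of m0] b[of m0] by (auto simp: X_def)
      have iD: "x $ i \<notin> D"
      proof
        assume iD: "x $ i \<in> D"
        have "x $ i \<noteq> p $ i" using i a[of i] b[of i] by auto
        then have "\<delta> i \<le> \<bar>p $ i - x $ i\<bar>" using \<delta>(2)[OF iD] by (simp add: dist_real_def)
        then show False using i a[of i] b[of i] r[of i] by auto
      qed
      have "n - d \<le> Suc (n - Suc d)" by simp
      also have "\<dots> \<le> Suc (card {i. i \<noteq> m0 \<and> x $ i \<in> D})" using xX(1) by (simp add: X_def)
      also have "\<dots> = card (insert i {i. i \<noteq> m0 \<and> x $ i \<in> D})" using iD by simp
      also have "\<dots> \<le> card {i. i \<noteq> m0 \<and> x $ i \<in> D'}"
        by (rule card_mono) (use i im0 in \<open>auto simp: D'_def\<close>)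
      finally show "x \<in> Y" using xX(1) by (simp add: X_def Y_def)
    qed
    show "\<exists>U. p \<in> U \<and> U \<subseteq> V \<and> openin (top_of_set X) U \<and>
            subtopology (top_of_set X) (top_of_set X frontier_of U) dim_le int (Suc d) - 1 - 1"
    proof (intro exI[of _ U] conjI pU UV opU)
      have "top_of_set (X \<inter> top_of_set X frontier_of U) dim_le (int d - 1)"
        by (rule dimension_le_subtopologies[OF Y]) (use fr in auto)
      then show "subtopology (top_of_set X) (top_of_set X frontier_of U) dim_le int (Suc d) - 1 - 1"
        by (simp add: subtopology_subtopology)
    qed
  qed simp
  then show ?case by (simp add: X_def)
qed

section \<open>Hausdorff premeasures\<close>

lemma hausdorff_premeasure_le:
  assumes "A \<subseteq> (\<Union>i. U i)" "\<And>i. bounded (U i)" "\<And>i. diameter (U i) \<le> \<delta>"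
  shows "hausdorff_premeasure s \<delta> A \<le> (\<Sum>i. diam_power s (U (i::nat)))"
  unfolding hausdorff_premeasure_def by (rule INF_lower) (use assms in auto)

lemma hausdorff_premeasure_mono:
  "A \<subseteq> B \<Longrightarrow> hausdorff_premeasure s \<delta> A \<le> hausdorff_premeasure s \<delta> B"
  unfolding hausdorff_premeasure_def by (rule INF_superset_mono) auto

lemma hausdorff_premeasure_lessE:
  assumes "hausdorff_premeasure s \<delta> A < c"
  obtains U :: "nat \<Rightarrow> 'a::metric_space set" where "A \<subseteq> (\<Union>i. U i)" "\<And>i. bounded (U i)"
    "\<And>i. diameter (U i) \<le> \<delta>" "(\<Sum>i. diam_power s (U i)) < c"
  using assms unfolding hausdorff_premeasure_def INF_less_iff by blast

lemma hausdorff_premeasure_UN: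
  fixes A :: "nat \<Rightarrow> 'a::metric_space set"
  shows "hausdorff_premeasure s \<delta> (\<Union>i. A i) \<le> (\<Sum>i. hausdorff_premeasure s \<delta> (A i))"
proof (rule ennreal_le_epsilon)
  fix e :: real assume e: "e > 0" and fin: "(\<Sum>i. hausdorff_premeasure s \<delta> (A i)) < top"
  have "\<exists>U. A i \<subseteq> (\<Union>j. U j) \<and> (\<forall>j::nat. bounded (U j) \<and> diameter (U j) \<le> \<delta>) \<and>
     (\<Sum>j. diam_power s (U j)) \<le> hausdorff_premeasure s \<delta> (A i) + ennreal (e * (1/2) ^ Suc i)" for i
  proof -
    have "hausdorff_premeasure s \<delta> (A i) \<noteq> top"
      using ennreal_suminf_lessD[OF fin, of i] by auto
    then have "hausdorff_premeasure s \<delta> (A i) < hausdorff_premeasure s \<delta> (A i) + ennreal (e * (1/2) ^ Suc i)"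
      using e by (cases "hausdorff_premeasure s \<delta> (A i)")
        (auto simp flip: ennreal_plus simp: ennreal_less_iff)
    then obtain U :: "nat \<Rightarrow> 'a set" where "A i \<subseteq> (\<Union>j. U j)" "\<And>j. bounded (U j)" "\<And>j. diameter (U j) \<le> \<delta>"
      "(\<Sum>j. diam_power s (U j)) < hausdorff_premeasure s \<delta> (A i) + ennreal (e * (1/2) ^ Suc i)"
      by (rule hausdorff_premeasure_lessE) (rule that, auto)
    then show ?thesis by (intro exI[of _ U]) auto
  qed
  then obtain U where U: "\<And>i. A i \<subseteq> (\<Union>j. U i j)" "\<And>i j. bounded (U i j)" "\<And>i j. diameter (U i j) \<le> \<delta>"
    "\<And>i. (\<Sum>j. diam_power s (U i (j::nat))) \<le> hausdorff_premeasure s \<delta> (A i) + ennreal (e * (1/2) ^ Suc i)"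
    by metis
  define W where "W k = (case prod_decode k of (i, j) \<Rightarrow> U i j)" for k
  have "(\<Union>i. A i) \<subseteq> (\<Union>k. W k)"
  proof
    fix x assume "x \<in> (\<Union>i. A i)"
    then obtain i j where "x \<in> U i j" using U(1) by blast
    then have "x \<in> W (prod_encode (i, j))" by (simp add: W_def)
    then show "x \<in> (\<Union>k. W k)" by blast
  qed
  then have "hausdorff_premeasure s \<delta> (\<Union>i. A i) \<le> (\<Sum>k. diam_power s (W k))"
    by (rule hausdorff_premeasure_le) (auto simp: W_def U split: prod.split)
  also have "\<dots> = (\<Sum>k. (\<lambda>(i,j). diam_power s (U i j)) (prod_decode k))"
    by (intro suminf_cong) (auto simp: W_def split: prod.split)
  also have "\<dots> = (\<Sum>i. \<Sum>j. diam_power s (U i j))"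
    by (rule suminf_ennreal_2dimen) simp
  also have "\<dots> \<le> (\<Sum>i. hausdorff_premeasure s \<delta> (A i) + ennreal (e * (1/2) ^ Suc i))"
    by (intro suminf_le U) auto
  also have "\<dots> = (\<Sum>i. hausdorff_premeasure s \<delta> (A i)) + (\<Sum>i. ennreal (e * (1/2) ^ Suc i))"
    by (intro suminf_add[symmetric]) auto
  also have "(\<Sum>i. ennreal (e * (1/2) ^ Suc i)) = ennreal e"
    using e sums_mult[OF power_half_series, of e]
    by (subst suminf_ennreal_eq[of _ "e"]) auto
  finally show "hausdorff_premeasure s \<delta> (\<Union>i. A i) \<le> (\<Sum>i. hausdorff_premeasure s \<delta> (A i)) + ennreal e" .
qed

text \<open>The finite cover is padded to a sequence with empty sets, which cost \<open>0\<close> by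
  the convention in \<open>diam_power\<close>. The size \<open>d\<close> of the sets may be much
  finer than the admissible scale \<open>\<delta>\<close>.\<close>

lemma hausdorff_premeasure_finite_cover:
  fixes A :: "'a::metric_space set"
  assumes fin: "finite \<U>" and cov: "A \<subseteq> \<Union>\<U>"
    and U: "\<And>U. U \<in> \<U> \<Longrightarrow> bounded U" "\<And>U. U \<in> \<U> \<Longrightarrow> diameter U \<le> d"
    and d: "0 \<le> d" "d \<le> \<delta>" and s: "s > 0"
  shows "hausdorff_premeasure s \<delta> A \<le> ennreal (real (card \<U>) * d powr s)"
proof -
  obtain e where e: "bij_betw e {..<card \<U>} \<U>"
    using ex_bij_betw_nat_finite[OF fin] by (auto simp: atLeast0LessThan)
  define V where "V i = (if i < card \<U> then e i else {})" for i
  have eU: "e i \<in> \<U>" if "i < card \<U>" for i using e that by (auto simp: bij_betw_def)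
  have "A \<subseteq> (\<Union>i. V i)"
  proof
    fix x assume "x \<in> A"
    then obtain U where U': "U \<in> \<U>" "x \<in> U" using cov by blast
    have "U \<in> e ` {..<card \<U>}" using bij_betw_imp_surj_on[OF e] U'(1) by simp
    then obtain i where "i < card \<U>" "e i = U" by auto
    then show "x \<in> (\<Union>i. V i)" using U'(2) by (auto simp: V_def)
  qed
  then have "hausdorff_premeasure s \<delta> A \<le> (\<Sum>i. diam_power s (V i))"
  proof (rule hausdorff_premeasure_le)
    show "bounded (V i)" "diameter (V i) \<le> \<delta>" for i
      using U eU[of i] d by (fastforce simp: V_def)+
  qed
  also have "\<dots> = (\<Sum>i<card \<U>. diam_power s (V i))"
    by (rule suminf_finite) (auto simp: V_def diam_power_def)
  also have "\<dots> \<le> (\<Sum>i<card \<U>. ennreal (d powr s))"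
  proof (rule sum_mono)
    fix i assume "i \<in> {..<card \<U>}"
    then have "bounded (V i)" "diameter (V i) \<le> d" using U eU[of i] by (auto simp: V_def)
    then show "diam_power s (V i) \<le> ennreal (d powr s)"
      using s by (auto simp: diam_power_def intro!: ennreal_leI powr_mono2 diameter_ge_0)
  qed
  also have "\<dots> = ennreal (real (card \<U>) * d powr s)"
    by (simp add: ennreal_mult ennreal_of_nat_eq_real_of_nat)
  finally show ?thesis .
qed

lemma hausdorff_measure_eq_0I:
  assumes "\<And>\<delta> \<eta>. \<lbrakk>\<delta> > 0; \<eta> > 0\<rbrakk> \<Longrightarrow> hausdorff_premeasure s \<delta> A \<le> ennreal \<eta>"
  shows "hausdorff_measure s A = 0"
proof -
  have "hausdorff_premeasure s \<delta> A \<le> 0" if "\<delta> > 0" for \<delta>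
    by (rule ennreal_le_epsilon) (use assms that in auto)
  then show ?thesis by (auto simp: hausdorff_measure_def)
qed

lemma hausdorff_premeasure_le_measure:
  "\<delta> > 0 \<Longrightarrow> hausdorff_premeasure s \<delta> A \<le> hausdorff_measure s A"
  unfolding hausdorff_measure_def by (rule SUP_upper) auto

lemma hausdorff_dim_le:
  assumes "hausdorff_measure s A = 0" "0 \<le> s"
  shows "hausdorff_dim A \<le> ereal s"
  using assms by (cases "A = {}") (auto simp: hausdorff_dim_def one_ereal_def intro!: Inf_lower2[of "ereal s"])

lemma hausdorff_dim_ge:
  assumes "A \<noteq> {}" "\<And>s. \<lbrakk>0 \<le> s; s < \<alpha>\<rbrakk> \<Longrightarrow> hausdorff_measure s A \<noteq> 0"
  shows "ereal \<alpha> \<le> hausdorff_dim A"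
  using assms by (auto simp: hausdorff_dim_def not_le intro!: Inf_greatest)

lemma hausdorff_premeasure_antimono:
  "\<delta> \<le> \<delta>' \<Longrightarrow> hausdorff_premeasure s \<delta>' A \<le> hausdorff_premeasure s \<delta> A"
  unfolding hausdorff_premeasure_def by (rule INF_superset_mono) (auto intro: order_trans)

lemma hausdorff_premeasure_empty: "\<delta> > 0 \<Longrightarrow> hausdorff_premeasure s \<delta> {} = 0"
  using hausdorff_premeasure_le[of "{}" "\<lambda>_. {}" \<delta> s] by (simp add: diam_power_def)

lemma hausdorff_measure_UN_eq_0:
  fixes A :: "nat \<Rightarrow> 'a::metric_space set"
  assumes "\<And>i. hausdorff_measure s (A i) = 0"
  shows "hausdorff_measure s (\<Union>i. A i) = 0"
proof (rule hausdorff_measure_eq_0I)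
  fix \<delta> \<eta> :: real assume "\<delta> > 0" "\<eta> > 0"
  have "hausdorff_premeasure s \<delta> (A i) = 0" for i
    using hausdorff_premeasure_le_measure[OF \<open>\<delta> > 0\<close>, of s "A i"] assms by simp
  then show "hausdorff_premeasure s \<delta> (\<Union>i. A i) \<le> ennreal \<eta>"
    using hausdorff_premeasure_UN[of s \<delta> A] by simp
qed

section \<open>Upper box dimension\<close>

text \<open>A power bound on covering counts, uniform over all scales up to \<open>1\<close>. For
  \<open>s \<ge> 0\<close> it gives upper box dimension at most \<open>s\<close>; the constant and
  the covers stay explicit because products, null sets and premeasures are estimated directly from
  them.\<close>

definition box_bounded :: "real \<Rightarrow> 'a::metric_space set \<Rightarrow> bool" where
  "box_bounded s A \<longleftrightarrow> (\<exists>c>0. \<forall>\<epsilon>. 0 < \<epsilon> \<and> \<epsilon> \<le> 1 \<longrightarrow>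
     (\<exists>\<U>. finite \<U> \<and> real (card \<U>) \<le> c * \<epsilon> powr (- s) \<and> A \<subseteq> \<Union>\<U> \<and>
          (\<forall>U\<in>\<U>. bounded U \<and> diameter U \<le> \<epsilon>)))"

lemma box_bounded_subset: "\<lbrakk>box_bounded s A; B \<subseteq> A\<rbrakk> \<Longrightarrow> box_bounded s B"
  unfolding box_bounded_def by (meson order_trans)

lemma box_bounded_mono:
  assumes "box_bounded s A" "s \<le> t"
  shows "box_bounded t A"
proof -
  obtain c where c: "c > 0" "\<And>\<epsilon>. \<lbrakk>0 < \<epsilon>; \<epsilon> \<le> 1\<rbrakk> \<Longrightarrow>
     \<exists>\<U>. finite \<U> \<and> real (card \<U>) \<le> c * \<epsilon> powr (- s) \<and> A \<subseteq> \<Union>\<U> \<and>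
          (\<forall>U\<in>\<U>. bounded U \<and> diameter U \<le> \<epsilon>)"
    using assms(1) unfolding box_bounded_def by blast
  have le: "c * \<epsilon> powr (- s) \<le> c * \<epsilon> powr (- t)" if "0 < \<epsilon>" "\<epsilon> \<le> 1" for \<epsilon>
    using c(1) that assms(2) by (intro mult_left_mono powr_mono') auto
  show ?thesis unfolding box_bounded_def
    using c le by (meson order_trans)
qed

lemma box_bounded_singleton: "0 \<le> s \<Longrightarrow> box_bounded s {x}"
  unfolding box_bounded_def
proof (intro exI[of _ 1] conjI allI impI)
  fix \<epsilon> :: real assume "0 \<le> s" "0 < \<epsilon> \<and> \<epsilon> \<le> 1"
  then have "1 \<le> \<epsilon> powr (- s)" using powr_mono'[of "- s" 0 \<epsilon>] by simp
  then show "\<exists>\<U>. finite \<U> \<and> real (card \<U>) \<le> 1 * \<epsilon> powr (- s) \<and> {x} \<subseteq> \<Union>\<U> \<and>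
          (\<forall>U\<in>\<U>. bounded U \<and> diameter U \<le> \<epsilon>)"
    using \<open>0 < \<epsilon> \<and> \<epsilon> \<le> 1\<close> by (intro exI[of _ "{{x}}"]) auto
qed simp

lemma small_setI:
  fixes S :: "'a::metric_space set"
  assumes "\<And>x y. \<lbrakk>x \<in> S; y \<in> S\<rbrakk> \<Longrightarrow> dist x y \<le> \<epsilon>" "0 \<le> \<epsilon>"
  shows "bounded S" "diameter S \<le> \<epsilon>"
proof -
  show "bounded S"
  proof (cases "S = {}")
    case False
    then obtain x where "x \<in> S" by blast
    then have "S \<subseteq> cball x \<epsilon>" using assms by auto
    then show ?thesis using bounded_cball bounded_subset by blast
  qed simp
  show "diameter S \<le> \<epsilon>"
    using assms by (auto simp: diameter_def intro!: cSUP_least)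
qed

text \<open>Constant factors in covering counts contribute a term
  \<open>c / ln (1 / \<epsilon>)\<close> to the box dimension quotient and so disappear in the
  limit.\<close>

lemma tendsto_const_div_ln: "((\<lambda>\<epsilon>. s + c / ln (1 / \<epsilon>)) \<longlongrightarrow> (s::real)) (at_right 0)"
proof -
  have "filterlim (\<lambda>\<epsilon>::real. ln (inverse \<epsilon>)) at_top (at_right 0)"
    by (rule filterlim_compose[OF ln_at_top filterlim_inverse_at_top_right])
  then have "((\<lambda>\<epsilon>. c / ln (1 / \<epsilon>)) \<longlongrightarrow> 0) (at_right 0)"
    by (intro real_tendsto_divide_at_top[OF tendsto_const]) (simp add: inverse_eq_divide)
  then show ?thesis using tendsto_add[OF tendsto_const] by fastforce
qed

text \<open>The \<open>LEAST\<close> in \<open>covering_number\<close> has a meaning only if some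
  finite cover exists; the given family is the witness.\<close>

lemma covering_number_attained:
  assumes "finite \<U>" "A \<subseteq> \<Union>\<U>" "\<And>U. U \<in> \<U> \<Longrightarrow> bounded U \<and> diameter U \<le> \<epsilon>"
  shows "covering_number \<epsilon> A \<le> card \<U>"
    and "\<exists>\<V>. finite \<V> \<and> card \<V> = covering_number \<epsilon> A \<and> A \<subseteq> \<Union>\<V> \<and> (\<forall>U\<in>\<V>. bounded U \<and> diameter U \<le> \<epsilon>)"
proof -
  have *: "\<exists>\<V>. finite \<V> \<and> card \<V> = card \<U> \<and> A \<subseteq> \<Union>\<V> \<and> (\<forall>U\<in>\<V>. bounded U \<and> diameter U \<le> \<epsilon>)"
    using assms by blast
  show "covering_number \<epsilon> A \<le> card \<U>"
    unfolding covering_number_def by (rule Least_le) (rule *)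
  show "\<exists>\<V>. finite \<V> \<and> card \<V> = covering_number \<epsilon> A \<and> A \<subseteq> \<Union>\<V> \<and> (\<forall>U\<in>\<V>. bounded U \<and> diameter U \<le> \<epsilon>)"
    unfolding covering_number_def by (rule LeastI) (rule *)
qed

lemma totally_bounded_finite_cover:
  fixes A :: "'a::metric_space set"
  shows "totally_bounded A \<longleftrightarrow>
    (\<forall>\<epsilon>>0. \<exists>\<U>. finite \<U> \<and> A \<subseteq> \<Union>\<U> \<and> (\<forall>U\<in>\<U>. bounded U \<and> diameter U \<le> \<epsilon>))"
proof
  assume L: "totally_bounded A"
  show "\<forall>\<epsilon>>0. \<exists>\<U>. finite \<U> \<and> A \<subseteq> \<Union>\<U> \<and> (\<forall>U\<in>\<U>. bounded U \<and> diameter U \<le> \<epsilon>)"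
  proof (intro allI impI)
    fix \<epsilon> :: real assume \<epsilon>: "\<epsilon> > 0"
    then obtain k where k: "finite k" "A \<subseteq> (\<Union>x\<in>k. ball x (\<epsilon>/2))"
      using L[unfolded totally_bounded_metric, rule_format, of "\<epsilon>/2"] by (auto simp: ball_def)
    have "diameter (ball x (\<epsilon>/2)) \<le> \<epsilon>" for x :: 'a
    proof (rule small_setI)
      fix y z assume "y \<in> ball x (\<epsilon>/2)" "z \<in> ball x (\<epsilon>/2)"
      then show "dist y z \<le> \<epsilon>" using dist_triangle_half_r[of x y \<epsilon> z] by simp
    qed (use \<epsilon> in simp)
    then show "\<exists>\<U>. finite \<U> \<and> A \<subseteq> \<Union>\<U> \<and> (\<forall>U\<in>\<U>. bounded U \<and> diameter U \<le> \<epsilon>)"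
      using k by (intro exI[of _ "(\<lambda>x. ball x (\<epsilon>/2)) ` k"]) auto
  qed
next
  assume R: "\<forall>\<epsilon>>0. \<exists>\<U>. finite \<U> \<and> A \<subseteq> \<Union>\<U> \<and> (\<forall>U\<in>\<U>. bounded U \<and> diameter U \<le> \<epsilon>)"
  show "totally_bounded A"
    unfolding totally_bounded_metric
  proof (intro allI impI)
    fix e :: real assume e: "e > 0"
    then obtain \<U> where U: "finite \<U>" "A \<subseteq> \<Union>\<U>" "\<And>U. U \<in> \<U> \<Longrightarrow> bounded U \<and> diameter U \<le> e/2"
      using R by (meson half_gt_zero)
    define p where "p U = (SOME x. x \<in> U)" for U :: "'a set"
    have "A \<subseteq> (\<Union>x\<in>p ` \<U>. ball x e)"
    proof
      fix x assume "x \<in> A"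
      then obtain V where V: "V \<in> \<U>" "x \<in> V" using U by blast
      then have "p V \<in> V" unfolding p_def by (metis someI)
      then have "dist (p V) x \<le> e/2"
        using diameter_bounded_bound[of V "p V" x] U(3)[OF V(1)] V by linarith
      then show "x \<in> (\<Union>x\<in>p ` \<U>. ball x e)" using V e by force
    qed
    then show "\<exists>k. finite k \<and> A \<subseteq> (\<Union>x\<in>k. {y. dist x y < e})"
      using U(1) unfolding ball_def by blast
  qed
qed

lemma upper_box_dim_le:
  fixes A :: "'a::metric_space set"
  assumes "box_bounded s A" and s: "0 \<le> s"
  shows "upper_box_dim A \<le> ereal s"
proof (cases "A = {}")
  case True
  then show ?thesis using s by (simp add: upper_box_dim_def one_ereal_def)
next
  case False
  obtain c where c: "c > 0" "\<And>\<epsilon>. \<lbrakk>0 < \<epsilon>; \<epsilon> \<le> 1\<rbrakk> \<Longrightarrow>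
     \<exists>\<U>. finite \<U> \<and> real (card \<U>) \<le> c * \<epsilon> powr (- s) \<and> A \<subseteq> \<Union>\<U> \<and>
          (\<forall>U\<in>\<U>. bounded U \<and> diameter U \<le> \<epsilon>)"
    using assms(1) unfolding box_bounded_def by blast
  have tb: "totally_bounded A"
    unfolding totally_bounded_finite_cover
  proof (intro allI impI)
    fix \<epsilon> :: real assume "\<epsilon> > 0"
    then have "0 < min \<epsilon> 1" "min \<epsilon> 1 \<le> 1" by auto
    from c(2)[OF this] obtain \<U> where "finite \<U>" "A \<subseteq> \<Union>\<U>" "\<forall>U\<in>\<U>. bounded U \<and> diameter U \<le> min \<epsilon> 1"
      by blast
    then show "\<exists>\<U>. finite \<U> \<and> A \<subseteq> \<Union>\<U> \<and> (\<forall>U\<in>\<U>. bounded U \<and> diameter U \<le> \<epsilon>)"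
      by (intro exI[of _ \<U>]) auto
  qed
  have "eventually (\<lambda>\<epsilon>. ereal (ln (real (covering_number \<epsilon> A)) / ln (1 / \<epsilon>)) \<le> ereal (s + ln c / ln (1 / \<epsilon>))) (at_right 0)"
    unfolding eventually_at_right_field
  proof (intro exI[of _ 1] conjI allI impI)
    fix \<epsilon> :: real assume \<epsilon>: "0 < \<epsilon>" "\<epsilon> < 1"
    then obtain \<U> where U: "finite \<U>" "real (card \<U>) \<le> c * \<epsilon> powr (- s)" "A \<subseteq> \<Union>\<U>"
          "\<forall>U\<in>\<U>. bounded U \<and> diameter U \<le> \<epsilon>"
      using c(2)[of \<epsilon>] by auto
    define N where "N = covering_number \<epsilon> A"
    have N1: "real N \<le> c * \<epsilon> powr (- s)"
      using covering_number_attained(1)[of \<U> A \<epsilon>] U by (simp add: N_def)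
    obtain \<V> where "finite \<V>" "card \<V> = N" "A \<subseteq> \<Union>\<V>"
      using covering_number_attained(2)[of \<U> A \<epsilon>] U by (auto simp: N_def)
    then have N0: "N > 0" using False by (auto simp: card_gt_0_iff)
    have "ln (real N) \<le> ln (c * \<epsilon> powr (- s))" using N0 N1 c(1) \<epsilon> by simp
    also have "\<dots> = ln c + s * ln (1 / \<epsilon>)"
      using c(1) \<epsilon> by (simp add: ln_mult ln_powr ln_div)
    finally have "ln (real N) / ln (1 / \<epsilon>) \<le> (ln c + s * ln (1 / \<epsilon>)) / ln (1 / \<epsilon>)"
      using \<epsilon> by (intro divide_right_mono) (auto simp: ln_div)
    also have "\<dots> = s + ln c / ln (1 / \<epsilon>)" using \<epsilon> by (simp add: field_simps ln_div)
    finally show "ereal (ln (real (covering_number \<epsilon> A)) / ln (1 / \<epsilon>)) \<le> ereal (s + ln c / ln (1 / \<epsilon>))"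
      by (simp add: N_def)
  qed simp
  then have "Limsup (at_right 0) (\<lambda>\<epsilon>. ereal (ln (real (covering_number \<epsilon> A)) / ln (1 / \<epsilon>)))
      \<le> Limsup (at_right 0) (\<lambda>\<epsilon>. ereal (s + ln c / ln (1 / \<epsilon>)))"
    by (rule Limsup_mono)
  also have "\<dots> = ereal s"
    by (rule lim_imp_Limsup) (auto intro: tendsto_const_div_ln)
  finally show ?thesis using False tb by (simp add: upper_box_dim_def)
qed

lemma upper_box_dim_ge:
  fixes A :: "'a::metric_space set"
  assumes "A \<noteq> {}" and v: "v > 0" and \<epsilon>0: "\<epsilon>0 > 0"
    and lower: "\<And>\<epsilon> \<U>. \<lbrakk>0 < \<epsilon>; \<epsilon> < \<epsilon>0; finite \<U>; A \<subseteq> \<Union>\<U>; \<And>U. U \<in> \<U> \<Longrightarrow> bounded U \<and> diameter U \<le> \<epsilon>\<rbrakk>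
        \<Longrightarrow> v * \<epsilon> powr (- s) \<le> real (card \<U>)"
  shows "ereal s \<le> upper_box_dim A"
proof (cases "totally_bounded A")
  case False
  then show ?thesis using assms(1) by (simp add: upper_box_dim_def)
next
  case True
  have "eventually (\<lambda>\<epsilon>. ereal (s + ln v / ln (1 / \<epsilon>)) \<le> ereal (ln (real (covering_number \<epsilon> A)) / ln (1 / \<epsilon>))) (at_right 0)"
    unfolding eventually_at_right_field
  proof (intro exI[of _ "min \<epsilon>0 1"] conjI allI impI)
    fix \<epsilon> :: real assume "0 < \<epsilon>" "\<epsilon> < min \<epsilon>0 1"
    then have \<epsilon>: "0 < \<epsilon>" "\<epsilon> < \<epsilon>0" "\<epsilon> < 1" by auto
    obtain \<U> where U: "finite \<U>" "A \<subseteq> \<Union>\<U>" "\<And>U. U \<in> \<U> \<Longrightarrow> bounded U \<and> diameter U \<le> \<epsilon>"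
      using True[unfolded totally_bounded_finite_cover, rule_format, OF \<epsilon>(1)] by blast
    define N where "N = covering_number \<epsilon> A"
    obtain \<V> where V: "finite \<V>" "card \<V> = N" "A \<subseteq> \<Union>\<V>" "\<And>U. U \<in> \<V> \<Longrightarrow> bounded U \<and> diameter U \<le> \<epsilon>"
      using covering_number_attained(2)[OF U] unfolding N_def by blast
    have N1: "v * \<epsilon> powr (- s) \<le> real N" using lower[OF \<epsilon>(1,2) V(1,3,4)] V(2) by simp
    have "ln v + s * ln (1 / \<epsilon>) = ln (v * \<epsilon> powr (- s))"
      using v \<epsilon> by (simp add: ln_mult ln_powr ln_div)
    also have "\<dots> \<le> ln (real N)" using N1 v \<epsilon> by (intro ln_mono) auto
    finally have "(ln v + s * ln (1 / \<epsilon>)) / ln (1 / \<epsilon>) \<le> ln (real N) / ln (1 / \<epsilon>)"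
      using \<epsilon> by (intro divide_right_mono) (auto simp: ln_div)
    moreover have "(ln v + s * ln (1 / \<epsilon>)) / ln (1 / \<epsilon>) = s + ln v / ln (1 / \<epsilon>)"
      using \<epsilon> by (simp add: field_simps ln_div)
    ultimately show "ereal (s + ln v / ln (1 / \<epsilon>)) \<le> ereal (ln (real (covering_number \<epsilon> A)) / ln (1 / \<epsilon>))"
      by (simp add: N_def)
  qed (use \<epsilon>0 in simp)
  then have "Limsup (at_right 0) (\<lambda>\<epsilon>. ereal (s + ln v / ln (1 / \<epsilon>)))
     \<le> Limsup (at_right 0) (\<lambda>\<epsilon>. ereal (ln (real (covering_number \<epsilon> A)) / ln (1 / \<epsilon>)))"
    by (rule Limsup_mono)
  moreover have "Limsup (at_right 0) (\<lambda>\<epsilon>. ereal (s + ln v / ln (1 / \<epsilon>))) = ereal s"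
    by (rule lim_imp_Limsup) (auto intro: tendsto_const_div_ln)
  ultimately show ?thesis using assms(1) True by (simp add: upper_box_dim_def)
qed

text \<open>The product \<open>C \<times> [0, R]^n\<close> of the overview, \<open>m0\<close> being
  the index of the Cantor factor.\<close>

definition slab :: "'m::finite \<Rightarrow> real set \<Rightarrow> real \<Rightarrow> (real ^ 'm) set" where
  "slab m0 C R = {x. x $ m0 \<in> C \<and> (\<forall>i. i \<noteq> m0 \<longrightarrow> 0 \<le> x $ i \<and> x $ i \<le> R)}"

lemma dist_vec_le_sum: "dist x y \<le> (\<Sum>i\<in>UNIV. \<bar>x $ i - y $ i\<bar>)" for x y :: "real ^ 'm"
  using norm_le_l1_cart[of "x - y"] by (simp add: dist_norm)

lemma floor_cell_dist:
  fixes u v p :: real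
  assumes "p > 0" "\<lfloor>u / p\<rfloor> = \<lfloor>v / p\<rfloor>"
  shows "\<bar>u - v\<bar> \<le> p"
proof -
  have "\<bar>u / p - v / p\<bar> < 1" using assms(2) by linarith
  then have "\<bar>u - v\<bar> / p < 1" using assms(1) by (simp flip: diff_divide_distrib)
  then show ?thesis using assms(1) by simp
qed

lemma card_cells:
  fixes m0 :: "'m::finite" and M :: int
  assumes "CARD('m) = n + 1" "M \<ge> 0"
  shows "finite (PiE (- {m0}) (\<lambda>_. {0..M}))" "card (PiE (- {m0}) (\<lambda>_. {0..M})) = nat (M + 1) ^ n"
proof -
  have "card (- {m0}) = n" using assms by (simp add: Compl_eq_Diff_UNIV card_Diff_singleton)
  then show "card (PiE (- {m0}) (\<lambda>_. {0..M})) = nat (M + 1) ^ n"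
    by (simp add: card_PiE)
qed (simp add: finite_PiE)

text \<open>Covering \<open>C\<close> by sets of size \<open>p\<close> and cutting each of the other
  \<open>n\<close> coordinates into about \<open>1 / p\<close> intervals multiplies the counts, so
  the exponents add.\<close>

lemma box_bounded_slab:
  fixes m0 :: "'m::finite"
  assumes "box_bounded \<alpha> C" and R: "R \<le> 1" and dim: "CARD('m) = n + 1"
  shows "box_bounded (real n + \<alpha>) (slab m0 C R)"
proof -
  obtain c where c: "c > 0" "\<And>\<epsilon>. \<lbrakk>0 < \<epsilon>; \<epsilon> \<le> 1\<rbrakk> \<Longrightarrow>
     \<exists>\<U>. finite \<U> \<and> real (card \<U>) \<le> c * \<epsilon> powr (- \<alpha>) \<and> C \<subseteq> \<Union>\<U> \<and>
          (\<forall>U\<in>\<U>. bounded U \<and> diameter U \<le> \<epsilon>)"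
    using assms(1) unfolding box_bounded_def by blast
  define m where "m = real CARD('m)"
  have m: "m \<ge> 1" by (simp add: m_def Suc_le_eq)
  define K where "K = c * m powr \<alpha> * (2 * m) ^ n"
  show ?thesis unfolding box_bounded_def
  proof (intro exI[of _ K] conjI allI impI)
    show "K > 0" using c(1) m by (auto simp: K_def)
    fix \<epsilon> :: real assume "0 < \<epsilon> \<and> \<epsilon> \<le> 1"
    then have \<epsilon>: "0 < \<epsilon>" "\<epsilon> \<le> 1" by auto
    \<comment> \<open>In a cell each of the \<open>m\<close> coordinates varies by at most
      \<open>p\<close>, so the variations sum to at most \<open>\<epsilon>\<close>.\<close>
    define p where "p = \<epsilon> / m"
    have "\<epsilon> \<le> m" using \<epsilon> m by linarith
    then have p: "0 < p" "p \<le> 1" using \<epsilon> m by (auto simp: p_def)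
    obtain \<U> where U: "finite \<U>" "real (card \<U>) \<le> c * p powr (- \<alpha>)" "C \<subseteq> \<Union>\<U>"
        "\<And>U. U \<in> \<U> \<Longrightarrow> bounded U \<and> diameter U \<le> p" using c(2)[OF p] by blast
    define M where "M = \<lfloor>1 / p\<rfloor>"
    have M: "M \<ge> 0" "real_of_int M \<le> 1 / p" using p by (auto simp: M_def)
    define Z where "Z = PiE (- {m0}) (\<lambda>_. {0..M})"
    define cell where "cell = (\<lambda>(U, k). {x \<in> slab m0 C R. x $ m0 \<in> U \<and> (\<forall>i. i \<noteq> m0 \<longrightarrow> \<lfloor>x $ i / p\<rfloor> = k i)})"
    have Z: "finite Z" "card Z = nat (M + 1) ^ n" unfolding Z_def using card_cells[OF dim M(1)] by auto
    have small: "dist x y \<le> \<epsilon>" if "V \<in> \<U>" "x \<in> cell (V, k)" "y \<in> cell (V, k)" for V k x y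
    proof -
      have "\<bar>x $ i - y $ i\<bar> \<le> p" for i
      proof (cases "i = m0")
        case True
        have "dist (x $ m0) (y $ m0) \<le> diameter V"
          using that U(4)[of V] by (intro diameter_bounded_bound) (auto simp: cell_def)
        then show ?thesis using U(4)[OF that(1)] True by (simp add: dist_real_def)
      next
        case False
        then show ?thesis using that p by (intro floor_cell_dist) (auto simp: cell_def)
      qed
      then have "(\<Sum>i\<in>UNIV. \<bar>x $ i - y $ i\<bar>) \<le> (\<Sum>i\<in>(UNIV :: 'm set). p)" by (intro sum_mono)
      also have "\<dots> = \<epsilon>" using m by (simp add: p_def m_def)
      finally show ?thesis using dist_vec_le_sum[of x y] by linarith
    qed
    show "\<exists>\<U>. finite \<U> \<and> real (card \<U>) \<le> K * \<epsilon> powr (- (real n + \<alpha>)) \<and> slab m0 C R \<subseteq> \<Union>\<U> \<and>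
          (\<forall>U\<in>\<U>. bounded U \<and> diameter U \<le> \<epsilon>)"
    proof (intro exI[of _ "cell ` (\<U> \<times> Z)"] conjI ballI)
      show "finite (cell ` (\<U> \<times> Z))" using U Z by blast
      have "card (cell ` (\<U> \<times> Z)) \<le> card (\<U> \<times> Z)" by (rule card_image_le) (use U Z in auto)
      then have "real (card (cell ` (\<U> \<times> Z))) \<le> real (card \<U>) * real (card Z)"
        by (metis card_cartesian_product of_nat_le_iff of_nat_mult)
      also have "\<dots> \<le> (c * p powr (- \<alpha>)) * (2 / p) ^ n"
      proof (intro mult_mono U)
        have "real (card Z) = (real_of_int M + 1) ^ n" using Z(2) M(1) by simp
        also have "\<dots> \<le> (2 / p) ^ n"
        proof (intro power_mono)
          have "1 \<le> 1 / p" using p by simp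
          then show "real_of_int M + 1 \<le> 2 / p" using M(2) by simp
        qed (use M in auto)
        finally show "real (card Z) \<le> (2 / p) ^ n" .
      qed (use c in auto)
      also have "\<dots> = K * (\<epsilon> powr (- \<alpha>) * (1 / \<epsilon>) ^ n)"
      proof -
        have "p powr (- \<alpha>) = m powr \<alpha> * \<epsilon> powr (- \<alpha>)"
          unfolding p_def using \<epsilon> m by (subst powr_divide) (auto simp: powr_minus field_simps)
        moreover have "(2 / p) ^ n = (2 * m) ^ n * (1 / \<epsilon>) ^ n"
        proof -
          have "2 / p = (2 * m) * (1 / \<epsilon>)" by (simp add: p_def)
          then show ?thesis by (simp only: power_mult_distrib)
        qed
        ultimately show ?thesis by (simp add: K_def)
      qed
      also have "\<epsilon> powr (- \<alpha>) * (1 / \<epsilon>) ^ n = \<epsilon> powr (- (real n + \<alpha>))"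
      proof -
        have "(1 / \<epsilon>) ^ n = \<epsilon> powr (- real n)"
          using \<epsilon> by (simp add: powr_minus powr_realpow power_divide inverse_eq_divide)
        then show ?thesis by (simp add: add.commute flip: powr_add)
      qed
      finally show "real (card (cell ` (\<U> \<times> Z))) \<le> K * \<epsilon> powr (- (real n + \<alpha>))" .
      show "slab m0 C R \<subseteq> \<Union> (cell ` (\<U> \<times> Z))"
      proof
        fix x assume x: "x \<in> slab m0 C R"
        then obtain V where V: "V \<in> \<U>" "x $ m0 \<in> V" using U(3) by (auto simp: slab_def)
        define k where "k = restrict (\<lambda>i. \<lfloor>x $ i / p\<rfloor>) (- {m0})"
        have "k \<in> Z" unfolding Z_def k_def
        proof (rule restrict_PiE_iff[THEN iffD2], intro ballI)
          fix i assume "i \<in> - {m0}"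
          then have "0 \<le> x $ i" "x $ i \<le> 1" using x R by (auto simp: slab_def intro: order_trans)
          then show "\<lfloor>x $ i / p\<rfloor> \<in> {0..M}" using p
            by (auto simp: M_def intro!: floor_mono divide_right_mono)
        qed
        moreover have "x \<in> cell (V, k)" using x V by (simp add: cell_def k_def)
        ultimately show "x \<in> \<Union> (cell ` (\<U> \<times> Z))" using V by blast
      qed
      fix W assume "W \<in> cell ` (\<U> \<times> Z)"
      then obtain V k where "V \<in> \<U>" "W = cell (V, k)" by blast
      then show "bounded W" "diameter W \<le> \<epsilon>"
        using small[of V _ k] \<epsilon> by (auto intro!: small_setI)
    qed
  qed
qed

text \<open>A cover by at most \<open>c * \<epsilon> powr (- \<alpha>)\<close> sets of diameter
  \<open>\<epsilon>\<close> fits into intervals of total length of order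
  \<open>\<epsilon> powr (1 - \<alpha>)\<close>, which tends to \<open>0\<close>.\<close>

lemma negligible_box_bounded:
  fixes C :: "real set"
  assumes "box_bounded \<alpha> C" "\<alpha> < 1"
  shows "negligible C"
proof -
  obtain c where c: "c > 0" "\<And>\<epsilon>. \<lbrakk>0 < \<epsilon>; \<epsilon> \<le> 1\<rbrakk> \<Longrightarrow>
     \<exists>\<U>. finite \<U> \<and> real (card \<U>) \<le> c * \<epsilon> powr (- \<alpha>) \<and> C \<subseteq> \<Union>\<U> \<and>
          (\<forall>U\<in>\<U>. bounded U \<and> diameter U \<le> \<epsilon>)"
    using assms(1) unfolding box_bounded_def by blast
  show ?thesis unfolding negligible_outer_le
  proof (intro allI impI)
    fix e :: real assume e: "e > 0"
    define \<epsilon> where "\<epsilon> = min 1 ((e / (2 * c)) powr (1 / (1 - \<alpha>)))"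
    have \<epsilon>: "0 < \<epsilon>" "\<epsilon> \<le> 1" using e c by (auto simp: \<epsilon>_def)
    have "\<epsilon> powr (1 - \<alpha>) \<le> ((e / (2 * c)) powr (1 / (1 - \<alpha>))) powr (1 - \<alpha>)"
      using \<epsilon> assms by (intro powr_mono2) (auto simp: \<epsilon>_def)
    also have "\<dots> = e / (2 * c)" using assms e c by (simp add: powr_powr)
    finally have small: "2 * c * \<epsilon> powr (1 - \<alpha>) \<le> e" using c by (simp add: field_simps)
    obtain \<U> where U: "finite \<U>" "real (card \<U>) \<le> c * \<epsilon> powr (- \<alpha>)" "C \<subseteq> \<Union>\<U>"
        "\<And>U. U \<in> \<U> \<Longrightarrow> bounded U \<and> diameter U \<le> \<epsilon>" using c(2)[OF \<epsilon>] by blast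
    define p where "p U = (SOME x. x \<in> U)" for U :: "real set"
    define I where "I U = cbox (p U - \<epsilon>) (p U + \<epsilon>)" for U
    have UI: "V \<subseteq> I V" if "V \<in> \<U>" for V
    proof
      fix x assume x: "x \<in> V"
      then have "p V \<in> V" unfolding p_def by (metis someI)
      then have "dist (p V) x \<le> \<epsilon>"
        using diameter_bounded_bound[of V "p V" x] U(4)[OF that] x by linarith
      then show "x \<in> I V" by (auto simp: I_def dist_real_def)
    qed
    have "measure lebesgue (\<Union>V\<in>\<U>. I V) \<le> (\<Sum>V\<in>\<U>. measure lebesgue (I V))"
      by (rule measure_UNION_le) (auto simp: U I_def)
    also have "\<dots> = real (card \<U>) * (2 * \<epsilon>)" using \<epsilon> by (simp add: I_def)
    also have "\<dots> \<le> (c * \<epsilon> powr (- \<alpha>)) * (2 * \<epsilon>)" using \<epsilon> by (intro mult_right_mono U) auto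
    also have "\<dots> = 2 * c * \<epsilon> powr (1 - \<alpha>)"
      using \<epsilon> powr_add[of \<epsilon> 1 "- \<alpha>"] by simp
    also note small
    finally show "\<exists>T. C \<subseteq> T \<and> T \<in> lmeasurable \<and> measure lebesgue T \<le> e"
    proof (intro exI[of _ "\<Union>V\<in>\<U>. I V"] conjI)
      show "C \<subseteq> (\<Union>V\<in>\<U>. I V)" using UI U(3) by blast
      show "(\<Union>V\<in>\<U>. I V) \<in> lmeasurable" by (intro fmeasurable.finite_UN U) (auto simp: I_def)
    qed
  qed
qed

section \<open>Cantor sets\<close>

text \<open>An inverse of such a function is a Hoelder continuous devil's staircase: lower dimension bounds are
  pulled back to Lebesgue measure, upper ones come from the oscillation on dyadic intervals.\<close>
definition cantor_like :: "real \<Rightarrow> real \<Rightarrow> (real \<Rightarrow> real) \<Rightarrow> real \<Rightarrow> bool" where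
  "cantor_like \<alpha> R \<phi> c \<longleftrightarrow> c > 0 \<and>
     (\<forall>t. 0 \<le> t \<longrightarrow> t < 1 \<longrightarrow> \<phi> t \<in> {0..R}) \<and>
     (\<forall>s t. 0 \<le> s \<longrightarrow> s < 1 \<longrightarrow> 0 \<le> t \<longrightarrow> t < 1 \<longrightarrow> \<bar>s - t\<bar> \<le> c * \<bar>\<phi> s - \<phi> t\<bar> powr \<alpha>) \<and>
     (\<forall>k s t. 0 \<le> s \<longrightarrow> s < 1 \<longrightarrow> 0 \<le> t \<longrightarrow> t < 1 \<longrightarrow> \<lfloor>2 ^ k * s\<rfloor> = \<lfloor>2 ^ k * t\<rfloor> \<longrightarrow>
        \<bar>\<phi> s - \<phi> t\<bar> \<le> R * (2 powr (- 1 / \<alpha>)) ^ k)"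

text \<open>The function is a multiple of \<open>\<Sum>k. \<lfloor>2\<^sup>k t\<rfloor> \<beta>\<^sup>k\<close> with \<open>\<beta> = 2\<^sup>-\<^sup>1\<^sup>/\<^sup>\<alpha>\<close>: every summand is increasing, and the
  \<open>k\<close>-th one jumps by \<open>\<beta>\<^sup>k\<close> at the dyadic points of level \<open>k\<close>.\<close>
lemma cantor_like_exists:
  fixes \<alpha> R :: real
  assumes \<alpha>: "0 < \<alpha>" "\<alpha> < 1" and R: "R > 0"
  shows "\<exists>\<phi> c. cantor_like \<alpha> R \<phi> c"
proof -
  define \<beta> where "\<beta> = 2 powr (- 1 / \<alpha>)"
  \<comment> \<open>It is \<open>\<alpha> < 1\<close> that gives \<open>2 * \<beta> < 1\<close> and
    with it the convergence of the series, whose \<open>k\<close>-th term can be as large as about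
    \<open>(2 * \<beta>) ^ k\<close>.\<close>
  have "\<beta> < 2 powr (- 1)" unfolding \<beta>_def using \<alpha> by (intro powr_less_mono) (auto simp: field_simps)
  then have \<beta>: "0 < \<beta>" "2 * \<beta> < 1" by (auto simp: \<beta>_def powr_minus)
  have \<beta>\<alpha>: "(\<beta> ^ k) powr \<alpha> = (1/2) ^ k" for k
  proof -
    have "(\<beta> ^ k) powr \<alpha> = 2 powr (- real k)"
      using \<alpha> by (simp add: \<beta>_def powr_power powr_powr)
    then show ?thesis by (simp add: powr_minus powr_realpow power_one_over inverse_eq_divide)
  qed
  define d where "d t k = real_of_int \<lfloor>2 ^ k * t\<rfloor> * \<beta> ^ k" for t :: real and k :: nat
  define \<psi> where "\<psi> t = (\<Sum>k. d t k)" for t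
  have geo: "summable (\<lambda>k. (2 * \<beta>) ^ k)" "(\<Sum>k. (2 * \<beta>) ^ k) = 1 / (1 - 2 * \<beta>)"
    using \<beta> summable_geometric[of "2 * \<beta>"] suminf_geometric[of "2 * \<beta>"] by simp_all
  have db: "0 \<le> d t k" "d t k \<le> (2 * \<beta>) ^ k" if "0 \<le> t" "t < 1" for t k
  proof -
    have "2 ^ k * t \<le> 2 ^ k * 1" by (rule mult_left_mono) (use that in auto)
    then have "real_of_int \<lfloor>2 ^ k * t\<rfloor> \<le> 2 ^ k" by linarith
    moreover have "0 \<le> real_of_int \<lfloor>2 ^ k * t\<rfloor>" using that by simp
    ultimately show "0 \<le> d t k" "d t k \<le> (2 * \<beta>) ^ k"
      using \<beta> by (auto simp: d_def power_mult_distrib intro!: mult_right_mono)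
  qed
  have ds: "summable (d t)" if "0 \<le> t" "t < 1" for t
    by (rule summable_comparison_test'[OF geo(1), of 0]) (use db[OF that] in auto)
  \<comment> \<open>On \<open>[0, 1)\<close> the sum \<open>\<psi>\<close> is at most
    \<open>1 / (1 - 2 * \<beta>)\<close>, so this factor scales its range into
    \<open>[0, R]\<close>.\<close>
  define \<kappa> where "\<kappa> = R * (1 - 2 * \<beta>)"
  have \<kappa>: "\<kappa> > 0" using R \<beta> by (simp add: \<kappa>_def)
  define c where "c = 2 / \<kappa> powr \<alpha>"
  have bound: "0 \<le> \<psi> t \<and> \<psi> t \<le> 1 / (1 - 2 * \<beta>)" if "0 \<le> t" "t < 1" for t
    using suminf_nonneg[OF ds[OF that]] suminf_le[OF db(2)[OF that] ds[OF that] geo(1)] db[OF that] geo(2)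
    by (auto simp: \<psi>_def)
  have expand: "t - s \<le> c * \<bar>\<kappa> * \<psi> s - \<kappa> * \<psi> t\<bar> powr \<alpha>" if st: "0 \<le> s" "s < t" "t < 1" for s t
  proof -
    \<comment> \<open>At this level \<open>s\<close> and \<open>t\<close> are separated by a dyadic
      point, so the \<open>k\<close>-th summand alone grows by \<open>\<beta> ^ k\<close>.
      Minimality of \<open>k\<close> gives \<open>t - s \<le> 2 * (1/2) ^ k\<close>, and
      \<open>\<beta> ^ k\<close> raised to the power \<open>\<alpha>\<close> is
      \<open>(1/2) ^ k\<close>.\<close>
    define k where "k = (LEAST k. (1/2) ^ k \<le> t - s)"
    have "\<exists>k. (1/2::real) ^ k \<le> t - s"
      using real_arch_pow_inv[of "t - s" "1/2"] st by (auto intro: less_imp_le)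
    then have k1: "(1/2) ^ k \<le> t - s" unfolding k_def by (rule LeastI_ex)
    have k0: "k \<noteq> 0" using k1 st by (intro notI) auto
    then have "\<not> (1/2) ^ (k - 1) \<le> t - s" using not_less_Least[of "k - 1" "\<lambda>k. (1/2) ^ k \<le> t - s"]
      by (simp flip: k_def)
    moreover have "(1/2::real) ^ (k - 1) = 2 * (1/2) ^ k" using k0 by (cases k) auto
    ultimately have k2: "t - s \<le> 2 * (1/2) ^ k" by simp
    have "2 ^ k * s + 1 \<le> 2 ^ k * t" using k1 by (simp add: field_simps power_one_over)
    then have fl: "\<lfloor>2 ^ k * s\<rfloor> + 1 \<le> \<lfloor>2 ^ k * t\<rfloor>" by linarith
    have dm: "0 \<le> d t j - d s j" for j
    proof -
      have "\<lfloor>2 ^ j * s\<rfloor> \<le> \<lfloor>2 ^ j * t\<rfloor>" using st by (intro floor_mono mult_left_mono) auto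
      then show ?thesis using \<beta> by (auto simp: d_def intro!: mult_right_mono)
    qed
    have "real_of_int (\<lfloor>2 ^ k * s\<rfloor> + 1) * \<beta> ^ k \<le> real_of_int \<lfloor>2 ^ k * t\<rfloor> * \<beta> ^ k"
      using fl \<beta> by (intro mult_right_mono) (auto simp del: of_int_add)
    then have "\<beta> ^ k \<le> d t k - d s k" by (simp add: d_def algebra_simps)
    also have "\<dots> = (\<Sum>j\<in>{k}. d t j - d s j)" by simp
    also have "\<dots> \<le> (\<Sum>j. d t j - d s j)"
      by (rule sum_le_suminf) (use dm st in \<open>auto intro!: summable_diff ds\<close>)
    also have "\<dots> = \<psi> t - \<psi> s" unfolding \<psi>_def using st by (intro suminf_diff[symmetric] ds) auto
    finally have "\<kappa> * \<beta> ^ k \<le> \<kappa> * (\<psi> t - \<psi> s)" using \<kappa> by (intro mult_left_mono) auto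
    also have "\<dots> \<le> \<bar>\<kappa> * \<psi> s - \<kappa> * \<psi> t\<bar>" by (simp add: algebra_simps)
    finally have "(\<kappa> * \<beta> ^ k) powr \<alpha> \<le> \<bar>\<kappa> * \<psi> s - \<kappa> * \<psi> t\<bar> powr \<alpha>"
      using \<alpha> \<kappa> \<beta> by (intro powr_mono2) auto
    moreover have "(\<kappa> * \<beta> ^ k) powr \<alpha> = \<kappa> powr \<alpha> * (1/2) ^ k"
      using \<kappa> \<beta> by (simp add: powr_mult \<beta>\<alpha>)
    ultimately have "c * (\<kappa> powr \<alpha> * (1/2) ^ k) \<le> c * \<bar>\<kappa> * \<psi> s - \<kappa> * \<psi> t\<bar> powr \<alpha>"
      using \<kappa> by (intro mult_left_mono) (auto simp: c_def)
    moreover have "c * (\<kappa> powr \<alpha> * (1/2) ^ k) = 2 * (1/2) ^ k" using \<kappa> by (simp add: c_def)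
    ultimately show ?thesis using k2 by linarith
  qed
  show ?thesis
    unfolding cantor_like_def
  proof (intro exI[of _ "\<lambda>t. \<kappa> * \<psi> t"] exI[of _ c] conjI allI impI)
    show "c > 0" using \<kappa> by (simp add: c_def)
    show "\<kappa> * \<psi> t \<in> {0..R}" if "0 \<le> t" "t < 1" for t
    proof -
      have "\<kappa> * \<psi> t \<le> \<kappa> * (1 / (1 - 2 * \<beta>))" using bound[OF that] \<kappa> by (intro mult_left_mono) auto
      also have "\<dots> = R" using \<beta> by (simp add: \<kappa>_def)
      finally show ?thesis using bound[OF that] \<kappa> by simp
    qed
    show "\<bar>s - t\<bar> \<le> c * \<bar>\<kappa> * \<psi> s - \<kappa> * \<psi> t\<bar> powr \<alpha>" if "0 \<le> s" "s < 1" "0 \<le> t" "t < 1" for s t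
    proof (cases s t rule: linorder_cases)
      case less
      then show ?thesis using expand[of s t] that by simp
    next
      case greater
      then show ?thesis using expand[of t s] that by (simp add: abs_minus_commute)
    qed simp
    show "\<bar>\<kappa> * \<psi> s - \<kappa> * \<psi> t\<bar> \<le> R * (2 powr (- 1 / \<alpha>)) ^ k"
      if st: "0 \<le> s" "s < 1" "0 \<le> t" "t < 1" and eq: "\<lfloor>2 ^ k * s\<rfloor> = \<lfloor>2 ^ k * t\<rfloor>" for k s t
    proof -
      define e where "e j = d s j - d t j" for j
      have es: "summable e" unfolding e_def using st by (intro summable_diff ds)
      \<comment> \<open>Equal floors at level \<open>k\<close> force equal floors at all coarser
        levels, which are integer quotients of them. Only the tail of the series
        contributes.\<close>
      have e0: "e j = 0" if "j < k" for j
      proof -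
        have "\<lfloor>2 ^ j * u\<rfloor> = \<lfloor>2 ^ k * u\<rfloor> div 2 ^ (k - j)" for u :: real
        proof -
          have "(2::real) ^ k = 2 ^ j * 2 ^ (k - j)" using that by (simp flip: power_add)
          then have "2 ^ j * u = (2 ^ k * u) / real_of_int (2 ^ (k - j))" by simp
          then show ?thesis using floor_divide_real_eq_div[of "2 ^ (k - j)" "2 ^ k * u"] by simp
        qed
        then show ?thesis by (simp add: e_def d_def eq)
      qed
      have eb: "\<bar>e (j + k)\<bar> \<le> \<beta> ^ k * (2 * \<beta>) ^ j" for j
      proof -
        have "\<bar>2 ^ k * s - 2 ^ k * t\<bar> < 1" using eq by linarith
        then have "2 ^ j * \<bar>2 ^ k * s - 2 ^ k * t\<bar> \<le> 2 ^ j * 1" by (intro mult_left_mono) auto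
        moreover have "2 ^ j * \<bar>2 ^ k * s - 2 ^ k * t\<bar> = \<bar>2 ^ (j + k) * s - 2 ^ (j + k) * t\<bar>"
        proof -
          have "2 ^ j * \<bar>2 ^ k * s - 2 ^ k * t\<bar> = \<bar>2 ^ j * (2 ^ k * s - 2 ^ k * t)\<bar>"
            by (simp add: abs_mult)
          then show ?thesis by (simp add: algebra_simps power_add)
        qed
        ultimately have "\<bar>2 ^ (j + k) * s - 2 ^ (j + k) * t\<bar> \<le> real_of_int (2 ^ j)" by simp
        then have "\<bar>\<lfloor>2 ^ (j + k) * s\<rfloor> - \<lfloor>2 ^ (j + k) * t\<rfloor>\<bar> \<le> 2 ^ j" by linarith
        then have "\<bar>real_of_int \<lfloor>2 ^ (j + k) * s\<rfloor> - real_of_int \<lfloor>2 ^ (j + k) * t\<rfloor>\<bar> \<le> 2 ^ j"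
          by (metis (no_types, opaque_lifting) of_int_abs of_int_diff of_int_le_iff of_int_numeral of_int_power)
        then have "\<bar>real_of_int \<lfloor>2 ^ (j + k) * s\<rfloor> - real_of_int \<lfloor>2 ^ (j + k) * t\<rfloor>\<bar> * \<beta> ^ (j + k) \<le> 2 ^ j * \<beta> ^ (j + k)"
          using \<beta> by (intro mult_right_mono) auto
        moreover have "\<bar>e (j + k)\<bar> = \<bar>real_of_int \<lfloor>2 ^ (j + k) * s\<rfloor> - real_of_int \<lfloor>2 ^ (j + k) * t\<rfloor>\<bar> * \<beta> ^ (j + k)"
          using \<beta> by (simp add: e_def d_def abs_mult flip: left_diff_distrib)
        ultimately show ?thesis by (simp add: power_add power_mult_distrib algebra_simps)
      qed
      have "\<psi> s - \<psi> t = (\<Sum>j. e j)" unfolding \<psi>_def e_def using st by (intro suminf_diff ds)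
      also have "\<dots> = (\<Sum>j. e (j + k)) + (\<Sum>j<k. e j)" by (rule suminf_split_initial_segment[OF es])
      also have "(\<Sum>j<k. e j) = 0" using e0 by simp
      finally have "\<bar>\<psi> s - \<psi> t\<bar> = \<bar>\<Sum>j. e (j + k)\<bar>" by simp
      also have "\<dots> \<le> (\<Sum>j. \<beta> ^ k * (2 * \<beta>) ^ j)"
        using norm_suminf_le[of "\<lambda>j. e (j + k)" "\<lambda>j. \<beta> ^ k * (2 * \<beta>) ^ j"] eb geo(1)
        by (auto intro: summable_mult)
      also have "\<dots> = \<beta> ^ k * (1 / (1 - 2 * \<beta>))" using geo by (simp add: suminf_mult)
      finally have "\<kappa> * \<bar>\<psi> s - \<psi> t\<bar> \<le> \<kappa> * (\<beta> ^ k * (1 / (1 - 2 * \<beta>)))" using \<kappa> by (intro mult_left_mono) auto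
      also have "\<dots> = R * \<beta> ^ k" using \<beta> by (simp add: \<kappa>_def)
      also have "\<kappa> * \<bar>\<psi> s - \<psi> t\<bar> = \<bar>\<kappa> * \<psi> s - \<kappa> * \<psi> t\<bar>"
        using \<kappa> by (simp add: abs_mult flip: right_diff_distrib)
      finally show ?thesis by (simp add: \<beta>_def)
    qed
  qed
qed

text \<open>The \<open>2 ^ k\<close> dyadic intervals of level \<open>k\<close> have images of
  diameter at most \<open>R * \<beta> ^ k\<close>, and \<open>2 ^ k\<close> is
  \<open>\<beta> ^ k\<close> raised to the power \<open>- \<alpha>\<close>. Closing these images
  leaves their diameters unchanged.\<close>

lemma box_bounded_closure_dyadic:
  fixes \<phi> :: "real \<Rightarrow> real"
  assumes \<alpha>: "0 < \<alpha>" and R: "R > 0"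
    and osc: "\<And>k s t. \<lbrakk>0 \<le> s; s < 1; 0 \<le> t; t < 1; \<lfloor>2 ^ k * s\<rfloor> = \<lfloor>2 ^ k * t\<rfloor>\<rbrakk>
        \<Longrightarrow> \<bar>\<phi> s - \<phi> t\<bar> \<le> R * (2 powr (- 1 / \<alpha>)) ^ k"
  shows "box_bounded \<alpha> (closure (\<phi> ` {0..<1}))"
proof -
  define \<beta> where "\<beta> = 2 powr (- 1 / \<alpha>)"
  have "\<beta> < 2 powr 0" unfolding \<beta>_def using \<alpha> by (intro powr_less_mono) auto
  then have \<beta>: "0 < \<beta>" "\<beta> < 1" by (auto simp: \<beta>_def)
  have \<beta>\<alpha>: "(\<beta> ^ k) powr (- \<alpha>) = 2 ^ k" for k
    using \<alpha> by (simp add: \<beta>_def powr_power powr_powr powr_realpow)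
  \<comment> \<open>The summand \<open>1\<close> takes care of level \<open>k = 0\<close>; for
    higher levels, minimality of \<open>k\<close> gives \<open>2 ^ k \<le> 2 * R powr \<alpha> *
    \<epsilon> powr (- \<alpha>)\<close>.\<close>
  define K where "K = 1 + 2 * R powr \<alpha>"
  show ?thesis unfolding box_bounded_def
  proof (intro exI[of _ K] conjI allI impI)
    show "K > 0" by (simp add: K_def add_pos_nonneg)
    fix \<epsilon> :: real assume "0 < \<epsilon> \<and> \<epsilon> \<le> 1"
    then have \<epsilon>: "0 < \<epsilon>" "\<epsilon> \<le> 1" by auto
    define k where "k = (LEAST k. R * \<beta> ^ k \<le> \<epsilon>)"
    have "\<exists>k. R * \<beta> ^ k \<le> \<epsilon>"
      using real_arch_pow_inv[of "\<epsilon> / R" \<beta>] \<epsilon> R \<beta> by (auto simp: field_simps intro: less_imp_le)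
    then have k1: "R * \<beta> ^ k \<le> \<epsilon>" unfolding k_def by (rule LeastI_ex)
    have ge1: "1 \<le> \<epsilon> powr (- \<alpha>)" using powr_mono'[of "- \<alpha>" 0 \<epsilon>] \<epsilon> \<alpha> by simp
    have card: "2 ^ k \<le> K * \<epsilon> powr (- \<alpha>)"
    proof (cases k)
      case 0
      have "1 * 1 \<le> K * \<epsilon> powr (- \<alpha>)" using ge1 by (intro mult_mono) (auto simp: K_def)
      then show ?thesis using 0 by simp
    next
      case (Suc j)
      then have "\<epsilon> < R * \<beta> ^ j" using not_less_Least[of j "\<lambda>k. R * \<beta> ^ k \<le> \<epsilon>"] by (simp flip: k_def)
      then have "\<epsilon> / R \<le> \<beta> ^ j" using R by (simp add: field_simps)
      then have "(\<beta> ^ j) powr (- \<alpha>) \<le> (\<epsilon> / R) powr (- \<alpha>)"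
        using \<epsilon> R \<alpha> by (intro powr_mono2') auto
      also have "\<dots> = R powr \<alpha> * \<epsilon> powr (- \<alpha>)"
        using \<epsilon> R by (simp add: powr_divide powr_minus divide_simps)
      finally have "2 ^ k \<le> 2 * (R powr \<alpha> * \<epsilon> powr (- \<alpha>))" using Suc by (simp add: \<beta>\<alpha>)
      also have "\<dots> \<le> K * \<epsilon> powr (- \<alpha>)" by (simp add: K_def algebra_simps)
      finally show ?thesis .
    qed
    define J where "J j = {t::real. 0 \<le> t \<and> t < 1 \<and> \<lfloor>2 ^ k * t\<rfloor> = j}" for j :: int
    define \<U> where "\<U> = (\<lambda>j. closure (\<phi> ` J j)) ` {0..<2 ^ k}"
    have "card \<U> \<le> card {0..<2 ^ k :: int}" unfolding \<U>_def by (rule card_image_le) simp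
    then have "card \<U> \<le> 2 ^ k" by (simp add: nat_power_eq)
    then have "real (card \<U>) \<le> real (2 ^ k)" by (rule of_nat_mono)
    then have cU: "real (card \<U>) \<le> 2 ^ k" by simp
    have sm: "bounded (\<phi> ` J j)" "diameter (\<phi> ` J j) \<le> \<epsilon>" for j
    proof -
      have "dist x y \<le> \<epsilon>" if xy: "x \<in> \<phi> ` J j" "y \<in> \<phi> ` J j" for x y
      proof -
        obtain s t where "x = \<phi> s" "y = \<phi> t" "s \<in> J j" "t \<in> J j" using xy by blast
        then have "dist x y \<le> R * \<beta> ^ k" using osc[of s t k] by (auto simp: J_def dist_real_def \<beta>_def)
        with k1 show ?thesis by simp
      qed
      then show "bounded (\<phi> ` J j)" "diameter (\<phi> ` J j) \<le> \<epsilon>" using \<epsilon> by (auto intro!: small_setI)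
    qed
    show "\<exists>\<U>. finite \<U> \<and> real (card \<U>) \<le> K * \<epsilon> powr (- \<alpha>) \<and> closure (\<phi> ` {0..<1}) \<subseteq> \<Union>\<U> \<and>
          (\<forall>U\<in>\<U>. bounded U \<and> diameter U \<le> \<epsilon>)"
    proof (intro exI[of _ \<U>] conjI ballI)
      show "finite \<U>" by (simp add: \<U>_def)
      show "real (card \<U>) \<le> K * \<epsilon> powr (- \<alpha>)" using cU card by linarith
      show "closure (\<phi> ` {0..<1}) \<subseteq> \<Union>\<U>"
      proof (rule closure_minimal)
        show "closed (\<Union>\<U>)" by (intro closed_Union) (auto simp: \<U>_def)
        show "\<phi> ` {0..<1} \<subseteq> \<Union>\<U>"
        proof
          fix x assume "x \<in> \<phi> ` {0..<1}"
          then obtain t where t: "x = \<phi> t" "0 \<le> t" "t < 1" by auto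
          have "2 ^ k * t < 2 ^ k * 1" using t by (intro mult_strict_left_mono) auto
          then have "\<lfloor>2 ^ k * t\<rfloor> < 2 ^ k" by (simp add: floor_less_iff)
          moreover have "0 \<le> \<lfloor>2 ^ k * t\<rfloor>" using t by simp
          moreover have "x \<in> closure (\<phi> ` J \<lfloor>2 ^ k * t\<rfloor>)"
            using t by (intro subsetD[OF closure_subset]) (auto simp: J_def)
          ultimately show "x \<in> \<Union>\<U>" by (auto simp: \<U>_def)
        qed
      qed
      fix U assume "U \<in> \<U>"
      then show "bounded U" "diameter U \<le> \<epsilon>" using sm by (auto simp: \<U>_def diameter_closure)
    qed
  qed
qed

section \<open>Fibers of generic maps\<close>

text \<open>McShane's formula: the infimum of \<open>f y + L * dist x y\<close> over
  \<open>y\<close> is \<open>L\<close>-Lipschitz in \<open>x\<close>, and for large \<open>L\<close>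
  only points \<open>y\<close> near \<open>x\<close> can bring it below \<open>f x\<close>.\<close>

lemma lipschitz_approximation:
  fixes f :: "'a::metric_space \<Rightarrow> real"
  assumes K: "compact K" and f: "continuous_on K f" and e: "e > 0"
  obtains h L where "L \<ge> 0" "\<And>x. x \<in> K \<Longrightarrow> \<bar>h x - f x\<bar> \<le> e"
    "\<And>x y. \<bar>h x - h y\<bar> \<le> L * dist x y"
proof (cases "K = {}")
  case True
  then show ?thesis by (intro that[of 0 "\<lambda>_. 0"]) auto
next
  case False
  have "bounded (f ` K)" by (intro compact_imp_bounded compact_continuous_image K f)
  then obtain B where B: "B > 0" "\<And>x. x \<in> K \<Longrightarrow> \<bar>f x\<bar> \<le> B"
    unfolding bounded_pos by auto
  obtain d where d: "d > 0" "\<And>x y. \<lbrakk>x \<in> K; y \<in> K; dist y x < d\<rbrakk> \<Longrightarrow> dist (f y) (f x) < e"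
    using compact_uniformly_continuous[OF f K] e
    unfolding uniformly_continuous_on_def by blast
  \<comment> \<open>\<open>L * d\<close> equals \<open>2 * B\<close>, a bound for the oscillation of
    \<open>f\<close>: points at distance at least \<open>d\<close> cannot push the infimum below
    \<open>f x\<close>, and nearer ones do so by less than \<open>e\<close>.\<close>
  define L where "L = 2 * B / d"
  have L: "L \<ge> 0" using B d by (simp add: L_def)
  define h where "h x = (INF y\<in>K. f y + L * dist x y)" for x
  have bb: "bdd_below ((\<lambda>y. f y + L * dist x y) ` K)" for x
  proof (rule bdd_belowI2)
    fix y assume "y \<in> K"
    then have "- B \<le> f y" using B(2)[of y] by auto
    moreover have "0 \<le> L * dist x y" using L by simp
    ultimately show "- B \<le> f y + L * dist x y" by linarith
  qed
  have lip: "h x \<le> h y + L * dist x y" for x y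
  proof -
    have "h x - L * dist x y \<le> h y"
      unfolding h_def[of y]
    proof (rule cINF_greatest[OF False])
      fix z assume z: "z \<in> K"
      have "h x \<le> f z + L * dist x z" unfolding h_def by (rule cINF_lower[OF bb z])
      also have "L * dist x z \<le> L * (dist x y + dist y z)" using L by (intro mult_left_mono dist_triangle)
      finally show "h x - L * dist x y \<le> f z + L * dist y z" by (simp add: algebra_simps)
    qed
    then show ?thesis by simp
  qed
  show ?thesis
  proof (rule that[OF L, of h])
    fix x assume x: "x \<in> K"
    have "h x \<le> f x + L * dist x x" unfolding h_def by (rule cINF_lower[OF bb x])
    moreover have "f x - e \<le> h x" unfolding h_def
    proof (rule cINF_greatest[OF False])
      fix y assume y: "y \<in> K"
      show "f x - e \<le> f y + L * dist x y"
      proof (cases "dist x y < d")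
        case True
        then have "\<bar>f x - f y\<bar> < e" using d(2)[OF y x] by (simp add: dist_real_def)
        moreover have "0 \<le> L * dist x y" using L by simp
        ultimately show ?thesis by linarith
      next
        case False
        then have "L * d \<le> L * dist x y" using L by (intro mult_left_mono) auto
        then have "2 * B \<le> L * dist x y" using d by (simp add: L_def)
        then show ?thesis using B(2)[OF x] B(2)[OF y] e by linarith
      qed
    qed
    ultimately show "\<bar>h x - f x\<bar> \<le> e" using e by simp
  next
    fix x y
    show "\<bar>h x - h y\<bar> \<le> L * dist x y" using lip[of x y] lip[of y x] by (simp add: dist_commute abs_le_iff)
  qed
qed

text \<open>The triangle wave of period \<open>2\<close> with slopes \<open>1\<close> and
  \<open>-1\<close>. As a distance function it is continuous at once, and it is isometric between
  consecutive integers.\<close>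

definition zigzag :: "real \<Rightarrow> real" where
  "zigzag u = infdist u (range (\<lambda>i::int. 2 * real_of_int i))"

lemma zigzag_eqI:
  assumes "real_of_int (2 * i - 1) \<le> u" "u \<le> real_of_int (2 * i + 1)"
  shows "zigzag u = \<bar>u - 2 * real_of_int i\<bar>"
proof (rule antisym)
  show "zigzag u \<le> \<bar>u - 2 * real_of_int i\<bar>"
    unfolding zigzag_def by (rule infdist_le2[of "2 * real_of_int i"]) (auto simp: dist_real_def)
  show "\<bar>u - 2 * real_of_int i\<bar> \<le> zigzag u"
    unfolding zigzag_def
  proof (subst infdist_notempty, simp, rule cINF_greatest, simp)
    fix a assume "a \<in> range (\<lambda>i::int. 2 * real_of_int i)"
    then obtain k :: int where a: "a = 2 * real_of_int k" by blast
    consider "k = i" | "k + 1 \<le> i" | "i + 1 \<le> k" by linarith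
    then show "\<bar>u - 2 * real_of_int i\<bar> \<le> dist u a"
    proof cases
      case 2
      then have "real_of_int k + 1 \<le> real_of_int i" by linarith
      then show ?thesis using assms by (simp add: a dist_real_def)
    next
      case 3
      then have "real_of_int i + 1 \<le> real_of_int k" by linarith
      then show ?thesis using assms by (simp add: a dist_real_def)
    qed (simp add: a dist_real_def)
  qed
qed

lemma zigzag_isometric:
  assumes "\<lfloor>u\<rfloor> = \<lfloor>v\<rfloor>"
  shows "\<bar>zigzag u - zigzag v\<bar> = \<bar>u - v\<bar>"
proof -
  define j where "j = \<lfloor>u\<rfloor>"
  have j: "real_of_int j \<le> u" "u < real_of_int j + 1" "real_of_int j \<le> v" "v < real_of_int j + 1"
    using assms unfolding j_def by linarith+
  show ?thesis
  proof (cases "even j")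
    case True
    then obtain i where "j = 2 * i" by (auto elim: evenE)
    then show ?thesis using zigzag_eqI[of i u] zigzag_eqI[of i v] j by auto
  next
    case False
    then obtain i where "j = 2 * i + 1" by (auto elim: oddE)
    then show ?thesis using zigzag_eqI[of "i + 1" u] zigzag_eqI[of "i + 1" v] j by auto
  qed
qed

lemma zigzag_bounds: "0 \<le> zigzag u" "zigzag u \<le> 1"
proof -
  show "0 \<le> zigzag u" by (simp add: zigzag_def infdist_nonneg)
  define i where "i = \<lfloor>(u + 1) / 2\<rfloor>"
  have "real_of_int i \<le> (u + 1) / 2" "(u + 1) / 2 < real_of_int i + 1" unfolding i_def by linarith+
  then show "zigzag u \<le> 1" using zigzag_eqI[of i u] by auto
qed

lemma continuous_on_zigzag [continuous_intros]:
  "continuous_on S f \<Longrightarrow> continuous_on S (\<lambda>x. zigzag (f x))"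
  unfolding zigzag_def by (rule continuous_on_infdist)

text \<open>On a grid cell of side \<open>1 / M\<close> the zigzags are steep enough to dominate the
  Lipschitz part of \<open>g\<close>. Points of one fibre whose coordinates at \<open>m0\<close>
  differ by at most \<open>r\<close> then differ in the other coordinates by at most
  \<open>(1 + L) * r\<close> in total, so every set of size \<open>r\<close> in the Cantor factor
  costs one set of size \<open>(2 + L) * r\<close> per cell. The number of cells depends on
  \<open>M\<close> only, which is fixed before \<open>r\<close>; hence the count is of order
  \<open>r powr (- \<alpha>)\<close>, and \<open>\<alpha> < s\<close> makes the sum small. The bound
  holds for all maps within \<open>r / 2\<close> of \<open>g\<close> and all \<open>y\<close>
  simultaneously.\<close>

lemma perturbation_small_fibers:
  fixes f :: "real ^ 'm \<Rightarrow> real ^ 'n" and m0 :: 'm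
  assumes K: "compact K" "K' \<subseteq> K" "K' \<subseteq> slab m0 C 1" and box: "box_bounded \<alpha> C"
    and s: "\<alpha> < s" "0 < s" and \<eta>: "\<eta> > 0" and dim: "CARD('m) = CARD('n) + 1"
    and f: "continuous_on K f" and e: "e > 0"
  obtains g \<delta> where "\<delta> > 0" "continuous_on K g" "\<And>x. x \<in> K \<Longrightarrow> dist (f x) (g x) \<le> e"
    "\<And>h y. (\<And>x. x \<in> K \<Longrightarrow> dist (g x) (h x) \<le> \<delta>)
       \<Longrightarrow> hausdorff_premeasure s \<eta> (fiber K' h y) \<le> ennreal \<eta>"
proof -
  define n where "n = CARD('n)"
  have n: "real n \<ge> 1" by (simp add: n_def Suc_le_eq)
  have "card (- {m0}) = CARD('n)" using dim by (simp add: Compl_eq_Diff_UNIV card_Diff_singleton)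
  then obtain \<sigma> :: "'n \<Rightarrow> 'm" where \<sigma>: "bij_betw \<sigma> UNIV (- {m0})"
    using finite_same_card_bij[of "UNIV :: 'n set" "- {m0}"] by auto
  have \<sigma>m: "\<sigma> j \<noteq> m0" for j using \<sigma> by (auto simp: bij_betw_def)
  \<comment> \<open>Each component moves by at most \<open>e'\<close> in the Lipschitz approximation
    and by at most \<open>e'\<close> through the zigzag; the \<open>n\<close> components add up to
    \<open>e\<close>.\<close>
  define e' where "e' = e / (2 * real n)"
  have e': "e' > 0" using e n by (simp add: e'_def)
  have "\<exists>h L. L \<ge> 0 \<and> (\<forall>x\<in>K. \<bar>h x - f x $ j\<bar> \<le> e') \<and> (\<forall>x y. \<bar>h x - h y\<bar> \<le> L * dist x y)" for j
    by (rule lipschitz_approximation[OF K(1), of "\<lambda>x. f x $ j" e'])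
      (use f e' in \<open>auto intro!: continuous_intros\<close>)
  then obtain p Lj where p: "\<And>j. Lj j \<ge> 0" "\<And>j x. x \<in> K \<Longrightarrow> \<bar>p j x - f x $ j\<bar> \<le> e'"
    "\<And>j x y. \<bar>p j x - p j y\<bar> \<le> Lj j * dist x y"
    by metis
  define L where "L = (\<Sum>j\<in>UNIV. Lj j)"
  have L: "L \<ge> 0" unfolding L_def using p(1) by (intro sum_nonneg) auto
  have pL: "\<bar>p j x - p j y\<bar> \<le> L * dist x y" for j x y
  proof -
    have "Lj j \<le> L" unfolding L_def using p(1) by (intro member_le_sum) auto
    then show ?thesis using p(3)[of j x y] by (meson mult_right_mono order_trans zero_le_dist)
  qed
  \<comment> \<open>The slope \<open>e' * M\<close> of the zigzags becomes at least
    \<open>n * L + n\<close>: when the component inequalities are summed over \<open>j\<close>, the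
    term \<open>n * L * S\<close> is absorbed and \<open>n * S\<close> remains.\<close>
  obtain M0 :: nat where M0: "(real n * L + real n) / e' \<le> real M0" using real_arch_simple by blast
  define M where "M = M0 + 1"
  have M: "real M \<ge> 1" "e' * real M \<ge> real n * L + real n"
  proof -
    have "(real n * L + real n) / e' \<le> real M" using M0 by (simp add: M_def)
    then show "e' * real M \<ge> real n * L + real n" using e' by (simp add: field_simps)
  qed (simp add: M_def)
  define g where "g x = (\<chi> j. p j x + e' * zigzag (real M * x $ \<sigma> j))" for x
  have pc: "continuous_on S (p j)" for S j
    by (rule lipschitz_on_continuous_on[of "Lj j"]) (auto simp: lipschitz_on_def dist_real_def p)
  have gc: "continuous_on K g"
    unfolding g_def by (intro continuous_on_vec_lambda continuous_intros pc)
  have gf: "dist (f x) (g x) \<le> e" if "x \<in> K" for x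
  proof -
    have "\<bar>f x $ j - g x $ j\<bar> \<le> 2 * e'" for j
    proof -
      have "e' * zigzag (real M * x $ \<sigma> j) \<le> e' * 1"
        using e' zigzag_bounds by (intro mult_left_mono) auto
      moreover have "0 \<le> e' * zigzag (real M * x $ \<sigma> j)"
        using e' zigzag_bounds by simp
      ultimately show ?thesis using p(2)[OF that, of j] by (simp add: g_def abs_le_iff)
    qed
    then have "(\<Sum>j\<in>UNIV. \<bar>f x $ j - g x $ j\<bar>) \<le> (\<Sum>j\<in>(UNIV :: 'n set). 2 * e')" by (intro sum_mono)
    also have "\<dots> = e" using n by (simp add: e'_def n_def)
    finally show ?thesis using dist_vec_le_sum[of "f x" "g x"] by linarith
  qed
  obtain c where c: "c > 0" "\<And>\<epsilon>. \<lbrakk>0 < \<epsilon>; \<epsilon> \<le> 1\<rbrakk> \<Longrightarrow>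
     \<exists>\<U>. finite \<U> \<and> real (card \<U>) \<le> c * \<epsilon> powr (- \<alpha>) \<and> C \<subseteq> \<Union>\<U> \<and>
          (\<forall>U\<in>\<U>. bounded U \<and> diameter U \<le> \<epsilon>)"
    using box unfolding box_bounded_def by blast
  define Q where "Q = c * (real M + 1) ^ n * (2 + L) powr s"
  have Q: "Q > 0" using c L by (auto simp: Q_def)
  \<comment> \<open>The scale is chosen after \<open>M\<close>. The second bound makes the covering
    sets admissible for the scale \<open>\<eta>\<close>; the third brings
    \<open>Q * r powr (s - \<alpha>)\<close>, which bounds the cost of the cover, down to
    \<open>\<eta>\<close>.\<close>
  define r where "r = min 1 (min (\<eta> / (2 + L)) ((\<eta> / Q) powr (1 / (s - \<alpha>))))"
  have r: "0 < r" "r \<le> 1" "r \<le> \<eta> / (2 + L)" "r \<le> (\<eta> / Q) powr (1 / (s - \<alpha>))"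
    using \<eta> L Q by (auto simp: r_def)
  have r\<eta>: "(2 + L) * r \<le> \<eta>" using r(3) L by (simp add: field_simps)
  have "r powr (s - \<alpha>) \<le> ((\<eta> / Q) powr (1 / (s - \<alpha>))) powr (s - \<alpha>)"
    using r s by (intro powr_mono2) auto
  also have "\<dots> = \<eta> / Q" using s \<eta> Q by (simp add: powr_powr)
  finally have rQ: "Q * r powr (s - \<alpha>) \<le> \<eta>" using Q by (simp add: field_simps)
  show ?thesis
  proof (rule that[of "r / 2" g])
    fix h :: "real ^ 'm \<Rightarrow> real ^ 'n" and y
    assume h: "\<And>x. x \<in> K \<Longrightarrow> dist (g x) (h x) \<le> r / 2"
    define A where "A = fiber K' h y"
    have AK: "x \<in> K" "h x = y" "x \<in> slab m0 C 1" if "x \<in> A" for x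
      using that K by (auto simp: A_def fiber_def)
    obtain \<U> where U: "finite \<U>" "real (card \<U>) \<le> c * r powr (- \<alpha>)" "C \<subseteq> \<Union>\<U>"
      "\<And>U. U \<in> \<U> \<Longrightarrow> bounded U \<and> diameter U \<le> r" using c(2)[OF r(1,2)] by blast
    \<comment> \<open>The index \<open>M\<close> itself occurs for coordinates equal to
      \<open>1\<close>, whence \<open>M + 1\<close> values per coordinate.\<close>
    define Z where "Z = PiE (- {m0}) (\<lambda>_. {0..int M})"
    have Z: "finite Z" "card Z = (M + 1) ^ n"
      unfolding Z_def using card_cells[OF dim[folded n_def], of "int M"] by (auto simp: nat_add_distrib)
    define cell where "cell = (\<lambda>(U, k). {x \<in> A. x $ m0 \<in> U \<and> (\<forall>i. i \<noteq> m0 \<longrightarrow> \<lfloor>real M * x $ i\<rfloor> = k i)})"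
    have small: "dist x x' \<le> (2 + L) * r"
      if V: "V \<in> \<U>" and x: "x \<in> cell (V, k)" "x' \<in> cell (V, k)" for V k x x'
    proof -
      have xA: "x \<in> A" "x' \<in> A" using x by (auto simp: cell_def)
      define S where "S = (\<Sum>j\<in>UNIV. \<bar>x $ \<sigma> j - x' $ \<sigma> j\<bar>)"
      have "dist (x $ m0) (x' $ m0) \<le> diameter V"
        using x U(4)[OF V] by (intro diameter_bounded_bound) (auto simp: cell_def)
      then have c0: "\<bar>x $ m0 - x' $ m0\<bar> \<le> r" using U(4)[OF V] by (simp add: dist_real_def)
      have "(\<Sum>i\<in>UNIV. \<bar>x $ i - x' $ i\<bar>) = \<bar>x $ m0 - x' $ m0\<bar> + (\<Sum>i\<in>- {m0}. \<bar>x $ i - x' $ i\<bar>)"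
        by (subst sum.remove[of UNIV m0]) (auto simp: Compl_eq_Diff_UNIV)
      also have "(\<Sum>i\<in>- {m0}. \<bar>x $ i - x' $ i\<bar>) = S"
        unfolding S_def by (rule sum.reindex_bij_betw[OF \<sigma>, symmetric])
      finally have dS: "dist x x' \<le> r + S" using dist_vec_le_sum[of x x'] c0 by linarith
      have comp: "e' * real M * \<bar>x $ \<sigma> j - x' $ \<sigma> j\<bar> \<le> r + L * r + L * S" for j
      proof -
        \<comment> \<open>Since \<open>h\<close> is constant on the fibre, \<open>g\<close> varies
          there by at most twice \<open>r / 2\<close>.\<close>
        have "dist (g x) (g x') \<le> dist (g x) y + dist (g x') y" by (rule dist_triangle2)
        also have "\<dots> \<le> r" using h[OF AK(1)[OF xA(1)]] h[OF AK(1)[OF xA(2)]] AK(2)[OF xA(1)] AK(2)[OF xA(2)]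
          by auto
        finally have "\<bar>g x $ j - g x' $ j\<bar> \<le> r"
          using component_le_norm_cart[of "g x - g x'" j] by (simp add: dist_norm)
        then have "\<bar>p j x - p j x' + (e' * zigzag (real M * x $ \<sigma> j) - e' * zigzag (real M * x' $ \<sigma> j))\<bar> \<le> r"
          by (simp add: g_def algebra_simps)
        moreover have "\<bar>p j x - p j x'\<bar> \<le> L * (r + S)"
          using pL[of j x x'] mult_left_mono[OF dS L] by linarith
        ultimately have "\<bar>e' * zigzag (real M * x $ \<sigma> j) - e' * zigzag (real M * x' $ \<sigma> j)\<bar> \<le> r + L * (r + S)"
          by linarith
        moreover have "\<bar>e' * zigzag (real M * x $ \<sigma> j) - e' * zigzag (real M * x' $ \<sigma> j)\<bar>
            = e' * \<bar>zigzag (real M * x $ \<sigma> j) - zigzag (real M * x' $ \<sigma> j)\<bar>"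
          using e' by (simp add: abs_mult flip: right_diff_distrib)
        moreover have "\<bar>zigzag (real M * x $ \<sigma> j) - zigzag (real M * x' $ \<sigma> j)\<bar> = \<bar>real M * x $ \<sigma> j - real M * x' $ \<sigma> j\<bar>"
          using x \<sigma>m[of j] by (intro zigzag_isometric) (auto simp: cell_def)
        moreover have "\<bar>real M * x $ \<sigma> j - real M * x' $ \<sigma> j\<bar> = real M * \<bar>x $ \<sigma> j - x' $ \<sigma> j\<bar>"
          by (simp add: abs_mult flip: right_diff_distrib)
        ultimately show ?thesis by (simp add: algebra_simps)
      qed
      have S0: "S \<ge> 0" unfolding S_def by (intro sum_nonneg) auto
      have "(real n * L + real n) * S \<le> e' * real M * S" using M(2) S0 by (intro mult_right_mono)
      also have "\<dots> = (\<Sum>j\<in>UNIV. e' * real M * \<bar>x $ \<sigma> j - x' $ \<sigma> j\<bar>)"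
        by (simp add: S_def sum_distrib_left)
      also have "\<dots> \<le> (\<Sum>j\<in>(UNIV :: 'n set). r + L * r + L * S)" by (intro sum_mono comp)
      also have "\<dots> = real n * (r + L * r + L * S)" by (simp add: n_def)
      finally have "real n * S \<le> real n * (r + L * r)" by (simp add: algebra_simps)
      then have "S \<le> r + L * r" using n by simp
      then show ?thesis using dS by (simp add: algebra_simps)
    qed
    have "hausdorff_premeasure s \<eta> A \<le> ennreal (real (card (cell ` (\<U> \<times> Z))) * ((2 + L) * r) powr s)"
    proof (rule hausdorff_premeasure_finite_cover)
      show "finite (cell ` (\<U> \<times> Z))" using U Z by blast
      show "A \<subseteq> \<Union> (cell ` (\<U> \<times> Z))"
      proof
        fix x assume x: "x \<in> A"
        then obtain V where V: "V \<in> \<U>" "x $ m0 \<in> V" using U(3) AK(3)[OF x] by (auto simp: slab_def)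
        define k where "k = restrict (\<lambda>i. \<lfloor>real M * x $ i\<rfloor>) (- {m0})"
        have "k \<in> Z" unfolding Z_def k_def
        proof (rule restrict_PiE_iff[THEN iffD2], intro ballI)
          fix i assume "i \<in> - {m0}"
          then have "0 \<le> x $ i" "x $ i \<le> 1" using AK(3)[OF x] by (auto simp: slab_def)
          then have "0 \<le> real M * x $ i" "real M * x $ i \<le> real M * 1" using M by (auto intro: mult_left_mono)
          then show "\<lfloor>real M * x $ i\<rfloor> \<in> {0..int M}" by (auto simp: floor_le_iff)
        qed
        moreover have "x \<in> cell (V, k)" using x V by (simp add: cell_def k_def)
        ultimately show "x \<in> \<Union> (cell ` (\<U> \<times> Z))" using V by blast
      qed
      fix W assume "W \<in> cell ` (\<U> \<times> Z)"
      then obtain V k where "V \<in> \<U>" "W = cell (V, k)" by blast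
      then show "bounded W" "diameter W \<le> (2 + L) * r"
        using small[of V _ k] r L by (auto intro!: small_setI)
    qed (use r L s r\<eta> in auto)
    also have "\<dots> \<le> ennreal \<eta>"
    proof (rule ennreal_leI)
      have "card (cell ` (\<U> \<times> Z)) \<le> card (\<U> \<times> Z)" by (rule card_image_le) (use U Z in auto)
      then have "real (card (cell ` (\<U> \<times> Z))) \<le> real (card \<U>) * real (card Z)"
        by (metis card_cartesian_product of_nat_le_iff of_nat_mult)
      also have "\<dots> \<le> (c * r powr (- \<alpha>)) * (real M + 1) ^ n"
        using U(2) c Z(2) by (intro mult_mono) (auto simp: add.commute)
      finally have "real (card (cell ` (\<U> \<times> Z))) * ((2 + L) * r) powr s
          \<le> (c * r powr (- \<alpha>)) * (real M + 1) ^ n * ((2 + L) * r) powr s"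
        by (intro mult_right_mono) auto
      also have "\<dots> = Q * (r powr (- \<alpha>) * r powr s)"
        using r L by (simp add: Q_def powr_mult)
      also have "r powr (- \<alpha>) * r powr s = r powr (s - \<alpha>)" by (simp flip: powr_add)
      finally show "real (card (cell ` (\<U> \<times> Z))) * ((2 + L) * r) powr s \<le> \<eta>" using rQ by linarith
    qed
    finally show "hausdorff_premeasure s \<eta> (fiber K' h y) \<le> ennreal \<eta>" by (simp add: A_def)
  qed (use r gc gf in auto)
qed

text \<open>Arbitrarily close to any \<open>f\<close> there is a map \<open>g\<close> with a whole
  ball around it free of exceptional maps, because the estimate for \<open>g\<close> survives
  perturbation uniformly in \<open>y\<close>.\<close>

lemma nowhere_dense_large_fibers:
  fixes K K' :: "(real ^ 'm) set" and m0 :: 'm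
  assumes K: "compact K" "K' \<subseteq> K" "K' \<subseteq> slab m0 C 1" and box: "box_bounded \<alpha> C"
    and s: "\<alpha> < s" "0 < s" and \<eta>: "\<eta> > 0" and dim: "CARD('m) = CARD('n) + 1"
  shows "nowhere_dense_in (mtopology_of (C_metric K :: (real ^ 'm \<Rightarrow> real ^ 'n) metric))
     {f \<in> mspace (C_metric K). \<exists>y. \<not> hausdorff_premeasure s \<eta> (fiber K' f y) \<le> ennreal \<eta>}"
    (is "nowhere_dense_in (mtopology_of ?m) ?E")
proof -
  interpret M: Metric_space "mspace ?m" "mdist ?m" by (rule Metric_space_mspace_mdist)
  have top: "mtopology_of ?m = M.mtopology" by (simp add: mtopology_of_def)
  have "M.mtopology interior_of (M.mtopology closure_of ?E) = {}"
  proof (rule ccontr)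
    assume "\<not> ?thesis"
    then obtain f W where W: "openin M.mtopology W" "f \<in> W" "W \<subseteq> M.mtopology closure_of ?E"
      unfolding interior_of_def by blast
    obtain e where e: "e > 0" "M.mball f e \<subseteq> W" using W(1,2) unfolding M.openin_mtopology by blast
    have fm: "f \<in> mspace ?m" using W(1,2) unfolding M.openin_mtopology by blast
    then have "continuous_on K f" by (simp add: mspace_C_metric[OF K(1)])
    then obtain g \<delta> where g: "\<delta> > 0" "continuous_on K g" "\<And>x. x \<in> K \<Longrightarrow> dist (f x) (g x) \<le> e/2"
      "\<And>h y. (\<And>x. x \<in> K \<Longrightarrow> dist (g x) (h x) \<le> \<delta>)
         \<Longrightarrow> hausdorff_premeasure s \<eta> (fiber K' h y) \<le> ennreal \<eta>"
      using perturbation_small_fibers[OF K box s \<eta> dim, of f "e/2"] e by (metis half_gt_zero)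
    \<comment> \<open>Points of the function space have to be \<open>undefined\<close> outside
      \<open>K\<close>.\<close>
    define g' where "g' = restrict g K"
    have gm: "g' \<in> mspace ?m"
      using g(2) by (auto simp: mspace_C_metric[OF K(1)] g'_def cong: continuous_on_cong)
    have "mdist ?m f g' \<le> e/2"
      unfolding C_metric_def using g(3) e by (intro mdist_cfunspace_le) (auto simp: g'_def)
    then have "g' \<in> M.mball f e" using fm gm e by (simp add: M.in_mball)
    then have "g' \<in> M.mtopology closure_of ?E" using e W by blast
    then obtain h where h: "h \<in> ?E" "h \<in> M.mball g' \<delta>"
      using g(1) unfolding M.metric_closure_of by blast
    have "dist (g x) (h x) \<le> \<delta>" if "x \<in> K" for x
    proof -
      have hm: "h \<in> mspace ?m" using h(1) by blast
      have "mdist ?m g' h \<le> \<delta>"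
        using h(2)[unfolded M.in_mball, THEN conjunct2, THEN conjunct2] by (rule less_imp_le)
      from mdist_cfunspace_imp_mdist_le[OF gm[unfolded C_metric_def] hm[unfolded C_metric_def]
          this[unfolded C_metric_def], of x]
      have "mdist euclidean_metric (g' x) (h x) \<le> \<delta>" using that by simp
      then show ?thesis using that by (simp add: g'_def)
    qed
    then have "hausdorff_premeasure s \<eta> (fiber K' h y) \<le> ennreal \<eta>" for y using g(4) by blast
    then show False using h(1) by blast
  qed
  then show ?thesis by (auto simp: nowhere_dense_in_def top)
qed

section \<open>Lower bounds for complements\<close>

text \<open>The inverse of \<open>\<phi>\<close> is Hoelder with exponent \<open>\<alpha>\<close>,
  so a cover of \<open>A\<close>, read through the coordinate at \<open>m0\<close>, pulls back to a
  cover of \<open>[0, 1)\<close> by intervals of length \<open>2 * c\<close> times the diameter to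
  the power \<open>\<alpha>\<close>. For diameters up to \<open>1\<close> this power is at most the
  power \<open>s < \<alpha>\<close>, so the cost cannot be small.\<close>

lemma hausdorff_dim_ge_expanding:
  fixes A :: "(real ^ 'm) set" and \<phi> :: "real \<Rightarrow> real"
  assumes c: "c > 0" and \<alpha>: "0 < \<alpha>"
    and expand: "\<And>s t. \<lbrakk>0 \<le> s; s < 1; 0 \<le> t; t < 1\<rbrakk> \<Longrightarrow> \<bar>s - t\<bar> \<le> c * \<bar>\<phi> s - \<phi> t\<bar> powr \<alpha>"
    and proj: "\<And>t. \<lbrakk>0 \<le> t; t < 1\<rbrakk> \<Longrightarrow> \<exists>x\<in>A. x $ m0 = \<phi> t"
  shows "ereal \<alpha> \<le> hausdorff_dim A"
proof (rule hausdorff_dim_ge)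
  show "A \<noteq> {}" using proj[of 0] by auto
  fix s assume s: "0 \<le> s" "s < \<alpha>"
  show "hausdorff_measure s A \<noteq> 0"
  proof
    assume "hausdorff_measure s A = 0"
    \<comment> \<open>A cover cheaper than \<open>1 / (4 * c)\<close> pulls back to total length at
      most \<open>1/2\<close>, too short for \<open>[0, 1)\<close>.\<close>
    then have "hausdorff_premeasure s 1 A < ennreal (1 / (4 * c))"
      using hausdorff_premeasure_le_measure[of 1 s A] c by simp
    then obtain U :: "nat \<Rightarrow> (real ^ 'm) set" where U: "A \<subseteq> (\<Union>i. U i)" "\<And>i. bounded (U i)"
      "\<And>i. diameter (U i) \<le> 1" "(\<Sum>i. diam_power s (U i)) < ennreal (1 / (4 * c))"
      by (rule hausdorff_premeasure_lessE) (rule that, auto)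
    define T where "T i = {t. 0 \<le> t \<and> t < 1 \<and> (\<exists>x\<in>U i. x $ m0 = \<phi> t)}" for i
    define p where "p i = (SOME t. t \<in> T i)" for i
    define d where "d i = c * diameter (U i) powr \<alpha>" for i
    have d0: "d i \<ge> 0" for i using c by (simp add: d_def)
    define I where "I i = (if T i = {} then {} else cbox (p i - d i) (p i + d i))" for i
    have TI: "T i \<subseteq> I i" for i
    proof
      fix t assume t: "t \<in> T i"
      then have p: "p i \<in> T i" unfolding p_def by (metis someI)
      obtain x y where xy: "x \<in> U i" "x $ m0 = \<phi> t" "y \<in> U i" "y $ m0 = \<phi> (p i)"
        using t p by (auto simp: T_def)
      have "\<bar>\<phi> t - \<phi> (p i)\<bar> \<le> dist x y"
        using component_le_norm_cart[of "x - y" m0] xy by (simp add: dist_norm)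
      also have "\<dots> \<le> diameter (U i)" using U(2) xy by (intro diameter_bounded_bound)
      finally have "\<bar>\<phi> t - \<phi> (p i)\<bar> powr \<alpha> \<le> diameter (U i) powr \<alpha>" using \<alpha> by (intro powr_mono2) auto
      then have "c * \<bar>\<phi> t - \<phi> (p i)\<bar> powr \<alpha> \<le> d i" unfolding d_def using c by (intro mult_left_mono) auto
      moreover have "\<bar>t - p i\<bar> \<le> c * \<bar>\<phi> t - \<phi> (p i)\<bar> powr \<alpha>"
        using t p by (intro expand) (auto simp: T_def)
      ultimately have "\<bar>t - p i\<bar> \<le> d i" by linarith
      then show "t \<in> I i" using t by (auto simp: I_def)
    qed
    have mI: "emeasure lborel (I i) \<le> ennreal (2 * c) * diam_power s (U i)" for i
    proof (cases "T i = {}")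
      case True
      then show ?thesis by (simp add: I_def)
    next
      case False
      then have ne: "U i \<noteq> {}" by (auto simp: T_def)
      have D: "0 \<le> diameter (U i)" using U(2) by (rule diameter_ge_0)
      have le: "ennreal (diameter (U i) powr \<alpha>) \<le> diam_power s (U i)"
      proof (cases "s = 0")
        case True
        then show ?thesis using ne D U(3)[of i] \<alpha> powr_mono2[of \<alpha> "diameter (U i)" 1]
          by (simp add: diam_power_def ennreal_le_1)
      next
        case False
        then show ?thesis using ne D U(3)[of i] s
          by (auto simp: diam_power_def intro!: ennreal_leI powr_mono')
      qed
      have "emeasure lborel (I i) = ennreal (2 * c * diameter (U i) powr \<alpha>)"
        using False d0[of i] by (simp add: I_def d_def)
      also have "\<dots> = ennreal (2 * c) * ennreal (diameter (U i) powr \<alpha>)"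
        using c by (intro ennreal_mult) auto
      also have "\<dots> \<le> ennreal (2 * c) * diam_power s (U i)" by (intro mult_left_mono le) auto
      finally show ?thesis .
    qed
    have Im: "I i \<in> sets lborel" for i by (auto simp: I_def)
    have "{0..<1} \<subseteq> (\<Union>i. I i)"
    proof
      fix t :: real assume t: "t \<in> {0..<1}"
      then obtain x where "x \<in> A" "x $ m0 = \<phi> t" using proj[of t] by auto
      moreover from this obtain i where "x \<in> U i" using U(1) by blast
      ultimately have "t \<in> T i" using t by (auto simp: T_def)
      then show "t \<in> (\<Union>i. I i)" using TI by blast
    qed
    then have "emeasure lborel {0..<1::real} \<le> emeasure lborel (\<Union>i. I i)"
      using Im by (intro emeasure_mono sets.countable_UN) auto
    also have "\<dots> \<le> (\<Sum>i. emeasure lborel (I i))"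
      using Im by (intro emeasure_subadditive_countably) auto
    also have "\<dots> \<le> (\<Sum>i. ennreal (2 * c) * diam_power s (U i))"
      by (intro suminf_le mI) auto
    also have "\<dots> = ennreal (2 * c) * (\<Sum>i. diam_power s (U i))" by simp
    also have "\<dots> \<le> ennreal (2 * c) * ennreal (1 / (4 * c))"
      using U(4) by (intro mult_left_mono) auto
    also have "\<dots> = ennreal (1/2)" using c by (simp flip: ennreal_mult)
    finally have "emeasure lborel {0..<1::real} \<le> ennreal (1/2)" .
    moreover have "emeasure lborel {0..<1::real} = ennreal 1" by simp
    ultimately have "ennreal 1 \<le> ennreal (1/2)" by (simp only:)
    then show False by (subst (asm) ennreal_le_iff) auto
  qed
qed

lemma prod_distinguished_index:
  fixes m0 :: "'m::finite" and A B :: real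
  assumes "CARD('m) = n + 1"
  shows "(\<Prod>i\<in>(UNIV :: 'm set). if i = m0 then A else B) = A * B ^ n"
proof -
  have "card (UNIV - {m0}) = n" using assms by (simp add: card_Diff_singleton)
  moreover have "(\<Prod>i\<in>UNIV - {m0}. if i = m0 then A else B) = (\<Prod>i\<in>UNIV - {m0}. B)"
    by (rule prod.cong) auto
  ultimately show ?thesis by (subst prod.remove[of UNIV m0]) auto
qed

text \<open>The same comparison with Lebesgue measure in \<open>n + 1\<close> dimensions: a set of
  diameter \<open>\<epsilon>\<close> pulls back into a box with one side
  \<open>2 * c * \<epsilon> powr \<alpha>\<close> and \<open>n\<close> sides
  \<open>2 * \<epsilon>\<close>. The product has to lie only in the closure of \<open>A\<close>,
  because finite covers pass to closures; so the density supplied by Baire's theorem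
  suffices.\<close>

lemma upper_box_dim_ge_expanding:
  fixes A :: "(real ^ 'm) set" and \<phi> :: "real \<Rightarrow> real" and a :: "real ^ 'm"
  assumes c: "c > 0" and \<alpha>: "0 < \<alpha>" and dim: "CARD('m) = n + 1"
    and expand: "\<And>s t. \<lbrakk>0 \<le> s; s < 1; 0 \<le> t; t < 1\<rbrakk> \<Longrightarrow> \<bar>s - t\<bar> \<le> c * \<bar>\<phi> s - \<phi> t\<bar> powr \<alpha>"
    and u: "0 \<le> u" "u + w < 1" "w > 0" and r: "r > 0"
    and box: "{x. x $ m0 \<in> \<phi> ` {u..u + w} \<and> (\<forall>i. i \<noteq> m0 \<longrightarrow> \<bar>x $ i - a $ i\<bar> \<le> r)} \<subseteq> closure A"
  shows "ereal (real n + \<alpha>) \<le> upper_box_dim A"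
proof (rule upper_box_dim_ge)
  define lift where "lift \<tau> = (\<chi> i. if i = m0 then \<phi> (\<tau> $ m0) else \<tau> $ i)" for \<tau> :: "real ^ 'm"
  define Q where "Q = cbox (\<chi> i. if i = m0 then u else a $ i - r) ((\<chi> i. if i = m0 then u + w else a $ i + r) :: real ^ 'm)"
  have Q: "\<tau> \<in> Q \<longleftrightarrow> u \<le> \<tau> $ m0 \<and> \<tau> $ m0 \<le> u + w \<and> (\<forall>i. i \<noteq> m0 \<longrightarrow> \<bar>\<tau> $ i - a $ i\<bar> \<le> r)" for \<tau>
    by (fastforce simp: Q_def mem_box_cart abs_le_iff algebra_simps split: if_splits)
  have liftA: "lift \<tau> \<in> closure A" if "\<tau> \<in> Q" for \<tau>
    by (rule subsetD[OF box]) (use that in \<open>auto simp: Q lift_def\<close>)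
  have "(\<chi> i. if i = m0 then u else a $ i) \<in> Q" using u r by (simp add: Q)
  then have Qne: "Q \<noteq> {}" by blast
  then show "A \<noteq> {}" using liftA by auto
  have mQ: "measure lebesgue Q = w * (2 * r) ^ n"
  proof -
    have "measure lebesgue Q = measure lborel Q" by (simp add: Q_def)
    also have "\<dots> = (\<Prod>i\<in>UNIV. if i = m0 then w else 2 * r)"
      using Qne unfolding Q_def by (subst content_cbox_cart, assumption) (rule prod.cong, auto)
    finally show ?thesis by (simp add: prod_distinguished_index[OF dim])
  qed
  \<comment> \<open>The volume of \<open>Q\<close> divided by the constant factor in the volume of
    one pulled-back box.\<close>
  define v where "v = w * (2 * r) ^ n / (2 * c * 2 ^ n)"
  show "v > 0" using u r c by (simp add: v_def)
  show "(1::real) > 0" by simp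
  fix \<epsilon> :: real and \<U>
  assume \<epsilon>: "0 < \<epsilon>" "\<epsilon> < 1" and fin: "finite \<U>" and cov: "A \<subseteq> \<Union>\<U>"
    and U: "\<And>U. U \<in> \<U> \<Longrightarrow> bounded U \<and> diameter U \<le> \<epsilon>"
  have cl: "closure A \<subseteq> (\<Union>U\<in>\<U>. closure U)"
    by (rule closure_minimal) (use cov closure_subset fin in \<open>auto intro!: closed_UN\<close>, blast)
  define T where "T U = {\<tau> \<in> Q. lift \<tau> \<in> closure U}" for U
  define p where "p U = (SOME \<tau>. \<tau> \<in> T U)" for U
  define \<delta> where "\<delta> = (\<chi> i. if i = m0 then c * \<epsilon> powr \<alpha> else \<epsilon>)"
  define I where "I U = cbox (p U - \<delta>) (p U + \<delta>)" for U
  have \<delta>0: "\<delta> $ i \<ge> 0" for i using c \<epsilon> by (simp add: \<delta>_def)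
  have TI: "T U \<subseteq> I U" if "U \<in> \<U>" for U
  proof
    fix \<tau> assume \<tau>: "\<tau> \<in> T U"
    then have p: "p U \<in> T U" unfolding p_def by (metis someI)
    have "dist (lift \<tau>) (lift (p U)) \<le> diameter (closure U)"
      using \<tau> p U[OF that] by (intro diameter_bounded_bound) (auto simp: T_def)
    also have "\<dots> \<le> \<epsilon>" using U[OF that] by (simp add: diameter_closure)
    finally have d: "\<bar>lift \<tau> $ i - lift (p U) $ i\<bar> \<le> \<epsilon>" for i
      using component_le_norm_cart[of "lift \<tau> - lift (p U)" i] by (simp add: dist_norm)
    have "\<bar>\<tau> $ i - p U $ i\<bar> \<le> \<delta> $ i" for i
    proof (cases "i = m0")
      case True
      have "\<bar>\<tau> $ m0 - p U $ m0\<bar> \<le> c * \<bar>\<phi> (\<tau> $ m0) - \<phi> (p U $ m0)\<bar> powr \<alpha>"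
        using \<tau> p u by (intro expand) (auto simp: T_def Q)
      also have "\<dots> \<le> c * \<epsilon> powr \<alpha>"
        using d[of m0] c \<alpha> by (intro mult_left_mono powr_mono2) (auto simp: lift_def)
      finally show ?thesis using True by (simp add: \<delta>_def)
    next
      case False
      then show ?thesis using d[of i] by (simp add: lift_def \<delta>_def)
    qed
    then show "\<tau> \<in> I U" by (auto simp: I_def mem_box_cart abs_le_iff algebra_simps)
  qed
  have mI: "measure lebesgue (I U) = 2 * c * \<epsilon> powr \<alpha> * (2 * \<epsilon>) ^ n" for U
  proof -
    have "p U \<in> I U" using \<delta>0 by (auto simp: I_def mem_box_cart)
    then have ne: "I U \<noteq> {}" by blast
    have "measure lebesgue (I U) = measure lborel (I U)" by (simp add: I_def)
    also have "\<dots> = (\<Prod>i\<in>UNIV. if i = m0 then 2 * (c * \<epsilon> powr \<alpha>) else 2 * \<epsilon>)"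
      using ne unfolding I_def by (subst content_cbox_cart, assumption) (rule prod.cong, auto simp: \<delta>_def)
    finally show ?thesis by (simp add: prod_distinguished_index[OF dim])
  qed
  have "Q \<subseteq> (\<Union>U\<in>\<U>. I U)"
  proof
    fix \<tau> assume \<tau>: "\<tau> \<in> Q"
    then obtain U where "U \<in> \<U>" "lift \<tau> \<in> closure U" using liftA cl by blast
    then show "\<tau> \<in> (\<Union>U\<in>\<U>. I U)" using TI[of U] \<tau> by (auto simp: T_def)
  qed
  then have "measure lebesgue Q \<le> measure lebesgue (\<Union>U\<in>\<U>. I U)"
    using fin by (intro measure_mono_fmeasurable) (auto simp: I_def Q_def intro!: fmeasurable.finite_UN)
  also have "\<dots> \<le> (\<Sum>U\<in>\<U>. measure lebesgue (I U))"
    using fin by (intro measure_UNION_le) (auto simp: I_def)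
  also have "\<dots> = real (card \<U>) * (2 * c * 2 ^ n * (\<epsilon> powr \<alpha> * \<epsilon> ^ n))"
    by (simp add: mI power_mult_distrib)
  also have "\<epsilon> powr \<alpha> * \<epsilon> ^ n = \<epsilon> powr (real n + \<alpha>)"
    using \<epsilon> by (simp add: powr_add powr_realpow)
  finally have "w * (2 * r) ^ n \<le> real (card \<U>) * (2 * c * 2 ^ n) * \<epsilon> powr (real n + \<alpha>)"
    by (simp add: mQ)
  then have "v \<le> real (card \<U>) * \<epsilon> powr (real n + \<alpha>)"
    unfolding v_def using c by (subst pos_divide_le_eq) (auto simp: mult_ac)
  then show "v * \<epsilon> powr - (real n + \<alpha>) \<le> real (card \<U>)"
    unfolding powr_minus using \<epsilon> by (simp add: divide_inverse[symmetric] pos_divide_le_eq)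
qed

text \<open>The cube is centred at \<open>a\<close> instead of \<open>x\<close> because
  \<open>x\<close> may lie on the boundary of the cube factor. Clamping the free coordinates to
  \<open>[r, R - r]\<close> keeps it inside the slab and within \<open>2 * r\<close> of
  \<open>x\<close> in every coordinate.\<close>

lemma slab_local_cube:
  fixes x :: "real ^ 'm" and m0 :: 'm
  assumes x: "x \<in> slab m0 C R" and R: "R > 0" and e: "e > 0"
  shows "\<exists>a r. r > 0 \<and> a $ m0 = x $ m0 \<and>
    (\<forall>y. y $ m0 \<in> C \<and> \<bar>y $ m0 - x $ m0\<bar> < r \<and> (\<forall>i. i \<noteq> m0 \<longrightarrow> \<bar>y $ i - a $ i\<bar> \<le> r) \<longrightarrow> y \<in> slab m0 C R \<and> y \<in> ball x e)"
proof -
  define m where "m = real CARD('m)"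
  have m: "m \<ge> 1" by (simp add: m_def Suc_le_eq)
  define r where "r = min (R / 2) (e / (4 * m))"
  have r: "r > 0" "r \<le> R / 2" "r \<le> e / (4 * m)" using R e m by (auto simp: r_def)
  have em: "0 < e / m" using e m by simp
  have r2: "2 * r < e / m" using r(3) em m by (simp add: field_simps)
  define a where "a = (\<chi> i. if i = m0 then x $ m0 else max r (min (R - r) (x $ i)))"
  have a: "r \<le> a $ i" "a $ i \<le> R - r" "\<bar>a $ i - x $ i\<bar> \<le> r" if "i \<noteq> m0" for i
    using x that r by (auto simp: a_def slab_def max_def min_def abs_le_iff)
  show ?thesis
  proof (intro exI[of _ r] exI[of _ a] conjI allI impI r(1))
    show "a $ m0 = x $ m0" by (simp add: a_def)
    fix y :: "real ^ 'm"
    assume "y $ m0 \<in> C \<and> \<bar>y $ m0 - x $ m0\<bar> < r \<and> (\<forall>i. i \<noteq> m0 \<longrightarrow> \<bar>y $ i - a $ i\<bar> \<le> r)"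
    then have y: "y $ m0 \<in> C" "\<bar>y $ m0 - x $ m0\<bar> < r" "\<And>i. i \<noteq> m0 \<Longrightarrow> \<bar>y $ i - a $ i\<bar> \<le> r"
      by auto
    have "\<bar>(y - x) $ i\<bar> < e / m" for i
    proof (cases "i = m0")
      case True
      then show ?thesis using y(2) r2 r(1) by simp
    next
      case False
      then show ?thesis using y(3)[OF False] a(3)[OF False] r2 by simp
    qed
    then have "norm (y - x) < e" unfolding m_def by (rule norm_vec_less_if_components)
    then have "y \<in> ball x e" by (simp add: dist_norm norm_minus_commute)
    moreover have "0 \<le> y $ i \<and> y $ i \<le> R" if "i \<noteq> m0" for i
      using y(3)[OF that] a[OF that] by (auto simp: abs_le_iff)
    ultimately show "y \<in> slab m0 C R" "y \<in> ball x e" using y(1) by (simp_all add: slab_def)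
  qed
qed

lemma closed_slab:
  assumes "closed C"
  shows "closed (slab m0 C R)"
proof -
  have "slab m0 C R = (\<lambda>x. x $ m0) -` C \<inter> (\<Inter>i\<in>- {m0}. (\<lambda>x. x $ i) -` {0..R})"
    by (auto simp: slab_def)
  then show ?thesis
    using assms by (simp only:) (intro closed_Int closed_INT closed_vimage ballI continuous_intros closed_atLeastAtMost)
qed

text \<open>Otherwise \<open>F\<close> would contain an \<open>n\<close>-cube in the slice through
  \<open>x\<close>. Staying in the slice makes the complement project onto the Cantor factor,
  staying near \<open>x\<close> makes it dense.\<close>

lemma slab_dim_le_complement:
  fixes F :: "(real ^ 'm) set" and m0 :: 'm
  assumes F: "top_of_set F dim_le (int n - 1)" and dim: "CARD('m) = n + 1"
    and x: "x \<in> slab m0 C R" and R: "R > 0" and e: "e > 0"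
  shows "\<exists>y \<in> slab m0 C R \<inter> ball x e. y $ m0 = x $ m0 \<and> y \<notin> F"
proof (rule ccontr)
  assume neg: "\<not> ?thesis"
  obtain a r where a: "r > 0" "a $ m0 = x $ m0"
    "(\<forall>y. y $ m0 \<in> C \<and> \<bar>y $ m0 - x $ m0\<bar> < r \<and> (\<forall>i. i \<noteq> m0 \<longrightarrow> \<bar>y $ i - a $ i\<bar> \<le> r) \<longrightarrow> y \<in> slab m0 C R \<and> y \<in> ball x e)"
    using slab_local_cube[OF x R e] by blast
  have "{y. y $ m0 = a $ m0 \<and> (\<forall>i. \<bar>y $ i - a $ i\<bar> \<le> r)} \<subseteq> F"
  proof
    fix y assume y: "y \<in> {y. y $ m0 = a $ m0 \<and> (\<forall>i. \<bar>y $ i - a $ i\<bar> \<le> r)}"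
    then have "y \<in> slab m0 C R \<and> y \<in> ball x e"
      using a(1,2) x by (intro a(3)[rule_format]) (auto simp: slab_def)
    then show "y \<in> F" using neg y a(2) by auto
  qed
  then have "top_of_set {y. y $ m0 = a $ m0 \<and> (\<forall>i. \<bar>y $ i - a $ i\<bar> \<le> r)} dim_le (int n - 1)"
    by (rule dimension_le_subtopologies[OF F])
  with cube_face_not_dimension_le[OF a(1) dim] show False by blast
qed

text \<open>The closed pieces of \<open>F\<close> have dense complement in the slab. If no
  \<open>X j\<close> were dense in a relatively open part of the slab, Baire's theorem would provide
  a point of the slab in neither \<open>F\<close> nor any \<open>X j\<close>. So some
  \<open>X j\<close> is dense in a small product set, whose box dimension is already
  \<open>n + \<alpha>\<close>.\<close>

lemma packing_dim_slab_ge: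
  fixes K F :: "(real ^ 'm) set" and m0 :: 'm and \<phi> :: "real \<Rightarrow> real"
  assumes c: "c > 0" and \<alpha>: "0 < \<alpha>" "\<alpha> < 1" and dim: "CARD('m) = n + 1" and R: "R > 0"
    and expand: "\<And>s t. \<lbrakk>0 \<le> s; s < 1; 0 \<le> t; t < 1\<rbrakk> \<Longrightarrow> \<bar>s - t\<bar> \<le> c * \<bar>\<phi> s - \<phi> t\<bar> powr \<alpha>"
    and osc: "\<And>k s t. \<lbrakk>0 \<le> s; s < 1; 0 \<le> t; t < 1; \<lfloor>2 ^ k * s\<rfloor> = \<lfloor>2 ^ k * t\<rfloor>\<rbrakk>
        \<Longrightarrow> \<bar>\<phi> s - \<phi> t\<bar> \<le> R * (2 powr (- 1 / \<alpha>)) ^ k"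
    and C: "C = closure (\<phi> ` {0..<1})" and SK: "slab m0 C R \<subseteq> K" and K: "closed K"
    and F: "fsigma_in (top_of_set K) F" "top_of_set F dim_le (int n - 1)"
  shows "ereal (real n + \<alpha>) \<le> packing_dim (K - F)"
proof -
  define S where "S = slab m0 C R"
  have clS: "closed S" by (simp add: S_def C closed_slab)
  have "(\<chi> i. if i = m0 then \<phi> 0 else 0) \<in> S"
    using R closure_subset[of "\<phi> ` {0..<1}"] by (auto simp: S_def slab_def C)
  then obtain x0 where x0: "x0 \<in> S" by blast
  have dense: "\<exists>y\<in>S \<inter> ball x e. y $ m0 = x $ m0 \<and> y \<notin> F" if "x \<in> S" "e > 0" for x e
    using slab_dim_le_complement[OF F(2) dim _ R that(2)] that(1) by (simp add: S_def)
  have ne: "K - F \<noteq> {}" using dense[OF x0, of 1] SK by (auto simp: S_def)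
  have "ereal (real n + \<alpha>) \<le> (SUP j. upper_box_dim (X j))" if X: "K - F = (\<Union>j. X j)" for X :: "nat \<Rightarrow> (real ^ 'm) set"
  proof -
    obtain D :: "nat \<Rightarrow> (real ^ 'm) set" where D: "\<And>k. closedin (top_of_set K) (D k)" "\<Union> (range D) = F"
      using F(1) unfolding fsigma_in_ascending by blast
    have clD: "closed (D k)" for k using D(1) K closedin_closed_trans by blast
    have "\<exists>j. \<exists>x\<in>S. \<exists>e>0. S \<inter> ball x e \<subseteq> closure (X j)"
    proof (rule ccontr)
      assume neg: "\<not> ?thesis"
      define \<G> where "\<G> = range (\<lambda>k. S - D k) \<union> range (\<lambda>j. S - closure (X j))"
      have "S \<subseteq> closure (\<Inter>\<G>)"
      proof (rule Baire[OF clS])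
        show "countable \<G>" by (auto simp: \<G>_def)
        fix T assume "T \<in> \<G>"
        then consider k where "T = S - D k" | j where "T = S - closure (X j)" by (auto simp: \<G>_def)
        then show "openin (top_of_set S) T \<and> S \<subseteq> closure T"
        proof cases
          case 1
          have "openin (top_of_set S) (S \<inter> (- D k))" using clD by (intro openin_open_Int) auto
          moreover have "S \<subseteq> closure T"
          proof
            fix x assume "x \<in> S"
            then show "x \<in> closure T"
              unfolding closure_approachable using dense[of x] D(2) 1
              by (fastforce simp: dist_commute)
          qed
          ultimately show ?thesis by (simp add: 1 Diff_eq)
        next
          case 2
          have "openin (top_of_set S) (S \<inter> (- closure (X j)))" by (intro openin_open_Int) auto
          moreover have "S \<subseteq> closure T"
          proof
            fix x assume x: "x \<in> S"
            show "x \<in> closure T"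
              unfolding closure_approachable
            proof (intro allI impI)
              fix e :: real assume "e > 0"
              then have "\<not> S \<inter> ball x e \<subseteq> closure (X j)" using neg x by blast
              then obtain y where "y \<in> S" "y \<in> ball x e" "y \<notin> closure (X j)" by blast
              then show "\<exists>y\<in>T. dist y x < e" using 2 by (auto simp: dist_commute)
            qed
          qed
          ultimately show ?thesis by (simp add: 2 Diff_eq)
        qed
      qed
      moreover have "\<Inter>\<G> = {}"
      proof -
        have "x \<notin> \<Inter>\<G>" for x
        proof
          assume x: "x \<in> \<Inter>\<G>"
          then have "x \<in> S" "x \<notin> D k" "x \<notin> closure (X k)" for k by (auto simp: \<G>_def)
          then have "x \<in> K - F" using D(2) SK by (auto simp: S_def)
          then show False using X \<open>\<And>k. x \<notin> closure (X k)\<close> closure_subset by blast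
        qed
        then show ?thesis by blast
      qed
      ultimately show False using x0 by simp
    qed
    then obtain j x e where x: "x \<in> S" "e > 0" "S \<inter> ball x e \<subseteq> closure (X j)" by blast
    obtain a r where a: "r > 0" "a $ m0 = x $ m0"
      "(\<forall>y. y $ m0 \<in> C \<and> \<bar>y $ m0 - x $ m0\<bar> < r \<and> (\<forall>i. i \<noteq> m0 \<longrightarrow> \<bar>y $ i - a $ i\<bar> \<le> r) \<longrightarrow> y \<in> slab m0 C R \<and> y \<in> ball x e)"
      using slab_local_cube[OF _ R x(2)] x(1) unfolding S_def by blast
    have "x $ m0 \<in> closure (\<phi> ` {0..<1})" using x(1) by (simp add: S_def slab_def C)
    then obtain z where z: "z \<in> \<phi> ` {0..<1}" "dist (x $ m0) z < r / 2"
      using closure_approachableD[of "x $ m0" "\<phi> ` {0..<1}" "r / 2"] a(1) by auto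
    then obtain t where t: "0 \<le> t" "t < 1" "\<bar>\<phi> t - x $ m0\<bar> < r / 2"
      by (auto simp: dist_real_def abs_minus_commute)
    \<comment> \<open>No continuity of \<open>\<phi>\<close> is available, so closeness of its
      values comes from the oscillation bound on the dyadic interval of a high level
      \<open>k\<close> containing \<open>t\<close>.\<close>
    have "2 powr (- 1 / \<alpha>) < 2 powr 0" using \<alpha> by (intro powr_less_mono) auto
    then have "2 powr (- 1 / \<alpha>) < 1" by (simp only: powr_zero_eq_one) simp
    moreover have "0 < r / (2 * R)" using a(1) R by simp
    ultimately obtain k where k: "(2 powr (- 1 / \<alpha>)) ^ k < r / (2 * R)"
      using real_arch_pow_inv by blast
    \<comment> \<open>Half the distance from \<open>t\<close> to the right end of its dyadic
      interval, so that \<open>{t..t + w}\<close> stays in that interval and below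
      \<open>1\<close>.\<close>
    define w where "w = (real_of_int (\<lfloor>2 ^ k * t\<rfloor> + 1) / 2 ^ k - t) / 2"
    have fl: "real_of_int \<lfloor>2 ^ k * t\<rfloor> \<le> 2 ^ k * t" "2 ^ k * t < real_of_int \<lfloor>2 ^ k * t\<rfloor> + 1" by linarith+
    have w: "w > 0" using fl by (simp add: w_def field_simps)
    have "2 ^ k * t < 2 ^ k * 1" using t by (intro mult_strict_left_mono) auto
    then have "\<lfloor>2 ^ k * t\<rfloor> < 2 ^ k" by (simp add: floor_less_iff)
    then have "\<lfloor>2 ^ k * t\<rfloor> + 1 \<le> 2 ^ k" by linarith
    then have "real_of_int (\<lfloor>2 ^ k * t\<rfloor> + 1) \<le> real_of_int (2 ^ k)" by (rule of_int_le_iff[THEN iffD2])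
    then have "real_of_int (\<lfloor>2 ^ k * t\<rfloor> + 1) / 2 ^ k \<le> 1" by simp
    moreover have "t + (E - t) / 2 < 1" if "E \<le> 1" for E :: real using t that by (simp add: field_simps)
    ultimately have tw: "t + w < 1" unfolding w_def by blast
    have tw2: "2 ^ k * (t + w) < real_of_int \<lfloor>2 ^ k * t\<rfloor> + 1"
    proof -
      have "P * (t + (Y - t) / 2) = (P * t + P * Y) / 2" for P Y :: real by (simp add: field_simps)
      then have eq: "2 ^ k * (t + w) = (2 ^ k * t + (real_of_int \<lfloor>2 ^ k * t\<rfloor> + 1)) / 2"
        by (simp add: w_def)
      have "(P + (Y + 1)) / 2 < Y + 1" if "P < Y + 1" for P Y :: real using that by simp
      from this[OF fl(2)] show ?thesis unfolding eq .
    qed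
    have near: "\<bar>\<phi> t' - x $ m0\<bar> < r" if "t' \<in> {t..t + w}" for t'
    proof -
      have "2 ^ k * t \<le> 2 ^ k * t'" "2 ^ k * t' \<le> 2 ^ k * (t + w)" using that by auto
      then have "\<lfloor>2 ^ k * t'\<rfloor> = \<lfloor>2 ^ k * t\<rfloor>" using fl tw2 by linarith
      then have "\<bar>\<phi> t' - \<phi> t\<bar> \<le> R * (2 powr (- 1 / \<alpha>)) ^ k" using that t tw by (intro osc) auto
      also have "\<dots> \<le> R * (r / (2 * R))" using k R by (intro mult_left_mono) auto
      also have "\<dots> = r / 2" using R by simp
      finally show ?thesis using t(3) by linarith
    qed
    have box: "{x. x $ m0 \<in> \<phi> ` {t..t + w} \<and> (\<forall>i. i \<noteq> m0 \<longrightarrow> \<bar>x $ i - a $ i\<bar> \<le> r)} \<subseteq> closure (X j)"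
    proof
      fix y assume y: "y \<in> {x. x $ m0 \<in> \<phi> ` {t..t + w} \<and> (\<forall>i. i \<noteq> m0 \<longrightarrow> \<bar>x $ i - a $ i\<bar> \<le> r)}"
      then obtain t' where t': "t' \<in> {t..t + w}" "y $ m0 = \<phi> t'" by blast
      have "y $ m0 \<in> C" unfolding C t'(2) using t' t tw by (intro subsetD[OF closure_subset]) auto
      then have "y \<in> slab m0 C R \<and> y \<in> ball x e" using near[OF t'(1)] y t'(2) by (intro a(3)[rule_format]) auto
      then show "y \<in> closure (X j)" using x(3) by (auto simp: S_def)
    qed
    have "ereal (real n + \<alpha>) \<le> upper_box_dim (X j)"
      by (rule upper_box_dim_ge_expanding[OF c \<alpha>(1) dim _ t(1) tw w a(1) box]) (rule expand)
    then show ?thesis by (rule SUP_upper2[OF UNIV_I])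
  qed
  then have "ereal (real n + \<alpha>) \<le> (INF X \<in> {X :: nat \<Rightarrow> (real ^ 'm) set. K - F = (\<Union>i. X i)}. SUP i. upper_box_dim (X i))"
    by (intro INF_greatest) auto
  then show ?thesis unfolding packing_dim_def if_not_P[OF ne] .
qed

section \<open>Thin tubes around rational points\<close>

text \<open>About \<open>1 / r\<close> pieces of size of order \<open>r\<close> cover a tube of
  length \<open>1\<close>. Their cost \<open>r powr (s - 1)\<close> becomes small with
  \<open>r\<close> exactly when \<open>s > 1\<close>.\<close>

lemma hausdorff_premeasure_tube:
  fixes q :: "real ^ 'm" and m0 :: 'm
  assumes r: "0 < r" "r \<le> 1" and \<delta>: "2 * real CARD('m) * r \<le> \<delta>" and s: "s > 0"
  shows "hausdorff_premeasure s \<delta> {x. 0 \<le> x $ m0 \<and> x $ m0 \<le> 1 \<and> (\<forall>i. i \<noteq> m0 \<longrightarrow> \<bar>x $ i - q $ i\<bar> < r)}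
    \<le> ennreal (2 * (2 * real CARD('m)) powr s * r powr (s - 1))" (is "hausdorff_premeasure s \<delta> ?A \<le> _")
proof -
  define m where "m = real CARD('m)"
  have m: "m \<ge> 1" by (simp add: m_def Suc_le_eq)
  define cell where "cell j = {x \<in> ?A. \<lfloor>x $ m0 / r\<rfloor> = j}" for j :: int
  define J where "J = {0..\<lfloor>1 / r\<rfloor>}"
  have small: "dist x y \<le> 2 * m * r" if "x \<in> cell j" "y \<in> cell j" for x y j
  proof -
    have "\<bar>x $ i - y $ i\<bar> \<le> 2 * r" for i
    proof (cases "i = m0")
      case True
      then show ?thesis using floor_cell_dist[of r "x $ m0" "y $ m0"] that r by (auto simp: cell_def)
    next
      case False
      then have "\<bar>x $ i - q $ i\<bar> < r" "\<bar>y $ i - q $ i\<bar> < r" using that by (auto simp: cell_def)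
      then show ?thesis by linarith
    qed
    then have "(\<Sum>i\<in>UNIV. \<bar>x $ i - y $ i\<bar>) \<le> (\<Sum>i\<in>(UNIV :: 'm set). 2 * r)" by (intro sum_mono)
    also have "\<dots> = 2 * m * r" by (simp add: m_def)
    finally show ?thesis using dist_vec_le_sum[of x y] by linarith
  qed
  have "hausdorff_premeasure s \<delta> ?A \<le> ennreal (real (card (cell ` J)) * (2 * m * r) powr s)"
  proof (rule hausdorff_premeasure_finite_cover)
    show "finite (cell ` J)" by (simp add: J_def)
    show "?A \<subseteq> \<Union> (cell ` J)"
    proof
      fix x assume x: "x \<in> ?A"
      then have "\<lfloor>x $ m0 / r\<rfloor> \<in> J" using r by (auto simp: J_def intro!: floor_mono divide_right_mono)
      moreover have "x \<in> cell \<lfloor>x $ m0 / r\<rfloor>" using x by (simp add: cell_def)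
      ultimately show "x \<in> \<Union> (cell ` J)" by blast
    qed
    fix W assume "W \<in> cell ` J"
    then obtain j where "W = cell j" by blast
    then show "bounded W" "diameter W \<le> 2 * m * r"
      using small[of _ j] r m by (auto intro!: small_setI)
  qed (use r m s \<delta> in \<open>auto simp: m_def\<close>)
  also have "\<dots> \<le> ennreal (2 * (2 * m) powr s * r powr (s - 1))"
  proof (rule ennreal_leI)
    have "card (cell ` J) \<le> card J" by (rule card_image_le) (simp add: J_def)
    then have "real (card (cell ` J)) \<le> real (card J)" by simp
    also have "\<dots> = real_of_int \<lfloor>1 / r\<rfloor> + 1" using r by (simp add: J_def)
    also have "\<dots> \<le> 1 / r + 1 / r" using r by (intro add_mono) auto
    finally have "real (card (cell ` J)) * (2 * m * r) powr s \<le> 2 / r * (2 * m * r) powr s"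
      by (intro mult_right_mono) auto
    also have "\<dots> = 2 * (2 * m) powr s * (r powr s / r)"
      using r m by (simp add: powr_mult)
    also have "r powr s / r = r powr (s - 1)" using r by (simp add: powr_diff)
    finally show "real (card (cell ` J)) * (2 * m * r) powr s \<le> 2 * (2 * m) powr s * r powr (s - 1)" .
  qed
  finally show ?thesis by (simp add: m_def)
qed

lemma countable_rational_vectors: "countable {q :: real ^ 'm. \<forall>i. q $ i \<in> \<rat>}"
proof (rule countable_subset)
  show "{q :: real ^ 'm. \<forall>i. q $ i \<in> \<rat>} \<subseteq> vec_lambda ` PiE UNIV (\<lambda>_. \<rat>)"
  proof
    fix q :: "real ^ 'm" assume "q \<in> {q. \<forall>i. q $ i \<in> \<rat>}"
    then show "q \<in> vec_lambda ` PiE UNIV (\<lambda>_. \<rat>)"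
      by (intro image_eqI[of _ _ "vec_nth q"]) auto
  qed
  show "countable (vec_lambda ` PiE (UNIV :: 'm set) (\<lambda>_. \<rat> :: real set))"
    by (intro countable_image countable_PiE) (auto simp: countable_rat)
qed

lemma rational_tubes:
  fixes m0 :: "'m::finite"
  obtains G :: "nat \<Rightarrow> (real ^ 'm) set" where "\<And>k. open (G k)"
    "\<And>k x. (\<And>i. i \<noteq> m0 \<Longrightarrow> x $ i \<in> \<rat>) \<Longrightarrow> x \<in> G k"
    "\<And>A. \<lbrakk>\<And>x. x \<in> A \<Longrightarrow> 0 \<le> x $ m0 \<and> x $ m0 \<le> 1; A \<subseteq> (\<Inter>k. G k)\<rbrakk> \<Longrightarrow> hausdorff_dim A \<le> 1"
proof -
  define Dq where "Dq = {q :: real ^ 'm. \<forall>i. q $ i \<in> \<rat>}"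
  have "0 \<in> Dq" by (simp add: Dq_def)
  then have ne: "Dq \<noteq> {}" by blast
  define q where "q = from_nat_into Dq"
  have rq: "range q = Dq"
    unfolding q_def using ne countable_rational_vectors by (intro range_from_nat_into) (auto simp: Dq_def)
  \<comment> \<open>The factor \<open>k + j\<close> makes the costs summable over \<open>j\<close>
    with a total that tends to \<open>0\<close> in \<open>k\<close>. The factor \<open>k + 1\<close>
    outweighs the power \<open>s - 1\<close> once \<open>k\<close> is large, so one choice of radii
    serves every \<open>s > 1\<close>.\<close>
  define \<rho> where "\<rho> k j = (1/2 :: real) ^ ((k + j) * (k + 1))" for k j :: nat
  define tube where "tube k j = {x :: real ^ 'm. \<forall>i. i \<noteq> m0 \<longrightarrow> \<bar>x $ i - q j $ i\<bar> < \<rho> k j}" for k j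
  define G where "G k = (\<Union>j. tube k j)" for k
  have \<rho>: "0 < \<rho> k j" "\<rho> k j \<le> 1" for k j by (auto simp: \<rho>_def power_le_one)
  have \<rho>k: "\<rho> k j \<le> (1/2) ^ k" for k j
    unfolding \<rho>_def by (rule power_decreasing) auto
  define m where "m = real CARD('m)"
  have m: "m \<ge> 1" by (simp add: m_def Suc_le_eq)
  show ?thesis
  proof (rule that[of G])
    fix k
    have "tube k j = (\<Inter>i\<in>- {m0}. (\<lambda>x. \<bar>x $ i - q j $ i\<bar>) -` {..<\<rho> k j})" for j
      by (auto simp: tube_def)
    then have "open (tube k j)" for j
      by (simp only:) (intro open_INT finite ballI open_vimage continuous_intros open_lessThan)
    then show "open (G k)" by (auto simp: G_def)
  next
    fix k and x :: "real ^ 'm" assume x: "\<And>i. i \<noteq> m0 \<Longrightarrow> x $ i \<in> \<rat>"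
    have "(\<chi> i. if i = m0 then 0 else x $ i) \<in> Dq" using x by (simp add: Dq_def)
    then obtain j where j: "q j = (\<chi> i. if i = m0 then 0 else x $ i)" using rq by (metis imageE)
    have "x \<in> tube k j" using \<rho> by (simp add: tube_def j)
    then show "x \<in> G k" by (auto simp: G_def)
  next
    fix A assume A: "\<And>x. x \<in> A \<Longrightarrow> 0 \<le> x $ m0 \<and> x $ m0 \<le> 1" "A \<subseteq> (\<Inter>k. G k)"
    have dim: "hausdorff_dim A \<le> ereal s" if s: "s > 1" for s
    proof (rule hausdorff_dim_le)
      show "hausdorff_measure s A = 0"
      proof (rule hausdorff_measure_eq_0I)
        fix \<delta> \<eta> :: real assume \<delta>: "\<delta> > 0" "\<eta> > 0"
        define Q where "Q = 2 * (2 * m) powr s"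
        have Q: "Q > 0" using m by (simp add: Q_def)
        define z where "z = min (\<delta> / (2 * m)) (\<eta> / (2 * Q))"
        have z: "z > 0" using \<delta> m Q by (simp add: z_def)
        obtain k1 where k1: "(1/2) ^ k1 < z" using real_arch_pow_inv[OF z, of "1/2"] by auto
        obtain k2 :: nat where k2: "1 / (s - 1) \<le> real k2" using real_arch_simple by blast
        \<comment> \<open>\<open>k1\<close> settles the scale \<open>\<delta>\<close> and the total
          cost \<open>\<eta>\<close>, \<open>k2\<close> the exponent \<open>s - 1\<close>.\<close>
        define k where "k = max k1 k2"
        have "(1/2 :: real) ^ k \<le> (1/2) ^ k1" by (rule power_decreasing) (auto simp: k_def)
        then have kz: "(1/2) ^ k \<le> z" using k1 by linarith
        have kd: "(1/2) ^ k * (2 * m) \<le> \<delta>" and k\<eta>: "(1/2) ^ k * (2 * Q) \<le> \<eta>"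
          using kz m Q by (auto simp: z_def field_simps)
        have "1 / (s - 1) \<le> real k" using k2 by (simp add: k_def)
        then have ks: "1 \<le> real (k + 1) * (s - 1)" using s by (simp add: field_simps)
        have \<rho>s: "\<rho> k j powr (s - 1) \<le> (1/2) ^ k * (1/2) ^ j" for j
        proof -
          have "\<rho> k j powr (s - 1) = ((1/2) ^ (k + j)) powr (real (k + 1) * (s - 1))"
          proof -
            have "\<rho> k j = ((1/2) ^ (k + j)) powr real (k + 1)"
              by (simp only: \<rho>_def power_mult powr_realpow zero_less_power half_gt_zero zero_less_one)
            then show ?thesis by (simp only: powr_powr)
          qed
          also have "\<dots> \<le> ((1/2) ^ (k + j)) powr 1"
            using ks by (intro powr_mono') (auto simp: power_le_one)
          also have "\<dots> = (1/2) ^ k * (1/2) ^ j" by (simp add: power_add)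
          finally show ?thesis .
        qed
        define B where "B j = {x :: real ^ 'm. 0 \<le> x $ m0 \<and> x $ m0 \<le> 1 \<and> (\<forall>i. i \<noteq> m0 \<longrightarrow> \<bar>x $ i - q j $ i\<bar> < \<rho> k j)}" for j
        have Bj: "hausdorff_premeasure s \<delta> (B j) \<le> ennreal (Q * ((1/2) ^ k * (1/2) ^ j))" for j
        proof -
          have "2 * m * \<rho> k j \<le> 2 * m * (1/2) ^ k" using \<rho>k m by (intro mult_left_mono) auto
          also have "\<dots> \<le> \<delta>" using kd by (simp only: mult.commute)
          finally have "hausdorff_premeasure s \<delta> (B j) \<le> ennreal (Q * \<rho> k j powr (s - 1))"
            unfolding B_def Q_def m_def using \<rho> s by (intro hausdorff_premeasure_tube) auto
          also have "\<dots> \<le> ennreal (Q * ((1/2) ^ k * (1/2) ^ j))"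
            using \<rho>s Q by (intro ennreal_leI mult_left_mono) auto
          finally show ?thesis .
        qed
        have "A \<subseteq> (\<Union>j. B j)"
        proof
          fix x assume x: "x \<in> A"
          then have "x \<in> G k" using A(2) by blast
          then obtain j where "x \<in> tube k j" by (auto simp: G_def)
          then have "x \<in> B j" using A(1)[OF x] by (simp add: B_def tube_def)
          then show "x \<in> (\<Union>j. B j)" by blast
        qed
        then have "hausdorff_premeasure s \<delta> A \<le> hausdorff_premeasure s \<delta> (\<Union>j. B j)"
          by (rule hausdorff_premeasure_mono)
        also have "\<dots> \<le> (\<Sum>j. hausdorff_premeasure s \<delta> (B j))" by (rule hausdorff_premeasure_UN)
        also have "\<dots> \<le> (\<Sum>j. ennreal (Q * ((1/2) ^ k * (1/2) ^ j)))" by (intro suminf_le Bj) auto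
        also have "\<dots> = ennreal (Q * (1/2) ^ k * 2)"
        proof (rule suminf_ennreal_eq)
          show "(\<lambda>j. Q * ((1/2) ^ k * (1/2) ^ j)) sums (Q * (1/2) ^ k * 2)"
            using sums_mult[OF geometric_sums[of "1/2 :: real"], of "Q * (1/2) ^ k"] by (simp add: mult.assoc)
        qed (use Q in simp)
        also have "\<dots> \<le> ennreal \<eta>" using k\<eta> by (intro ennreal_leI) (simp only: mult_ac)
        finally show "hausdorff_premeasure s \<delta> A \<le> ennreal \<eta>" .
      qed
    qed (use s in simp)
    show "hausdorff_dim A \<le> 1"
    proof (rule ereal_le_epsilon2)
      fix e :: real assume "e > 0"
      then show "hausdorff_dim A \<le> 1 + ereal e" using dim[of "1 + e"] by (simp add: one_ereal_def)
    qed
  qed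
qed

section \<open>Construction of the compact set\<close>

lemma packing_dim_le:
  fixes X :: "nat \<Rightarrow> 'a::metric_space set"
  assumes "A = (\<Union>i. X i)" "\<And>i. upper_box_dim (X i) \<le> ereal s" "0 \<le> s"
  shows "packing_dim A \<le> ereal s"
proof (cases "A = {}")
  case True
  then show ?thesis using assms(3) by (simp add: packing_dim_def one_ereal_def)
next
  case False
  have "(INF X \<in> {X :: nat \<Rightarrow> 'a set. A = (\<Union>i. X i)}. SUP i. upper_box_dim (X i)) \<le> (SUP i. upper_box_dim (X i))"
    by (rule INF_lower) (use assms in simp)
  also have "\<dots> \<le> ereal s" by (rule SUP_least) (use assms in simp)
  finally show ?thesis using False by (simp add: packing_dim_def)
qed

lemma nowhere_dense_in_subset:
  "\<lbrakk>nowhere_dense_in X T; S \<subseteq> T\<rbrakk> \<Longrightarrow> nowhere_dense_in X S"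
  using interior_of_mono[OF closure_of_mono[of S T X], of X] by (auto simp: nowhere_dense_in_def)

text \<open>\<open>meager_in\<close> asks for an exact union, so the given sets are cut down to the
  complement of \<open>S\<close>.\<close>

lemma comeager_inI:
  assumes "S \<subseteq> topspace X" "countable \<N>" "\<And>N. N \<in> \<N> \<Longrightarrow> nowhere_dense_in X N"
    and "topspace X - S \<subseteq> \<Union>\<N>"
  shows "comeager_in X S"
  unfolding comeager_in_def meager_in_def
proof (intro conjI exI[of _ "(\<lambda>N. N \<inter> (topspace X - S)) ` \<N>"] ballI)
  show "topspace X - S = \<Union> ((\<lambda>N. N \<inter> (topspace X - S)) ` \<N>)" using assms(4) by blast
  fix N assume "N \<in> (\<lambda>N. N \<inter> (topspace X - S)) ` \<N>"
  then show "nowhere_dense_in X N" using assms(3) nowhere_dense_in_subset by (metis (no_types, lifting) imageE inf_le1)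
qed (use assms in auto)

text \<open>Passes to the supremum of the exponents of the construction, with \<open>a = 0\<close>
  for the Hausdorff and \<open>a = n\<close> for the packing bound.\<close>

lemma ereal_le_of_harmonic_approx:
  fixes d :: ereal
  assumes "\<And>i. ereal (a + (1 - 1 / (real i + 2))) \<le> d"
  shows "ereal (a + 1) \<le> d"
proof (rule ereal_le_epsilon2)
  fix e :: real assume e: "e > 0"
  obtain i :: nat where i: "1 / e \<le> real i" using real_arch_simple by blast
  have "1 / (real i + 2) \<le> e" using i e by (simp add: field_simps)
  then have "ereal (a + 1) \<le> ereal (a + (1 - 1 / (real i + 2))) + ereal e" by simp
  also have "\<dots> \<le> d + ereal e" by (intro add_right_mono assms)
  finally show "ereal (a + 1) \<le> d + ereal e" .
qed

theorem theorem7p6: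
  assumes dim: "CARD('m::finite) = CARD('n::finite) + 1"
  shows "\<exists>(K :: (real ^ 'm) set) (yf :: (real ^ 'm \<Rightarrow> real ^ 'n) \<Rightarrow> real ^ 'n).
           compact K \<and>
           d_hausdorff CARD('n) K = 1 \<and>
           d_packing CARD('n) K = ereal (real (CARD('n) + 1)) \<and>
           for_generic_C K (\<lambda>f. \<forall>y. y \<noteq> yf f \<longrightarrow> hausdorff_dim (fiber K f y) < 1) \<and>
           (\<forall>f \<in> mspace (C_metric K). \<forall>y. y \<noteq> yf f \<longrightarrow>
              packing_dim (fiber K f y) < ereal (real (CARD('n) + 1)))"
proof -

  \<comment> \<open>Parameters, Cantor factors and the compact set\<close>
  define n where "n = CARD('n)"
  have dim_n: "CARD('m) = n + 1" using dim by (simp add: n_def)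
  \<comment> \<open>Any index may carry the Cantor factor; \<open>undefined\<close> merely picks
    one.\<close>
  define m0 :: 'm where "m0 = undefined"
  \<comment> \<open>The offset \<open>2\<close> gives \<open>\<alpha> 0 = 1/2\<close>, so every
    exponent is positive.\<close>
  define \<alpha> where "\<alpha> i = 1 - 1 / (real i + 2)" for i :: nat
  define R where "R i = (1/2 :: real) ^ i" for i :: nat
  have \<alpha>: "0 < \<alpha> i" "\<alpha> i < 1" for i by (auto simp: \<alpha>_def)
  have \<alpha>_mono: "\<alpha> i \<le> \<alpha> j" if "i \<le> j" for i j using that by (simp add: \<alpha>_def frac_le)
  have R: "R i > 0" "R i \<le> 1" for i by (auto simp: R_def power_le_one)
  have "\<exists>\<phi> c. cantor_like (\<alpha> i) (R i) \<phi> c" for i by (rule cantor_like_exists[OF \<alpha> R(1)])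
  then obtain \<phi> c where \<phi>c: "\<And>i. cantor_like (\<alpha> i) (R i) (\<phi> i) (c i)" by metis
  have c: "c i > 0" and \<phi>R: "\<lbrakk>0 \<le> t; t < 1\<rbrakk> \<Longrightarrow> \<phi> i t \<in> {0..R i}"
    and expand: "\<lbrakk>0 \<le> s; s < 1; 0 \<le> t; t < 1\<rbrakk> \<Longrightarrow> \<bar>s - t\<bar> \<le> c i * \<bar>\<phi> i s - \<phi> i t\<bar> powr \<alpha> i"
    and osc: "\<lbrakk>0 \<le> s; s < 1; 0 \<le> t; t < 1; \<lfloor>2 ^ k * s\<rfloor> = \<lfloor>2 ^ k * t\<rfloor>\<rbrakk>
        \<Longrightarrow> \<bar>\<phi> i s - \<phi> i t\<bar> \<le> R i * (2 powr (- 1 / \<alpha> i)) ^ k" for i k s t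
    using \<phi>c[of i, unfolded cantor_like_def] by blast+
  define C where "C i = closure (\<phi> i ` {0..<1})" for i
  have CR: "C i \<subseteq> {0..R i}" for i
    unfolding C_def by (rule closure_minimal) (use \<phi>R in auto)
  have \<phi>C: "\<phi> i t \<in> C i" if "0 \<le> t" "t < 1" for i t
    unfolding C_def by (rule subsetD[OF closure_subset]) (use that in auto)
  have bbC: "box_bounded (\<alpha> i) (C i)" for i
    unfolding C_def by (rule box_bounded_closure_dyadic[OF \<alpha>(1) R(1)[of i]]) (rule osc)
  define S where "S i = slab m0 (C i) (R i)" for i
  have bbS: "box_bounded (real n + \<alpha> i) (S i)" for i
    unfolding S_def by (rule box_bounded_slab[OF bbC R(2) dim_n])
  have clS: "closed (S i)" for i unfolding S_def by (rule closed_slab) (simp add: C_def)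
  have normS: "norm x \<le> real CARD('m) * R i" if "x \<in> S i" for x i
  proof -
    have "\<bar>x $ j\<bar> \<le> R i" for j
      using that CR[of i] by (cases "j = m0") (auto simp: S_def slab_def)
    then have "(\<Sum>j\<in>UNIV. \<bar>x $ j\<bar>) \<le> (\<Sum>j\<in>(UNIV :: 'm set). R i)" by (intro sum_mono)
    then show ?thesis using norm_le_l1_cart[of x] by simp
  qed
  define K where "K = insert 0 (\<Union>i. S i)"
  have SK: "S i \<subseteq> K" for i by (auto simp: K_def)
  \<comment> \<open>This one fact yields both the closedness of \<open>K\<close> and the covers of
    fibres by finitely many pieces.\<close>
  have near0: "\<exists>N. K \<subseteq> (\<Union>i<N. S i) \<union> cball 0 d" if d: "d > 0" for d
  proof -
    obtain N where N: "(1/2 :: real) ^ N < d / real CARD('m)"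
      using real_arch_pow_inv[of "d / real CARD('m)" "1/2"] d by auto
    have "x \<in> cball 0 d" if "x \<in> S i" "N \<le> i" for x i
    proof -
      have "R i \<le> (1/2) ^ N" unfolding R_def by (rule power_decreasing) (use that in auto)
      then have "R i \<le> d / real CARD('m)" using N by linarith
      then have "real CARD('m) * R i \<le> d" by (simp add: field_simps)
      then show ?thesis using normS[OF that(1)] by simp
    qed
    then have "S i \<subseteq> (\<Union>i<N. S i) \<union> cball 0 d" for i by (cases "i < N") auto
    then have "K \<subseteq> (\<Union>i<N. S i) \<union> cball 0 d" unfolding K_def using d by auto
    then show ?thesis by blast
  qed
  have clK: "closed K"
  proof -
    have "x \<in> K" if x: "x \<in> closure K" for x
    proof (rule ccontr)
      assume xK: "x \<notin> K"
      then have x0: "norm x / 2 > 0" by (auto simp: K_def)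
      then obtain N where "K \<subseteq> (\<Union>i<N. S i) \<union> cball 0 (norm x / 2)" using near0 by blast
      moreover have "closed ((\<Union>i<N. S i) \<union> cball 0 (norm x / 2))"
        using clS by (intro closed_Un closed_UN) auto
      ultimately have "x \<in> (\<Union>i<N. S i) \<union> cball 0 (norm x / 2)"
        using x closure_minimal by blast
      then show False using xK x0 by (auto simp: K_def)
    qed
    then show ?thesis by (metis closure_subset closure_closed closed_closure subsetI subset_antisym)
  qed
  have "K \<subseteq> cball 0 (real CARD('m))"
  proof
    fix x assume "x \<in> K"
    then consider "x = 0" | i where "x \<in> S i" by (auto simp: K_def)
    then show "x \<in> cball 0 (real CARD('m))"
    proof cases
      case 2
      have "real CARD('m) * R i \<le> real CARD('m) * 1" by (rule mult_left_mono) (use R in auto)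
      from order_trans[OF normS[OF 2] this] show ?thesis by simp
    qed simp
  qed
  then have compK: "compact K"
    using clK bounded_cball bounded_subset by (auto simp: compact_eq_bounded_closed)
  have K0: "0 \<in> K" by (simp add: K_def)
  have Km0: "0 \<le> x $ m0 \<and> x $ m0 \<le> 1" if "x \<in> K" for x
  proof -
    from that consider "x = 0" | i where "x \<in> S i" by (auto simp: K_def)
    then show ?thesis
    proof cases
      case 2
      then have "x $ m0 \<in> C i" by (simp add: S_def slab_def)
      then have "x $ m0 \<in> {0..R i}" using CR[of i] by blast
      then show ?thesis using R(2)[of i] by auto
    qed simp
  qed

  \<comment> \<open>The Hausdorff quantity of the compact set\<close>
  have start: "(\<chi> j. if j = m0 then \<phi> i t else 0) \<in> S i" if "0 \<le> t" "t < 1" for i t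
    using \<phi>C[OF that] R(1)[of i] by (auto simp: S_def slab_def)
  have dH_lower: "1 \<le> d_hausdorff n K"
    unfolding d_dim_def
  proof (rule INF_greatest)
    fix F assume "F \<in> {F. F \<subseteq> K \<and> fsigma_in (top_of_set K) F \<and> top_of_set F dim_le (int n - 1)}"
    then have F: "top_of_set F dim_le (int n - 1)" by simp
    have "ereal (\<alpha> i) \<le> hausdorff_dim (K - F)" for i
    proof (rule hausdorff_dim_ge_expanding[OF c[of i] \<alpha>(1)[of i], of "\<phi> i" _ m0])
      fix t :: real assume t: "0 \<le> t" "t < 1"
      obtain y where "y \<in> S i" "y $ m0 = \<phi> i t" "y \<notin> F"
        using slab_dim_le_complement[OF F dim_n start[OF t, unfolded S_def] R(1) zero_less_one, folded S_def] by auto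
      then show "\<exists>x\<in>K - F. x $ m0 = \<phi> i t" using SK by blast
    qed (rule expand)
    then have "ereal (0 + (1 - 1 / (real i + 2))) \<le> hausdorff_dim (K - F)" for i by (simp add: \<alpha>_def)
    then have "ereal (0 + 1) \<le> hausdorff_dim (K - F)" by (rule ereal_le_of_harmonic_approx)
    then show "1 \<le> hausdorff_dim (K - F)" by (simp add: one_ereal_def)
  qed
  have dH_upper: "d_hausdorff n K \<le> 1"
  proof -
    obtain G :: "nat \<Rightarrow> (real ^ 'm) set" where G: "\<And>k. open (G k)"
      "\<And>k x. (\<And>i. i \<noteq> m0 \<Longrightarrow> x $ i \<in> \<rat>) \<Longrightarrow> x \<in> G k"
      "\<And>A. \<lbrakk>\<And>x. x \<in> A \<Longrightarrow> 0 \<le> x $ m0 \<and> x $ m0 \<le> 1; A \<subseteq> (\<Inter>k. G k)\<rbrakk> \<Longrightarrow> hausdorff_dim A \<le> 1"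
      using rational_tubes[of m0] by metis
    \<comment> \<open>What remains, \<open>K - F\<close>, is the part of \<open>K\<close> inside all
      \<open>G k\<close> and so has small Hausdorff dimension. A point of \<open>F\<close> misses
      some \<open>G k\<close> and therefore has an irrational coordinate besides the one at
      \<open>m0\<close>.\<close>
    define F where "F = (\<Union>k. K - G k)"
    define A where "A = insert 0 (\<Union>i. C i)"
    have "negligible A"
      unfolding A_def negligible_insert
      by (rule negligible_countable_Union[of "range C", simplified])
        (use negligible_box_bounded[OF bbC \<alpha>(2)] in auto)
    then have gap: "\<exists>u. a < u \<and> u < b \<and> u \<notin> A" if "a < b" for a b
      using that open_not_negligible[of "{a<..<b}"] negligible_subset[of A "{a<..<b}"] by fastforce
    \<comment> \<open>The instance \<open>d = n\<close>, \<open>D = {}\<close> of the dimension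
      bound: as \<open>n - n = 0\<close>, the counting condition is void.\<close>
    have FA: "F \<subseteq> {x. x $ m0 \<in> A \<and> (\<exists>i. i \<noteq> m0 \<and> x $ i \<notin> \<rat>) \<and> n - n \<le> card {i. i \<noteq> m0 \<and> x $ i \<in> {}}}"
    proof
      fix x assume "x \<in> F"
      then obtain k where "x \<in> K" "x \<notin> G k" by (auto simp: F_def)
      moreover have "x $ m0 \<in> A" using \<open>x \<in> K\<close> by (auto simp: K_def A_def S_def slab_def)
      ultimately show "x \<in> {x. x $ m0 \<in> A \<and> (\<exists>i. i \<noteq> m0 \<and> x $ i \<notin> \<rat>) \<and> n - n \<le> card {i. i \<noteq> m0 \<and> x $ i \<in> {}}}"
        using G(2)[of x k] by auto
    qed
    have "top_of_set F dim_le (int n - 1)"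
      by (rule dimension_le_subtopologies[OF dimension_le_irrational_flats[OF gap dim_n] FA]) auto
    moreover have "fsigma_in (top_of_set K) F"
      unfolding F_def
    proof (rule fsigma_in_Union)
      fix T assume "T \<in> range (\<lambda>k. K - G k)"
      then obtain k where "T = K - G k" by blast
      moreover have "closedin (top_of_set K) (K \<inter> (- G k))" using G(1) by (intro closedin_closed_Int) auto
      ultimately show "fsigma_in (top_of_set K) T" by (simp add: closed_imp_fsigma_in Diff_eq)
    qed simp
    moreover have "F \<subseteq> K" by (auto simp: F_def)
    ultimately have "d_hausdorff n K \<le> hausdorff_dim (K - F)"
      unfolding d_dim_def by (intro INF_lower) auto
    also have "\<dots> \<le> 1" by (rule G(3)) (use Km0 in \<open>auto simp: F_def\<close>)
    finally show ?thesis .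
  qed

  \<comment> \<open>The packing quantity of the compact set\<close>
  have packing_SK: "upper_box_dim (X :: (real ^ 'm) set) \<le> ereal (real n + \<alpha> N)" if "X \<subseteq> S i" "i \<le> N" for X i N
    by (rule upper_box_dim_le[OF box_bounded_mono[OF box_bounded_subset[OF bbS that(1)]]])
      (use \<alpha>_mono[OF that(2)] \<alpha>(1)[of N] in auto)
  have dP_upper: "d_packing n K \<le> ereal (real n + 1)"
  proof -
    have "packing_dim K \<le> ereal (real n + 1)"
    proof (rule packing_dim_le[of K "\<lambda>i. case i of 0 \<Rightarrow> {0} | Suc j \<Rightarrow> S j"])
      show "K = (\<Union>i. case i of 0 \<Rightarrow> {0} | Suc j \<Rightarrow> S j)"
        by (auto simp: K_def split: nat.splits)
      fix i :: nat
      show "upper_box_dim (case i of 0 \<Rightarrow> {0} | Suc j \<Rightarrow> S j) \<le> ereal (real n + 1)"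
      proof (cases i)
        case 0
        then show ?thesis by (simp add: upper_box_dim_le box_bounded_singleton)
      next
        case (Suc j)
        have "upper_box_dim (S j) \<le> ereal (real n + \<alpha> j)" by (rule packing_SK[of _ j]) auto
        also have "\<dots> \<le> ereal (real n + 1)" using \<alpha>(2)[of j] by simp
        finally show ?thesis using Suc by simp
      qed
    qed simp
    \<comment> \<open>The empty set, of dimension \<open>-1\<close>, is an admissible choice of
      \<open>F\<close>.\<close>
    moreover have "d_packing n K \<le> packing_dim (K - {})"
      unfolding d_dim_def by (rule INF_lower) (auto intro: dimension_le_mono[of _ "- 1"])
    ultimately show ?thesis by simp
  qed
  have dP_lower: "ereal (real n + 1) \<le> d_packing n K"
    unfolding d_dim_def
  proof (rule INF_greatest)
    fix F assume "F \<in> {F. F \<subseteq> K \<and> fsigma_in (top_of_set K) F \<and> top_of_set F dim_le (int n - 1)}"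
    then have F: "fsigma_in (top_of_set K) F" "top_of_set F dim_le (int n - 1)" by auto
    have "ereal (real n + \<alpha> i) \<le> packing_dim (K - F)" for i
      by (rule packing_dim_slab_ge[OF c[of i] \<alpha>[of i] dim_n R(1)[of i] _ _ C_def[of i] SK[of i, unfolded S_def] clK F])
        (rule expand osc; assumption)+
    then show "ereal (real n + 1) \<le> packing_dim (K - F)"
      by (intro ereal_le_of_harmonic_approx) (simp add: \<alpha>_def)
  qed

  \<comment> \<open>Fibres over points other than the image of the origin\<close>
  have fiber_cover: "\<exists>N. fiber K f y \<subseteq> (\<Union>i<N. S i)"
    if f: "continuous_on K f" and y: "y \<noteq> f 0" for f :: "real ^ 'm \<Rightarrow> real ^ 'n" and y
  proof -
    obtain d where d: "d > 0" "\<And>x. \<lbrakk>x \<in> K; dist x 0 < d\<rbrakk> \<Longrightarrow> dist (f x) (f 0) < dist y (f 0)"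
      using f K0 y unfolding continuous_on_iff by (metis zero_less_dist_iff)
    obtain N where N: "K \<subseteq> (\<Union>i<N. S i) \<union> cball 0 (d / 2)" using near0[of "d / 2"] d(1) by auto
    have "fiber K f y \<subseteq> (\<Union>i<N. S i)"
    proof
      fix x assume x: "x \<in> fiber K f y"
      then have "\<not> dist x 0 < d" using d(2)[of x] by (auto simp: fiber_def)
      then have "x \<notin> cball 0 (d / 2)" using d(1) by (simp add: dist_commute)
      then show "x \<in> (\<Union>i<N. S i)" using x N by (auto simp: fiber_def)
    qed
    then show ?thesis by blast
  qed
  have packing_fibers: "packing_dim (fiber K f y) < ereal (real n + 1)"
    if fy: "continuous_on K f" "y \<noteq> f 0" for f :: "real ^ 'm \<Rightarrow> real ^ 'n" and y
  proof -
    obtain N where N: "fiber K f y \<subseteq> (\<Union>i<N. S i)" using fiber_cover[OF fy] by blast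
    \<comment> \<open>Indices from \<open>N\<close> on contribute empty pieces, of upper box
      dimension \<open>-1\<close>; monotonicity of \<open>\<alpha>\<close> bounds all others by the
      exponent at \<open>N\<close>.\<close>
    have "packing_dim (fiber K f y) \<le> ereal (real n + \<alpha> N)"
    proof (rule packing_dim_le[of _ "\<lambda>i. if i < N then fiber K f y \<inter> S i else {}"])
      show "fiber K f y = (\<Union>i. if i < N then fiber K f y \<inter> S i else {})" using N by auto
      show "upper_box_dim (if i < N then fiber K f y \<inter> S i else {}) \<le> ereal (real n + \<alpha> N)" for i
        using packing_SK[of "fiber K f y \<inter> S i" i N] packing_SK[of "{}" N N] by auto
    qed (use \<alpha>(1)[of N] in simp)
    also have "\<dots> < ereal (real n + 1)" using \<alpha>(2)[of N] by simp
    finally show ?thesis .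
  qed

  \<comment> \<open>Hausdorff dimension of generic fibres\<close>
  define s where "s N = (\<alpha> N + 1) / 2" for N
  have s: "0 < s N" "s N < 1" "\<alpha> N < s N" for N
    using \<alpha>[of N] by (auto simp: s_def field_simps)
  \<comment> \<open>The exponent \<open>s N\<close> lies strictly between \<open>\<alpha> N\<close>
    and \<open>1\<close> and serves all pieces \<open>i \<le> N\<close> together. Triples make the
    exceptional sets one countable family, with empty members for \<open>i > N\<close>. As
    \<open>k\<close> controls both the scale and the size of the premeasure, avoiding all members
    gives measure zero on each piece.\<close>
  define E where "E = (\<lambda>(i, N, k). {f \<in> mspace (C_metric K :: (real ^ 'm \<Rightarrow> real ^ 'n) metric).
      i \<le> N \<and> (\<exists>y. \<not> hausdorff_premeasure (s N) (1 / real (Suc k)) (fiber (S i) f y) \<le> ennreal (1 / real (Suc k)))})"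
  have E_nd: "nowhere_dense_in (mtopology_of (C_metric K)) (E p)" for p
  proof -
    obtain i N k where p: "p = (i, N, k)" by (cases p)
    show ?thesis
    proof (cases "i \<le> N")
      case True
      have S1: "S i \<subseteq> slab m0 (C i) 1"
        using R(2)[of i] by (auto simp: S_def slab_def intro: order_trans)
      have "\<alpha> i < s N" using \<alpha>_mono[OF True] s(3)[of N] by linarith
      then show ?thesis
        using nowhere_dense_large_fibers[OF compK SK S1 bbC _ s(1) _ dim, of N "1 / real (Suc k)"] True
        by (simp add: E_def p)
    next
      case False
      then show ?thesis by (simp add: E_def p nowhere_dense_in_def)
    qed
  qed
  have generic: "for_generic_C K (\<lambda>f :: real ^ 'm \<Rightarrow> real ^ 'n. \<forall>y. y \<noteq> f 0 \<longrightarrow> hausdorff_dim (fiber K f y) < 1)"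
    unfolding for_generic_C_def
  proof (rule comeager_inI)
    show "countable (range E)" by simp
    show "nowhere_dense_in (mtopology_of (C_metric K)) M" if "M \<in> range E" for M
      using that E_nd by blast
    show "topspace (mtopology_of (C_metric K)) -
        {f \<in> mspace (C_metric K). \<forall>y. y \<noteq> f 0 \<longrightarrow> hausdorff_dim (fiber K f y) < 1} \<subseteq> \<Union> (range E)"
    proof (rule subsetI, rule ccontr)
      fix f :: "real ^ 'm \<Rightarrow> real ^ 'n"
      assume f: "f \<in> topspace (mtopology_of (C_metric K)) -
          {f \<in> mspace (C_metric K). \<forall>y. y \<noteq> f 0 \<longrightarrow> hausdorff_dim (fiber K f y) < 1}"
        and fE: "f \<notin> \<Union> (range E)"
      from f have fm: "f \<in> mspace (C_metric K)" by simp
      from f fm obtain y where y: "y \<noteq> f 0" "\<not> hausdorff_dim (fiber K f y) < 1" by blast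
      have fc: "continuous_on K f" using fm by (simp add: mspace_C_metric[OF compK])
      obtain N where N: "fiber K f y \<subseteq> (\<Union>i<N. S i)" using fiber_cover[OF fc y(1)] by blast
      have small: "hausdorff_premeasure (s N) (1 / real (Suc k)) (fiber (S i) f y) \<le> ennreal (1 / real (Suc k))"
        if "i \<le> N" for i k
      proof -
        have "f \<notin> E (i, N, k)" using fE by blast
        then show ?thesis using fm that by (simp add: E_def)
      qed
      have zero: "hausdorff_measure (s N) (fiber (S i) f y) = 0" if "i \<le> N" for i
      proof (rule hausdorff_measure_eq_0I)
        fix \<delta> \<eta> :: real assume "\<delta> > 0" "\<eta> > 0"
        then obtain k where k: "1 / real (Suc k) < min \<delta> \<eta>" using nat_approx_posE[of "min \<delta> \<eta>"] by auto
        have "hausdorff_premeasure (s N) \<delta> (fiber (S i) f y)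
            \<le> hausdorff_premeasure (s N) (1 / real (Suc k)) (fiber (S i) f y)"
          by (rule hausdorff_premeasure_antimono) (use k in simp)
        also have "\<dots> \<le> ennreal (1 / real (Suc k))" by (rule small[OF that])
        also have "\<dots> \<le> ennreal \<eta>" by (rule ennreal_leI) (use k in simp)
        finally show "hausdorff_premeasure (s N) \<delta> (fiber (S i) f y) \<le> ennreal \<eta>" .
      qed
      have "hausdorff_measure (s N) (\<Union>i. if i < N then fiber (S i) f y else {}) = 0"
        by (rule hausdorff_measure_UN_eq_0)
          (use zero in \<open>auto intro!: hausdorff_measure_eq_0I simp: hausdorff_premeasure_empty\<close>)
      also have "(\<Union>i. if i < N then fiber (S i) f y else {}) = fiber K f y"
        using N SK by (auto simp: fiber_def split: if_splits)
      finally have "hausdorff_dim (fiber K f y) \<le> ereal (s N)" using s(1)[of N] by (intro hausdorff_dim_le) auto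
      also have "\<dots> < 1" using s(2)[of N] by (simp add: one_ereal_def)
      finally show False using y(2) by simp
    qed
  qed auto
  show ?thesis
  proof (intro exI[of _ K] exI[of _ "\<lambda>f. f 0"] conjI ballI allI impI)
    show "compact K" by (rule compK)
    show "d_hausdorff CARD('n) K = 1" using dH_lower dH_upper by (simp add: n_def)
    show "d_packing CARD('n) K = ereal (real (CARD('n) + 1))"
      using dP_lower dP_upper by (simp add: n_def)
    show "for_generic_C K (\<lambda>f :: real ^ 'm \<Rightarrow> real ^ 'n. \<forall>y. y \<noteq> f 0 \<longrightarrow> hausdorff_dim (fiber K f y) < 1)"
      by (rule generic)
    fix f :: "real ^ 'm \<Rightarrow> real ^ 'n" and y
    assume "f \<in> mspace (C_metric K)" "y \<noteq> f 0"
    then show "packing_dim (fiber K f y) < ereal (real (CARD('n) + 1))"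
      using packing_fibers[of f y] by (simp add: mspace_C_metric[OF compK] n_def add.commute)
  qed
qed

end
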